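(* Let $\ell\equiv 3\pmod 4$ be a prime such that $(\ell-1)/2\in\mathbf{R}_{\mathbb{Q}(\zeta_\ell)/\mathbb{Q}}$. Then $h_\ell^+$, the class number of the maximal real subfield of $\mathbb{Q}(\zeta_\ell)$, is a power of $2$.
   Context: Here $\zeta_\ell$ is a primitive $\ell$-th root of unity. For a Galois extension of number fields $L/K$, the residue degree of a prime ideal $\wp$ of $L$ above a prime $\mathfrak{p}$ of $K$ is $[\mathcal{O}_L/\wp:\mathcal{O}_K/\mathfrak{p}]$, and $$\mathbf{R}_{L/K}=\{f\in\mathbb{N}: \text{the class group of } L \text{ is generated by the classes of prime ideals of } L \text{ that are unramified over } K \text{ and have residue degree } f \text{ for } L/K\}.$$ Powers of $2$ include $2^0=1$. *)

theory Defs
  imports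
    Complex_Main
    "HOL-Computational_Algebra.Computational_Algebra"
    "HOL-Algebra.Algebra"
    "HOL-Algebra.Algebraic_Closure_Type"
begin

text \<open>
  Number fields are realised as subfields of the complex numbers, that is, as sets
  \<open>K :: complex set\<close> containing \<open>\<rat>\<close> and of finite degree over \<open>\<rat>\<close>. The definitions
  below take arbitrary sets, but are meant only for number fields \<open>K \<subseteq> L\<close>.
\<close>

abbreviation complex_ring :: "complex ring" where
  "complex_ring \<equiv> ring_of_type_algebra"

definition primitive_root_of_unity :: "nat \<Rightarrow> complex \<Rightarrow> bool" where
  "primitive_root_of_unity n z \<longleftrightarrow> n > 0 \<and> z ^ n = 1 \<and> (\<forall>k. 0 < k \<and> k < n \<longrightarrow> z ^ k \<noteq> 1)"

definition rat_adjoin :: "complex \<Rightarrow> complex set" where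
  "rat_adjoin z = generate_field complex_ring (\<rat> \<union> {z})"

definition maximal_real_subfield :: "complex set \<Rightarrow> complex set" where
  "maximal_real_subfield L = L \<inter> \<real>"

definition integers_of :: "complex set \<Rightarrow> complex set" where
  "integers_of K = {x \<in> K. algebraic_int x}"

definition ring_of_integers :: "complex set \<Rightarrow> complex ring" where
  "ring_of_integers K = complex_ring \<lparr>carrier := integers_of K\<rparr>"


section \<open>The class group\<close>

definition fractional_ideal :: "complex set \<Rightarrow> complex set \<Rightarrow> bool" where
  "fractional_ideal K I \<longleftrightarrow>
     additive_subgroup I (complex_ring \<lparr>carrier := K\<rparr>) \<and>
     (\<forall>a \<in> integers_of K. \<forall>x \<in> I. a * x \<in> I) \<and>
     I \<noteq> {0} \<and>
     (\<exists>d \<in> integers_of K. d \<noteq> 0 \<and> (\<forall>x \<in> I. d * x \<in> integers_of K))"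

text \<open>
  The product of two fractional ideals consists of the finite sums of products of their
  elements; this is \<^const>\<open>ideal_prod\<close> taken in the ambient ring of complex numbers.
\<close>

definition fractional_ideal_group :: "complex set \<Rightarrow> complex set monoid" where
  "fractional_ideal_group K =
     \<lparr>carrier = {I. fractional_ideal K I}, monoid.mult = ideal_prod complex_ring, one = integers_of K\<rparr>"

definition principal_fractional_ideals :: "complex set \<Rightarrow> complex set set" where
  "principal_fractional_ideals K = {(\<lambda>a. x * a) ` integers_of K | x. x \<in> K \<and> x \<noteq> 0}"

definition class_group :: "complex set \<Rightarrow> complex set set monoid" where
  "class_group K = fractional_ideal_group K Mod principal_fractional_ideals K"

definition ideal_class :: "complex set \<Rightarrow> complex set \<Rightarrow> complex set set" where
  "ideal_class K I = principal_fractional_ideals K #>\<^bsub>fractional_ideal_group K\<^esub> I"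

definition class_number :: "complex set \<Rightarrow> nat" where
  "class_number K = Coset.order (class_group K)"


section \<open>Primes in extensions\<close>

text \<open>
  A prime of a number field is a nonzero prime ideal of its ring of integers. The prime of
  \<open>K\<close> below a prime \<open>P\<close> of \<open>L\<close> is \<open>P \<inter> integers_of K\<close>.
\<close>

definition prime_of :: "complex set \<Rightarrow> complex set \<Rightarrow> bool" where
  "prime_of L P \<longleftrightarrow> primeideal P (ring_of_integers L) \<and> P \<noteq> {0}"

text \<open>The exponent of \<open>P\<close> in the factorisation of the extension to \<open>L\<close> of the prime below \<open>P\<close>.\<close>

definition ramification_index :: "complex set \<Rightarrow> complex set \<Rightarrow> complex set \<Rightarrow> nat" where
  "ramification_index L K P =
     (GREATEST e::nat. \<exists>J. ideal J (ring_of_integers L) \<and>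
        Idl\<^bsub>ring_of_integers L\<^esub> (P \<inter> integers_of K) =
        (P [^]\<^bsub>fractional_ideal_group L\<^esub> e) \<cdot>\<^bsub>ring_of_integers L\<^esub> J)"

text \<open>Residue field extensions of number fields are separable, so no further condition is needed.\<close>

definition unramified :: "complex set \<Rightarrow> complex set \<Rightarrow> complex set \<Rightarrow> bool" where
  "unramified L K P \<longleftrightarrow> ramification_index L K P = 1"

text \<open>
  The residue field of \<open>K\<close> at the prime below \<open>P\<close> is identified with its image in the
  residue field of \<open>L\<close> at \<open>P\<close>, which consists of the classes of the elements of \<open>integers_of K\<close>.
\<close>

definition residue_degree :: "complex set \<Rightarrow> complex set \<Rightarrow> complex set \<Rightarrow> nat" where
  "residue_degree L K P =
     (let kP = ring_of_integers L Quot P;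
          kp = (\<lambda>x. P +>\<^bsub>ring_of_integers L\<^esub> x) ` integers_of K
      in ring.dim kP kp (carrier kP))"

definition R_set :: "complex set \<Rightarrow> complex set \<Rightarrow> nat set" where
  "R_set L K =
     {f. generate (class_group L)
           {ideal_class L P | P. prime_of L P \<and> unramified L K P \<and> residue_degree L K P = f}
         = carrier (class_group L)}"

end

theory Submission
  imports Defs "Jordan_Normal_Form.Char_Poly"
begin

text \<open>
  Write \<open>L\<close> for the cyclotomic field and \<open>f = (l - 1) / 2\<close>, which is odd. Let \<open>P\<close> be a prime of \<open>L\<close>
  of residue degree \<open>f\<close>. If \<open>P\<close> lies above \<open>l\<close>, it is generated by \<open>1 - \<zeta>\<close>. Otherwise complex
  conjugation cannot fix \<open>P\<close>, since it would act nontrivially on the residue field, whose degree is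
  odd; comparing the cardinalities of the quotients by \<open>p\<close>, \<open>P\<close> and its conjugate \<open>P'\<close> then gives
  \<open>P P' = (p)\<close>. In both cases \<open>P P'\<close> is generated by a real element. If such primes generate the class
  group, then \<open>I I'\<close> has a real generator for every fractional ideal \<open>I\<close> of \<open>L\<close>; for \<open>I\<close> extended
  from an ideal \<open>A\<close> of the maximal real subfield this says that \<open>A\<^sup>2\<close> is principal. So the class
  group of the real subfield is a finite group of exponent at most 2.

  The invertibility of ideals and the finiteness of the class group come from Hurwitz's argument:
  division with remainder for some bounded multiple of the dividend shows that there are only
  finitely many ideal classes, so two powers of an ideal are in the same class, and Nakayama's
  lemma lets one cancel.
\<close>

section \<open>Algebraic integers\<close>

text \<open>The generator of \<open>I I'\<close> has to be real, not merely an element of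
  \<open>L\<close>. If \<open>I\<close> extends an ideal \<open>A\<close> of the real subfield, then
  \<open>A^2 O_L = x O_L\<close>; for real \<open>x\<close> the quotient \<open>x^(-1) A^2\<close>
  is still an ideal of the real subfield, its extension to \<open>L\<close> is trivial, and this
  forces it to be trivial itself. With \<open>x\<close> merely in \<open>L\<close>,
  \<open>A^2\<close> might become principal only in \<open>L\<close>. The cardinality count needs at
  most \<open>p^(l - 1)\<close> residues modulo \<open>p\<close>, hence the description of
  \<open>O_L\<close> as the integer polynomials in \<open>\<zeta>\<close>. This description and the
  independence of the powers of \<open>\<zeta>\<close> come from one fact: \<open>l\<close> is a
  unit times \<open>(1 - \<zeta>)^(l - 1)\<close>, so an integer polynomial of degree below
  \<open>l - 1\<close> whose value at \<open>\<zeta>\<close> is divisible by \<open>l\<close> has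
  all its coefficients divisible by \<open>l\<close>. On the other side of the count stand two
  residue fields of \<open>p^f\<close> elements each, and \<open>2 f = l - 1\<close>.\<close>

definition int_span :: "complex set \<Rightarrow> complex set" where
  "int_span B = range (\<lambda>c. \<Sum>b\<in>B. of_int (c b) * b)"

lemma int_spanI: "x = (\<Sum>b\<in>B. of_int (c b) * b) \<Longrightarrow> x \<in> int_span B"
  by (auto simp: int_span_def)

lemma int_spanE:
  assumes "x \<in> int_span B"
  obtains c where "x = (\<Sum>b\<in>B. of_int (c b) * b)"
  using assms by (auto simp: int_span_def)

lemma int_span_zero: "0 \<in> int_span B"
  by (rule int_spanI[where c = "\<lambda>_. 0"]) simp

lemma int_span_add:
  assumes "x \<in> int_span B" "y \<in> int_span B"
  shows "x + y \<in> int_span B"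
proof -
  from assms obtain c d where "x = (\<Sum>b\<in>B. of_int (c b) * b)" "y = (\<Sum>b\<in>B. of_int (d b) * b)"
    by (auto elim!: int_spanE)
  then show ?thesis
    by (intro int_spanI[where c = "\<lambda>b. c b + d b"]) (simp add: sum.distrib distrib_right)
qed

lemma int_span_smult:
  assumes "x \<in> int_span B"
  shows "of_int k * x \<in> int_span B"
proof -
  from assms obtain c where "x = (\<Sum>b\<in>B. of_int (c b) * b)"
    by (auto elim!: int_spanE)
  then show ?thesis
    by (intro int_spanI[where c = "\<lambda>b. k * c b"]) (simp add: sum_distrib_left mult.assoc)
qed

lemma int_span_sum: "(\<And>i. i \<in> I \<Longrightarrow> f i \<in> int_span B) \<Longrightarrow> (\<Sum>i\<in>I. f i) \<in> int_span B"
  by (induction I rule: infinite_finite_induct) (auto intro: int_span_zero int_span_add)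

text \<open>Finiteness matters: a sum over an infinite set is 0 by convention, so the span of an
  infinite \<open>B\<close> collapses to 0.\<close>

lemma int_span_base:
  assumes "finite B" "b \<in> B"
  shows "b \<in> int_span B"
proof (rule int_spanI)
  have "of_int (if b' = b then 1 else 0) * b' = (if b' = b then b else 0)" for b' :: complex
    by simp
  with assms show "b = (\<Sum>b'\<in>B. of_int (if b' = b then 1 else 0) * b')"
    by simp
qed

text \<open>\<open>x\<close> is an eigenvalue of an integer matrix, hence a root of its
  characteristic polynomial, which is monic with integer coefficients. The entries of
  \<open>v\<close> may be linearly dependent.\<close>

lemma algebraic_int_if_int_matrix:
  fixes v :: "nat \<Rightarrow> complex" and c :: "nat \<Rightarrow> nat \<Rightarrow> int"
  assumes eq: "\<And>i. i < n \<Longrightarrow> x * v i = (\<Sum>j<n. of_int (c i j) * v j)"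
    and nz: "i0 < n" "v i0 \<noteq> 0"
  shows "algebraic_int x"
proof -
  define C where "C = mat n n (\<lambda>(i, j). c i j)"
  have C: "C \<in> carrier_mat n n" by (simp add: C_def)
  let ?C = "of_int_hom.mat_hom C :: complex mat"
  have "eigenvector ?C (vec n v) x"
  proof -
    have "vec n v \<noteq> 0\<^sub>v n"
      using nz by (metis index_vec index_zero_vec(1))
    moreover have "?C *\<^sub>v vec n v = x \<cdot>\<^sub>v vec n v"
      by (rule eq_vecI)
        (use eq in \<open>auto simp: C_def scalar_prod_def lessThan_atLeast0 intro!: sum.cong\<close>)
    ultimately show ?thesis
      by (simp add: eigenvector_def C_def)
  qed
  then have "poly (char_poly ?C) x = 0"
    using eigenvalue_root_char_poly[of ?C n x] C by (auto simp: eigenvalue_def)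
  then have "poly (map_poly of_int (char_poly C)) x = 0"
    by (simp add: of_int_hom.char_poly_hom[OF C])
  moreover have "lead_coeff (char_poly C) = 1"
    using degree_monic_char_poly[OF C] by simp
  ultimately show ?thesis
    by (auto simp: algebraic_int_altdef_ipoly)
qed

text \<open>The determinant trick: multiplication by \<open>x\<close> on a finitely generated
  nonzero module is given by an integer matrix.\<close>

lemma algebraic_int_if_int_span_stable:
  assumes fin: "finite B" and nz: "b0 \<in> B" "b0 \<noteq> 0"
    and stable: "\<And>b. b \<in> B \<Longrightarrow> x * b \<in> int_span B"
  shows "algebraic_int x"
proof -
  obtain f where f: "bij_betw f {..<card B} B"
    using ex_bij_betw_nat_finite[OF fin] by (auto simp: lessThan_atLeast0)
  have "\<forall>b\<in>B. \<exists>c. x * b = (\<Sum>b'\<in>B. of_int (c b') * b')"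
    using stable by (metis int_spanE)
  then obtain c where c: "\<And>b. b \<in> B \<Longrightarrow> x * b = (\<Sum>b'\<in>B. of_int (c b b') * b')"
    by metis
  obtain i0 where "i0 < card B" "f i0 = b0"
    using f nz by (metis bij_betw_iff_bijections lessThan_iff)
  moreover have "x * f i = (\<Sum>j<card B. of_int (c (f i) (f j)) * f j)" if "i < card B" for i
  proof -
    have "f i \<in> B" using f that by (auto simp: bij_betw_def)
    then show ?thesis
      using sum.reindex_bij_betw[OF f, of "\<lambda>b'. of_int (c (f i) b') * b'"] c by simp
  qed
  ultimately show ?thesis
    using nz by (intro algebraic_int_if_int_matrix[of "card B" x f]) auto
qed

lemma algebraic_int_monic_relation:
  assumes "algebraic_int (x :: complex)"
  obtains n c where "n > 0" "x ^ n = (\<Sum>i<n. of_int (c i) * x ^ i)"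
proof -
  from assms obtain p where p: "poly (map_poly of_int p) x = 0" "lead_coeff p = 1"
    by (auto simp: algebraic_int_altdef_ipoly)
  define n where "n = degree p"
  have "degree (map_poly of_int p :: complex poly) = n"
    by (simp add: n_def)
  then have "(\<Sum>i\<le>n. of_int (coeff p i) * x ^ i) = 0"
    using p by (simp add: poly_altdef)
  then have 0: "x ^ n + (\<Sum>i<n. of_int (coeff p i) * x ^ i) = 0"
    using p by (simp add: n_def lessThan_Suc_atMost[symmetric] add.commute)
  have "n > 0"
  proof (rule ccontr)
    assume "\<not> n > 0"
    with 0 show False by simp
  qed
  moreover have "x ^ n = (\<Sum>i<n. of_int (- coeff p i) * x ^ i)"
    using 0 by (simp add: add_eq_0_iff2 sum_negf)
  ultimately show ?thesis
    by (rule that)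
qed

text \<open>Sums and products of \<open>x\<close> and \<open>y\<close> act on this module, hence are integral.\<close>

lemma algebraic_int_monomial_module:
  assumes "algebraic_int (x :: complex)" "algebraic_int y"
  obtains B where "finite B" "1 \<in> B"
    "\<And>b. b \<in> B \<Longrightarrow> x * b \<in> int_span B" "\<And>b. b \<in> B \<Longrightarrow> y * b \<in> int_span B"
proof -
  from assms obtain n c m d where n: "n > 0" "x ^ n = (\<Sum>i<n. of_int (c i) * x ^ i)"
    and m: "m > 0" "y ^ m = (\<Sum>i<m. of_int (d i) * y ^ i)"
    by (metis algebraic_int_monic_relation)
  define B where "B = (\<lambda>(i, j). x ^ i * y ^ j) ` ({..<n} \<times> {..<m})"
  have fin: "finite B" by (simp add: B_def)
  have mem: "x ^ i * y ^ j \<in> int_span B" if "i < n" "j < m" for i j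
    by (rule int_span_base[OF fin]) (use that in \<open>auto simp: B_def\<close>)
  have "1 \<in> B"
    using n m by (auto simp: B_def image_iff intro!: bexI[of _ 0])
  moreover have "x * b \<in> int_span B" if b: "b \<in> B" for b
  proof -
    from b obtain i j where ij: "i < n" "j < m" "b = x ^ i * y ^ j"
      by (auto simp: B_def)
    show ?thesis
    proof (cases "Suc i < n")
      case True
      then show ?thesis using mem[of "Suc i" j] ij by (simp add: mult.assoc)
    next
      \<comment> \<open>The exponent reaches \<open>n\<close>, and the monic relation for
        \<open>x\<close> rewrites \<open>x ^ n\<close> by lower powers.\<close>
      case False
      then have "Suc i = n" using ij by simp
      then have "x * b = x ^ n * y ^ j" using ij by (auto simp: mult.assoc)
      also have "\<dots> = (\<Sum>i<n. of_int (c i) * (x ^ i * y ^ j))"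
        by (simp add: n(2) sum_distrib_right mult.assoc)
      also have "\<dots> \<in> int_span B"
        using mem ij by (intro int_span_sum int_span_smult) auto
      finally show ?thesis .
    qed
  qed
  moreover have "y * b \<in> int_span B" if b: "b \<in> B" for b
  proof -
    from b obtain i j where ij: "i < n" "j < m" "b = x ^ i * y ^ j"
      by (auto simp: B_def)
    show ?thesis
    proof (cases "Suc j < m")
      case True
      then show ?thesis using mem[of i "Suc j"] ij by (simp add: mult_ac)
    next
      case False
      then have "Suc j = m" using ij by simp
      then have "y * b = y ^ m * x ^ i" using ij by (auto simp: mult_ac)
      also have "\<dots> = (\<Sum>j<m. of_int (d j) * (x ^ i * y ^ j))"
        by (simp add: m(2) sum_distrib_left sum_distrib_right mult_ac)
      also have "\<dots> \<in> int_span B"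
        using mem ij by (intro int_span_sum int_span_smult) auto
      finally show ?thesis .
    qed
  qed
  ultimately show ?thesis
    using fin that by blast
qed

lemma int_span_stable_mult:
  assumes "\<And>b. b \<in> B \<Longrightarrow> x * b \<in> int_span B" "y \<in> int_span B"
  shows "x * y \<in> int_span B"
proof -
  from assms(2) obtain c where "y = (\<Sum>b\<in>B. of_int (c b) * b)"
    by (rule int_spanE)
  then have "x * y = (\<Sum>b\<in>B. of_int (c b) * (x * b))"
    by (simp add: sum_distrib_left mult_ac)
  then show ?thesis
    using assms(1) by (auto intro!: int_span_sum int_span_smult)
qed

lemma algebraic_int_add:
  assumes "algebraic_int (x :: complex)" "algebraic_int y"
  shows "algebraic_int (x + y)"
proof -
  obtain B where B: "finite B" "1 \<in> B"
    "\<And>b. b \<in> B \<Longrightarrow> x * b \<in> int_span B" "\<And>b. b \<in> B \<Longrightarrow> y * b \<in> int_span B"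
    using algebraic_int_monomial_module[OF assms] by metis
  show ?thesis
    by (rule algebraic_int_if_int_span_stable[OF B(1,2)])
      (use B in \<open>auto simp: distrib_right intro: int_span_add\<close>)
qed

lemma algebraic_int_mult:
  assumes "algebraic_int (x :: complex)" "algebraic_int y"
  shows "algebraic_int (x * y)"
proof -
  obtain B where B: "finite B" "1 \<in> B"
    "\<And>b. b \<in> B \<Longrightarrow> x * b \<in> int_span B" "\<And>b. b \<in> B \<Longrightarrow> y * b \<in> int_span B"
    using algebraic_int_monomial_module[OF assms] by metis
  show ?thesis
    by (rule algebraic_int_if_int_span_stable[OF B(1,2)])
      (use B in \<open>auto simp: mult.assoc intro: int_span_stable_mult\<close>)
qed

lemma algebraic_int_diff:
  "algebraic_int (x :: complex) \<Longrightarrow> algebraic_int y \<Longrightarrow> algebraic_int (x - y)"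
  using algebraic_int_add[of x "- y"] by simp

lemma algebraic_int_of_int: "algebraic_int (of_int k :: complex)"
  by (rule int_imp_algebraic_int) simp

lemma algebraic_int_of_nat: "algebraic_int (of_nat k :: complex)"
  by (rule int_imp_algebraic_int) simp

lemma algebraic_int_one: "algebraic_int (1 :: complex)"
  by (rule int_imp_algebraic_int) simp

lemma algebraic_int_power: "algebraic_int (x :: complex) \<Longrightarrow> algebraic_int (x ^ n)"
  by (induction n) (auto intro: algebraic_int_mult algebraic_int_one)

lemma algebraic_int_sum:
  "(\<And>i. i \<in> I \<Longrightarrow> algebraic_int (f i :: complex)) \<Longrightarrow> algebraic_int (\<Sum>i\<in>I. f i)"
  by (induction I rule: infinite_finite_induct) (auto intro: algebraic_int_add)

lemma algebraic_int_prod: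
  "(\<And>i. i \<in> I \<Longrightarrow> algebraic_int (f i :: complex)) \<Longrightarrow> algebraic_int (\<Prod>i\<in>I. f i)"
  by (induction I rule: infinite_finite_induct)
    (auto intro: algebraic_int_mult algebraic_int_one)

lemmas algebraic_int_intros =
  algebraic_int_add algebraic_int_mult algebraic_int_diff algebraic_int_minus algebraic_int_cnj
  algebraic_int_of_int algebraic_int_of_nat algebraic_int_one algebraic_int_power
  algebraic_int_sum algebraic_int_prod

section \<open>Fractional ideals\<close>

lemma complex_ring_simps:
  "carrier complex_ring = UNIV" "x \<otimes>\<^bsub>complex_ring\<^esub> y = x * y" "\<one>\<^bsub>complex_ring\<^esub> = 1"
  "\<zero>\<^bsub>complex_ring\<^esub> = 0" "x \<oplus>\<^bsub>complex_ring\<^esub> y = x + y"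
  by (simp_all add: ring_of_type_algebra_def)

lemma complex_ring_field: "Ring.field complex_ring"
  by (rule field_from_type_algebra)

section \<open>Products and scalings of sets of complex numbers\<close>

abbreviation ideal_mult :: "complex set \<Rightarrow> complex set \<Rightarrow> complex set" (infixl "\<star>" 70) where
  "I \<star> J \<equiv> ideal_prod complex_ring I J"

lemma ideal_mult_prod: "i \<in> I \<Longrightarrow> j \<in> J \<Longrightarrow> i * j \<in> I \<star> J"
  using ideal_prod.prod[of i I j J complex_ring] by (simp add: complex_ring_simps)

lemma ideal_mult_sum: "a \<in> I \<star> J \<Longrightarrow> b \<in> I \<star> J \<Longrightarrow> a + b \<in> I \<star> J"
  using ideal_prod.sum[of a complex_ring I J b] by (simp add: complex_ring_simps)

lemma ideal_mult_induct [consumes 1, case_names prod sum]: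
  assumes "x \<in> I \<star> J"
    and "\<And>i j. i \<in> I \<Longrightarrow> j \<in> J \<Longrightarrow> P (i * j)"
    and "\<And>a b. a \<in> I \<star> J \<Longrightarrow> b \<in> I \<star> J \<Longrightarrow> P a \<Longrightarrow> P b \<Longrightarrow> P (a + b)"
  shows "P x"
  using assms(1)
  by (induction rule: ideal_prod.induct) (auto simp: complex_ring_simps assms(2,3))

lemma ideal_mult_subsetI:
  assumes "\<And>i j. i \<in> I \<Longrightarrow> j \<in> J \<Longrightarrow> i * j \<in> H" "\<And>a b. a \<in> H \<Longrightarrow> b \<in> H \<Longrightarrow> a + b \<in> H"
  shows "I \<star> J \<subseteq> H"
proof
  fix x assume "x \<in> I \<star> J"
  then show "x \<in> H" by (induction rule: ideal_mult_induct) (auto intro: assms)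
qed

lemma ideal_mult_mono: "I \<subseteq> I' \<Longrightarrow> J \<subseteq> J' \<Longrightarrow> I \<star> J \<subseteq> I' \<star> J'"
  by (rule ideal_mult_subsetI) (auto intro: ideal_mult_prod ideal_mult_sum)

lemma ideal_mult_commute: "I \<star> J = J \<star> I"
proof -
  have "I \<star> J \<subseteq> J \<star> I" for I J
  proof (rule ideal_mult_subsetI)
    fix i j assume "i \<in> I" "j \<in> J"
    then show "i * j \<in> J \<star> I" using ideal_mult_prod[of j J i I] by (simp add: mult.commute)
  qed (rule ideal_mult_sum)
  then show ?thesis by blast
qed

lemma ideal_mult_assoc: "(I \<star> J) \<star> H = I \<star> (J \<star> H)"
proof
  show "(I \<star> J) \<star> H \<subseteq> I \<star> (J \<star> H)"
  proof (rule ideal_mult_subsetI)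
    fix x h assume "x \<in> I \<star> J" and h: "h \<in> H"
    then show "x * h \<in> I \<star> (J \<star> H)"
      by (induction rule: ideal_mult_induct)
        (auto simp: mult.assoc distrib_right intro: ideal_mult_prod ideal_mult_sum h)
  qed (rule ideal_mult_sum)
  show "I \<star> (J \<star> H) \<subseteq> (I \<star> J) \<star> H"
  proof (rule ideal_mult_subsetI)
    fix i x assume "x \<in> J \<star> H" and i: "i \<in> I"
    then show "i * x \<in> (I \<star> J) \<star> H"
      by (induction rule: ideal_mult_induct)
        (auto simp: mult.assoc[symmetric] distrib_left intro: ideal_mult_prod ideal_mult_sum i)
  qed (rule ideal_mult_sum)
qed

abbreviation scaled :: "complex \<Rightarrow> complex set \<Rightarrow> complex set" where
  "scaled x I \<equiv> (\<lambda>a. x * a) ` I"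

lemma scaled_ideal_mult: "scaled x I \<star> J = scaled x (I \<star> J)"
proof
  show "scaled x I \<star> J \<subseteq> scaled x (I \<star> J)"
  proof (rule ideal_mult_subsetI)
    fix i j assume "i \<in> scaled x I" "j \<in> J"
    then show "i * j \<in> scaled x (I \<star> J)"
      by (auto simp: mult.assoc intro!: imageI ideal_mult_prod)
  next
    fix a b assume "a \<in> scaled x (I \<star> J)" "b \<in> scaled x (I \<star> J)"
    then show "a + b \<in> scaled x (I \<star> J)"
      by (auto simp: distrib_left[symmetric] intro!: imageI ideal_mult_sum)
  qed
  show "scaled x (I \<star> J) \<subseteq> scaled x I \<star> J"
  proof
    fix y assume "y \<in> scaled x (I \<star> J)"
    then obtain a where a: "a \<in> I \<star> J" "y = x * a" by blast
    from a(1) have "x * a \<in> scaled x I \<star> J"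
    proof (induction rule: ideal_mult_induct)
      case (prod i j)
      then show ?case using ideal_mult_prod[OF imageI, of i I j J "(*) x"] by (simp add: mult.assoc)
    next
      case (sum a b)
      then show ?case by (simp add: distrib_left ideal_mult_sum)
    qed
    then show "y \<in> scaled x I \<star> J" using a by simp
  qed
qed

lemma scaled_ideal_mult_right: "I \<star> scaled x J = scaled x (I \<star> J)"
  by (metis ideal_mult_commute scaled_ideal_mult)

lemma scaled_scaled: "scaled x (scaled y I) = scaled (x * y) I"
  by (simp add: image_image mult.assoc)

lemma scaled_one: "scaled 1 I = I"
  by simp

text \<open>Abstracts what \<open>L\<close> and its real subfield share, so that the ideal theory is
  developed once. The maps \<open>\<sigma> z\<close> are embeddings of \<open>K\<close>, possibly
  repeated: the real subfield is given the same index set, where complex conjugate roots yield the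
  same embedding, so that its \<open>norm_abs\<close> is the square of the usual absolute norm. This
  is harmless, since the norm only serves to measure remainders. The factor \<open>m\<close> in
  \<open>finitely_generated\<close> spares the construction of an integral basis of the real
  subfield.\<close>

locale number_ring =
  fixes K :: "complex set" and Z :: "'i set" and \<sigma> :: "'i \<Rightarrow> complex \<Rightarrow> complex"
  assumes K_Rats: "q \<in> \<rat> \<Longrightarrow> q \<in> K"
    and K_add: "x \<in> K \<Longrightarrow> y \<in> K \<Longrightarrow> x + y \<in> K"
    and K_mult: "x \<in> K \<Longrightarrow> y \<in> K \<Longrightarrow> x * y \<in> K"
    and K_inverse: "x \<in> K \<Longrightarrow> inverse x \<in> K"
    and denominator: "x \<in> K \<Longrightarrow> \<exists>d::nat. d > 0 \<and> algebraic_int (of_nat d * x)"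
    and Z: "finite Z" "Z \<noteq> {}"
    and \<sigma>_add: "z \<in> Z \<Longrightarrow> x \<in> K \<Longrightarrow> y \<in> K \<Longrightarrow> \<sigma> z (x + y) = \<sigma> z x + \<sigma> z y"
    and \<sigma>_mult: "z \<in> Z \<Longrightarrow> x \<in> K \<Longrightarrow> y \<in> K \<Longrightarrow> \<sigma> z (x * y) = \<sigma> z x * \<sigma> z y"
    and \<sigma>_Rats: "z \<in> Z \<Longrightarrow> q \<in> \<rat> \<Longrightarrow> \<sigma> z q = q"
    and norm_nat: "x \<in> integers_of K \<Longrightarrow> \<exists>n::nat. (\<Prod>z\<in>Z. cmod (\<sigma> z x)) = real n"
    and finitely_generated: "\<exists>E m. finite E \<and> E \<subseteq> integers_of K \<and> m > 0 \<and>
      (\<forall>x\<in>integers_of K. of_nat m * x \<in> int_span E)"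
begin

abbreviation R :: "complex set" where "R \<equiv> integers_of K"

abbreviation frac :: "complex set \<Rightarrow> bool" where "frac \<equiv> fractional_ideal K"

definition norm_abs :: "complex \<Rightarrow> real" where
  "norm_abs x = (\<Prod>z\<in>Z. cmod (\<sigma> z x))"

lemma K_zero: "0 \<in> K" and K_one: "1 \<in> K" and K_of_int: "of_int i \<in> K" and K_of_nat: "of_nat n \<in> K"
  by (auto intro: K_Rats)

lemma K_uminus: "x \<in> K \<Longrightarrow> - x \<in> K"
  using K_mult[of "of_int (-1)" x] K_of_int[of "-1"] by simp

lemma K_diff: "x \<in> K \<Longrightarrow> y \<in> K \<Longrightarrow> x - y \<in> K"
  using K_add[of x "- y"] K_uminus by simp

lemma K_divide: "x \<in> K \<Longrightarrow> y \<in> K \<Longrightarrow> x / y \<in> K"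
  using K_mult[of x "inverse y"] K_inverse by (simp add: divide_inverse)

lemma K_sum: "(\<And>i. i \<in> I \<Longrightarrow> f i \<in> K) \<Longrightarrow> (\<Sum>i\<in>I. f i) \<in> K"
  by (induction I rule: infinite_finite_induct) (auto intro: K_zero K_add)

lemma R_K: "x \<in> R \<Longrightarrow> x \<in> K"
  by (simp add: integers_of_def)

lemma R_add: "x \<in> R \<Longrightarrow> y \<in> R \<Longrightarrow> x + y \<in> R"
  and R_mult: "x \<in> R \<Longrightarrow> y \<in> R \<Longrightarrow> x * y \<in> R"
  and R_uminus: "x \<in> R \<Longrightarrow> - x \<in> R"
  and R_diff: "x \<in> R \<Longrightarrow> y \<in> R \<Longrightarrow> x - y \<in> R"
  and R_of_int: "of_int i \<in> R"
  and R_of_nat: "of_nat n \<in> R"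
  and R_one: "1 \<in> R"
  and R_zero: "0 \<in> R"
  by (auto simp: integers_of_def intro: K_add K_mult K_uminus K_diff K_of_int K_of_nat K_one K_zero
      algebraic_int_intros)

lemma R_sum: "(\<And>i. i \<in> I \<Longrightarrow> f i \<in> R) \<Longrightarrow> (\<Sum>i\<in>I. f i) \<in> R"
  by (induction I rule: infinite_finite_induct) (auto intro: R_zero R_add)

lemma R_power: "x \<in> R \<Longrightarrow> x ^ n \<in> R"
  by (induction n) (auto intro: R_one R_mult)

lemma int_span_R: "E \<subseteq> R \<Longrightarrow> x \<in> int_span E \<Longrightarrow> x \<in> R"
  by (auto elim!: int_spanE intro!: R_sum R_mult R_of_int)

lemma frac_iff:
  "frac I \<longleftrightarrow> I \<subseteq> K \<and> 0 \<in> I \<and> (\<forall>x\<in>I. \<forall>y\<in>I. x + y \<in> I) \<and> (\<forall>a\<in>R. \<forall>x\<in>I. a * x \<in> I) \<and>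
     (\<exists>x\<in>I. x \<noteq> 0) \<and> (\<exists>d\<in>R. d \<noteq> 0 \<and> (\<forall>x\<in>I. d * x \<in> R))"
proof -
  have inv: "inv\<^bsub>add_monoid (complex_ring\<lparr>carrier := K\<rparr>)\<^esub> x = - x" if "x \<in> K" for x
    unfolding m_inv_def
    by (rule the_equality)
      (use that in \<open>auto simp: ring_of_type_algebra_def K_uminus eq_neg_iff_add_eq_0 add.commute\<close>)
  have "additive_subgroup I (complex_ring\<lparr>carrier := K\<rparr>) \<longleftrightarrow>
      I \<subseteq> K \<and> 0 \<in> I \<and> (\<forall>x\<in>I. \<forall>y\<in>I. x + y \<in> I) \<and> (\<forall>x\<in>I. - x \<in> I)"
    unfolding additive_subgroup_def subgroup_def using inv
    by (auto simp: ring_of_type_algebra_def subset_iff)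
  moreover have "(\<forall>x\<in>I. - x \<in> I)" if "\<forall>a\<in>R. \<forall>x\<in>I. a * x \<in> I"
    using that R_of_int[of "-1"] by fastforce
  ultimately show ?thesis
    unfolding fractional_ideal_def by auto
qed

lemma fracI:
  assumes "I \<subseteq> K" "0 \<in> I" "\<And>x y. x \<in> I \<Longrightarrow> y \<in> I \<Longrightarrow> x + y \<in> I"
    "\<And>a x. a \<in> R \<Longrightarrow> x \<in> I \<Longrightarrow> a * x \<in> I" "x0 \<in> I" "x0 \<noteq> 0"
    "d \<in> R" "d \<noteq> 0" "\<And>x. x \<in> I \<Longrightarrow> d * x \<in> R"
  shows "frac I"
  unfolding frac_iff using assms by (intro conjI ballI bexI[of _ x0] bexI[of _ d]) auto

lemma
  assumes "frac I"
  shows frac_K: "x \<in> I \<Longrightarrow> x \<in> K"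
    and frac_zero: "0 \<in> I"
    and frac_add: "x \<in> I \<Longrightarrow> y \<in> I \<Longrightarrow> x + y \<in> I"
    and frac_mult: "a \<in> R \<Longrightarrow> x \<in> I \<Longrightarrow> a * x \<in> I"
    and frac_uminus: "x \<in> I \<Longrightarrow> - x \<in> I"
    and frac_diff: "x \<in> I \<Longrightarrow> y \<in> I \<Longrightarrow> x - y \<in> I"
    and frac_nonzero: "\<exists>x\<in>I. x \<noteq> 0"
    and frac_denominator: "\<exists>d\<in>R. d \<noteq> 0 \<and> (\<forall>x\<in>I. d * x \<in> R)"
proof -
  note * = assms[unfolded frac_iff]
  show "x \<in> I \<Longrightarrow> x \<in> K" "0 \<in> I" "\<exists>x\<in>I. x \<noteq> 0" "\<exists>d\<in>R. d \<noteq> 0 \<and> (\<forall>x\<in>I. d * x \<in> R)"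
    using * by (blast+)
  show add: "x + y \<in> I" if "x \<in> I" "y \<in> I" for x y
    using * that by blast
  show mult: "a * x \<in> I" if "a \<in> R" "x \<in> I" for a x
    using * that by blast
  show uminus: "- x \<in> I" if "x \<in> I" for x
    using mult[OF R_of_int[of "-1"] that] by simp
  show "x - y \<in> I" if "x \<in> I" "y \<in> I"
    using add[OF that(1) uminus[OF that(2)]] by simp
qed

lemma frac_R: "frac R"
  unfolding frac_iff
  by (auto intro: R_K R_zero R_add R_mult R_one intro!: bexI[of _ 1])

lemma frac_scaled:
  assumes "frac I" "x \<in> K" "x \<noteq> 0"
  shows "frac (scaled x I)"
proof -
  obtain d where d: "d \<in> R" "d \<noteq> 0" "\<forall>a\<in>I. d * a \<in> R" using frac_denominator[OF assms(1)] by blast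
  obtain e :: nat where e: "e > 0" "algebraic_int (of_nat e * x)" using denominator[OF assms(2)] by blast
  \<comment> \<open>\<open>x\<close> need not be integral, so its own denominator \<open>e\<close>
    joins the denominator \<open>d\<close> of \<open>I\<close>.\<close>
  have ex: "of_nat e * x \<in> R" using e assms(2) by (simp add: integers_of_def K_mult K_of_nat)
  have R: "of_nat e * d * (x * a) \<in> R" if "a \<in> I" for a
    using R_mult[OF ex, of "d * a"] d that by (simp add: mult_ac)
  obtain x0 where x0: "x0 \<in> I" "x0 \<noteq> 0" using frac_nonzero[OF assms(1)] by blast
  show ?thesis
  proof (rule fracI)
    show "scaled x I \<subseteq> K" using frac_K[OF assms(1)] assms(2) by (auto intro: K_mult)
    show "0 \<in> scaled x I" using frac_zero[OF assms(1)] by (rule rev_image_eqI) simp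
    show "y + z \<in> scaled x I" if "y \<in> scaled x I" "z \<in> scaled x I" for y z
      using that frac_add[OF assms(1)] by (auto simp: distrib_left[symmetric])
    show "a * y \<in> scaled x I" if a: "a \<in> R" and "y \<in> scaled x I" for a y
    proof -
      from that obtain b where b: "b \<in> I" "y = x * b" by auto
      show ?thesis using frac_mult[OF assms(1) a b(1)] by (rule rev_image_eqI) (simp add: b(2))
    qed
    show "x * x0 \<in> scaled x I" "x * x0 \<noteq> 0" using x0 assms(3) by auto
    show "of_nat e * d \<in> R" "of_nat e * d \<noteq> 0" using R_mult[OF R_of_nat d(1)] d e by auto
    show "of_nat e * d * y \<in> R" if "y \<in> scaled x I" for y using R that by auto
  qed
qed

lemma frac_ideal_mult:
  assumes I: "frac I" and J: "frac J"
  shows "frac (I \<star> J)"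
proof -
  obtain d where d: "d \<in> R" "d \<noteq> 0" "\<forall>x\<in>I. d * x \<in> R" using frac_denominator[OF I] by blast
  obtain e where e: "e \<in> R" "e \<noteq> 0" "\<forall>x\<in>J. e * x \<in> R" using frac_denominator[OF J] by blast
  have R: "d * e * x \<in> R" if "x \<in> I \<star> J" for x
    using that
  proof (induction rule: ideal_mult_induct)
    case (prod i j)
    then show ?case using R_mult[of "d * i" "e * j"] d e by (simp add: mult_ac)
  qed (auto simp: distrib_left R_add)
  obtain x where x: "x \<in> I" "x \<noteq> 0" using frac_nonzero[OF I] by blast
  obtain y where y: "y \<in> J" "y \<noteq> 0" using frac_nonzero[OF J] by blast
  show ?thesis
  proof (rule fracI)
    show "I \<star> J \<subseteq> K"
      by (rule ideal_mult_subsetI) (auto intro: K_mult K_add frac_K[OF I] frac_K[OF J])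
    show "0 \<in> I \<star> J" using ideal_mult_prod[OF frac_zero[OF I] frac_zero[OF J]] by simp
    show "a + b \<in> I \<star> J" if "a \<in> I \<star> J" "b \<in> I \<star> J" for a b
      using that by (rule ideal_mult_sum)
    show "a * b \<in> I \<star> J" if a: "a \<in> R" and b: "b \<in> I \<star> J" for a b
      using b
    proof (induction rule: ideal_mult_induct)
      case (prod i j)
      then show ?case
        using ideal_mult_prod[of "a * i" I j J] frac_mult[OF I a] by (simp add: mult.assoc)
    qed (simp add: distrib_left ideal_mult_sum)
    show "x * y \<in> I \<star> J" "x * y \<noteq> 0" using x y by (auto intro: ideal_mult_prod)
    show "d * e \<in> R" "d * e \<noteq> 0" using d e R_mult by auto
  qed (rule R)
qed

lemma ideal_mult_R:
  assumes "frac I"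
  shows "I \<star> R = I" "R \<star> I = I"
proof -
  have "R \<star> I \<subseteq> I"
    by (rule ideal_mult_subsetI) (auto intro: frac_mult[OF assms] frac_add[OF assms])
  moreover have "I \<subseteq> R \<star> I"
    using ideal_mult_prod[OF R_one, of _ I] by auto
  ultimately show "R \<star> I = I" by blast
  then show "I \<star> R = I" by (simp add: ideal_mult_commute)
qed

lemma \<sigma>_sum:
  assumes "z \<in> Z" "\<And>i. i \<in> I \<Longrightarrow> f i \<in> K"
  shows "\<sigma> z (\<Sum>i\<in>I. f i) = (\<Sum>i\<in>I. \<sigma> z (f i))"
  using assms(2)
  by (induction I rule: infinite_finite_induct)
    (auto simp: \<sigma>_add[OF assms(1)] K_sum \<sigma>_Rats[OF assms(1)])

lemma norm_abs_mult: "x \<in> K \<Longrightarrow> y \<in> K \<Longrightarrow> norm_abs (x * y) = norm_abs x * norm_abs y"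
  by (simp add: norm_abs_def \<sigma>_mult norm_mult prod.distrib)

lemma norm_abs_pos:
  assumes "x \<in> K" "x \<noteq> 0"
  shows "norm_abs x > 0"
proof -
  have "\<sigma> z x \<noteq> 0" if "z \<in> Z" for z
    using \<sigma>_mult[OF that assms(1) K_inverse[OF assms(1)]] \<sigma>_Rats[OF that, of 1] assms(2) by auto
  then show ?thesis by (auto simp: norm_abs_def intro!: prod_pos)
qed

end

section \<open>Finiteness of the set of ideal classes and invertibility\<close>

lemma norm_of_rat: "cmod (of_rat q) = of_rat \<bar>q\<bar>"
proof -
  have "(of_rat q :: complex) = of_real (of_rat q)"
    by (cases q) (simp add: of_rat_rat)
  then show ?thesis by (simp add: abs_if of_rat_minus)
qed

context number_ring
begin

text \<open>Pigeonhole on the fractional parts of the coordinates of the multiples of \<open>\<alpha>\<close>.\<close>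

lemma hurwitz:
  "\<exists>M>0. \<forall>\<alpha>\<in>K. \<exists>t::nat. 0 < t \<and> t \<le> M \<and> (\<exists>\<omega>\<in>R. norm_abs (of_nat t * \<alpha> - \<omega>) < 1)"
proof -
  obtain E m where E: "finite E" "E \<subseteq> R" and m: "m > 0" "\<forall>x\<in>R. of_nat m * x \<in> int_span E"
    using finitely_generated by blast
  \<comment> \<open>\<open>C\<close> bounds every conjugate of a combination of \<open>E\<close>
    with coefficients of size at most 1. Coefficients of size at most \<open>1 / r\<close> with
    \<open>r > C\<close> therefore make every conjugate smaller than 1.\<close>
  define C where "C = (\<Sum>z\<in>Z. \<Sum>e\<in>E. cmod (\<sigma> z e))"
  obtain r :: nat where r: "real r > C" using reals_Archimedean2 by blast
  have C: "C \<ge> 0" by (auto simp: C_def intro!: sum_nonneg)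
  with r have r0: "r > 0" by linarith
  have "\<exists>t::nat. 0 < t \<and> t \<le> r ^ card E \<and> (\<exists>\<omega>\<in>R. norm_abs (of_nat t * \<alpha> - \<omega>) < 1)"
    if \<alpha>: "\<alpha> \<in> K" for \<alpha>
  proof -
    obtain d :: nat where d: "d > 0" "algebraic_int (of_nat d * \<alpha>)"
      using denominator[OF \<alpha>] by blast
    then have "of_nat d * \<alpha> \<in> R"
      using \<alpha> by (simp add: integers_of_def K_mult K_of_nat)
    with m obtain c where c: "of_nat m * (of_nat d * \<alpha>) = (\<Sum>e\<in>E. of_int (c e) * e)"
      by (metis int_spanE)
    define q :: "complex \<Rightarrow> rat" where "q e = of_int (c e) / of_nat (m * d)" for e
    have "\<alpha> = (\<Sum>e\<in>E. of_int (c e) * e) / of_nat (m * d)"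
      using m d by (simp add: c[symmetric])
    also have "\<dots> = (\<Sum>e\<in>E. of_rat (q e) * e)"
      by (simp add: q_def sum_divide_distrib of_rat_divide of_rat_mult)
    finally have \<alpha>_eq: "\<alpha> = (\<Sum>e\<in>E. of_rat (q e) * e)" .
    \<comment> \<open>\<open>g t\<close> records, for each coordinate of \<open>t \<alpha>\<close>,
      which of the \<open>r\<close> equal subintervals of \<open>[0, 1)\<close> contains its
      fractional part.\<close>
    define g :: "nat \<Rightarrow> complex \<Rightarrow> nat" where
      "g t = (\<lambda>e\<in>E. nat \<lfloor>of_nat r * Archimedean_Field.frac (of_nat t * q e)\<rfloor>)" for t
    have "g t \<in> E \<rightarrow>\<^sub>E {..<r}" for t
    proof -
      have "nat \<lfloor>of_nat r * Archimedean_Field.frac (of_nat t * q e)\<rfloor> < r" for e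
      proof -
        have "of_nat r * Archimedean_Field.frac (of_nat t * q e) < of_nat r * 1"
          using r0 by (intro mult_strict_left_mono frac_lt_1) auto
        then have "\<lfloor>of_nat r * Archimedean_Field.frac (of_nat t * q e)\<rfloor> < int r"
          by (simp add: floor_less_iff)
        then show ?thesis using r0 by linarith
      qed
      then show ?thesis by (auto simp: g_def)
    qed
    then have "g ` {..r ^ card E} \<subseteq> E \<rightarrow>\<^sub>E {..<r}" by blast
    then have "card (g ` {..r ^ card E}) \<le> r ^ card E"
      using card_mono[of "E \<rightarrow>\<^sub>E {..<r}"] E(1) by (simp add: card_PiE finite_PiE)
    \<comment> \<open>There are \<open>r ^ card E\<close> boxes, but \<open>r ^ card E + 1\<close>
      values of \<open>t\<close>, since 0 is included.\<close>
    then have "\<not> inj_on g {..r ^ card E}"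
      using card_image[of g "{..r ^ card E}"] by auto
    then obtain t1 t2 where t: "t1 < t2" "t2 \<le> r ^ card E" "g t1 = g t2"
      by (auto simp: inj_on_def) (metis linorder_neqE_nat)
    \<comment> \<open>Integer parts go into \<open>\<omega>\<close>, fractional parts into
      \<open>\<delta>\<close>: the coordinates of \<open>(t2 - t1) \<alpha> - \<omega>\<close> are
      the \<open>\<delta> e\<close>, each of size at most \<open>1 / r\<close> because both
      fractional parts lie in the same subinterval.\<close>
    define \<delta> where "\<delta> e = Archimedean_Field.frac (of_nat t2 * q e)
        - Archimedean_Field.frac (of_nat t1 * q e)" for e
    define \<omega> :: complex where
      "\<omega> = (\<Sum>e\<in>E. of_int (\<lfloor>of_nat t2 * q e\<rfloor> - \<lfloor>of_nat t1 * q e\<rfloor>) * e)"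
    have \<omega>: "\<omega> \<in> R"
      unfolding \<omega>_def using E(2) by (intro R_sum R_mult R_of_int) auto
    have \<delta>_small: "\<bar>\<delta> e\<bar> * of_nat r \<le> 1" if "e \<in> E" for e
    proof -
      let ?x = "of_nat r * Archimedean_Field.frac (of_nat t2 * q e)"
      let ?y = "of_nat r * Archimedean_Field.frac (of_nat t1 * q e)"
      have "nat \<lfloor>?x\<rfloor> = nat \<lfloor>?y\<rfloor>"
        using fun_cong[OF t(3), of e] that by (simp add: g_def)
      moreover have "\<lfloor>?x\<rfloor> \<ge> 0" "\<lfloor>?y\<rfloor> \<ge> 0" by (simp_all add: frac_ge_0)
      ultimately have "\<lfloor>?x\<rfloor> = \<lfloor>?y\<rfloor>" by linarith
      then have "\<bar>?x - ?y\<bar> \<le> 1" by linarith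
      moreover have "?x - ?y = of_nat r * \<delta> e" by (simp add: \<delta>_def right_diff_distrib)
      ultimately show ?thesis by (simp add: abs_mult mult.commute)
    qed
    have "of_nat (t2 - t1) * \<alpha> - \<omega> =
        (\<Sum>e\<in>E. (of_nat (t2 - t1) * of_rat (q e) - of_int (\<lfloor>of_nat t2 * q e\<rfloor> - \<lfloor>of_nat t1 * q e\<rfloor>)) * e)"
      unfolding \<omega>_def by (subst \<alpha>_eq) (simp add: sum_distrib_left sum_subtractf left_diff_distrib mult.assoc)
    also have "\<dots> = (\<Sum>e\<in>E. of_rat (\<delta> e) * e)"
    proof (rule sum.cong[OF refl])
      fix e
      have "of_nat (t2 - t1) * of_rat (q e) - of_int (\<lfloor>of_nat t2 * q e\<rfloor> - \<lfloor>of_nat t1 * q e\<rfloor>)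
          = (of_rat (\<delta> e) :: complex)"
        using t(1) by (simp add: \<delta>_def Archimedean_Field.frac_def of_rat_diff of_rat_mult of_nat_diff
            of_rat_add algebra_simps)
      then show "(of_nat (t2 - t1) * of_rat (q e) - of_int (\<lfloor>of_nat t2 * q e\<rfloor> - \<lfloor>of_nat t1 * q e\<rfloor>)) * e
          = of_rat (\<delta> e) * e" by simp
    qed
    finally have eq: "of_nat (t2 - t1) * \<alpha> - \<omega> = (\<Sum>e\<in>E. of_rat (\<delta> e) * e)" .
    have small: "cmod (\<sigma> z (of_nat (t2 - t1) * \<alpha> - \<omega>)) < 1" if z: "z \<in> Z" for z
    proof -
      have "\<sigma> z (of_nat (t2 - t1) * \<alpha> - \<omega>) = (\<Sum>e\<in>E. of_rat (\<delta> e) * \<sigma> z e)"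
      proof -
        have eK: "e \<in> K" "of_rat (\<delta> e) * e \<in> K" if "e \<in> E" for e
          using that E(2) K_mult[OF K_Rats[OF Rats_of_rat] R_K] by (auto intro: R_K)
        have "\<sigma> z (of_rat (\<delta> e) * e) = of_rat (\<delta> e) * \<sigma> z e" if "e \<in> E" for e
          using that eK by (simp add: \<sigma>_mult[OF z] \<sigma>_Rats[OF z] K_Rats)
        then show ?thesis
          unfolding eq by (subst \<sigma>_sum[OF z]) (auto intro: eK)
      qed
      then have "cmod (\<sigma> z (of_nat (t2 - t1) * \<alpha> - \<omega>)) \<le> (\<Sum>e\<in>E. cmod (of_rat (\<delta> e) * \<sigma> z e))"
        using norm_sum by metis
      then have "cmod (\<sigma> z (of_nat (t2 - t1) * \<alpha> - \<omega>)) * real r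
          \<le> (\<Sum>e\<in>E. cmod (of_rat (\<delta> e) * \<sigma> z e)) * real r"
        by (rule mult_right_mono) simp
      also have "\<dots> = (\<Sum>e\<in>E. of_rat (\<bar>\<delta> e\<bar> * of_nat r) * cmod (\<sigma> z e))"
        by (simp add: sum_distrib_left sum_distrib_right norm_mult norm_of_rat of_rat_mult mult_ac)
      also have "\<dots> \<le> (\<Sum>e\<in>E. 1 * cmod (\<sigma> z e))"
      proof (intro sum_mono mult_right_mono)
        fix e assume "e \<in> E"
        then have "of_rat (\<bar>\<delta> e\<bar> * of_nat r) \<le> (of_rat 1 :: real)"
          by (simp only: of_rat_less_eq \<delta>_small)
        then show "of_rat (\<bar>\<delta> e\<bar> * of_nat r) \<le> (1 :: real)" by simp
      qed simp
      also have "\<dots> \<le> C"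
        using member_le_sum[OF z, of "\<lambda>z. \<Sum>e\<in>E. cmod (\<sigma> z e)"] Z(1)
        by (simp add: C_def sum_nonneg)
      finally have "cmod (\<sigma> z (of_nat (t2 - t1) * \<alpha> - \<omega>)) * real r < 1 * real r"
        using r by simp
      then show ?thesis using r0 by simp
    qed
    have "norm_abs (of_nat (t2 - t1) * \<alpha> - \<omega>) < (\<Prod>z\<in>Z. 1)"
      unfolding norm_abs_def
      using Z small by (intro prod_mono_strict[of "SOME z. z \<in> Z"]) (auto simp: some_in_eq intro: less_imp_le)
    then show ?thesis
      using t \<omega> by (intro exI[of _ "t2 - t1"]) auto
  qed
  then show ?thesis using r0 by (intro exI[of _ "r ^ card E"]) auto
qed

text \<open>Equivalently, \<open>J\<close> is an ideal with
  \<open>k R \<subseteq> J \<subseteq> R\<close>; these inclusions leave finitely many possibilities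
  for \<open>J\<close>.\<close>

definition normalized :: "nat \<Rightarrow> complex set \<Rightarrow> bool" where
  "normalized k J \<longleftrightarrow> frac J \<and> J \<subseteq> R \<and> of_nat k \<in> J"

text \<open>Let \<open>\<beta>\<close> be a nonzero element of \<open>I\<close> of minimal norm. For
  \<open>\<alpha>\<close> in \<open>I\<close>, \<open>hurwitz\<close> applied to
  \<open>\<alpha> / \<beta>\<close> yields \<open>t \<alpha> - \<omega> \<beta>\<close> in
  \<open>I\<close> of smaller norm, hence 0, so \<open>t \<alpha> / \<beta>\<close> is integral with
  \<open>t \<le> M\<close>. As \<open>t\<close> divides \<open>M!\<close>, the ideal
  \<open>(M! / \<beta>) I\<close> lies in \<open>R\<close>, and it contains \<open>M!\<close> as the
  image of \<open>\<beta>\<close>. The bound \<open>k = M!\<close> depends only on the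
  field.\<close>

lemma frac_normalize:
  "\<exists>k>0. \<forall>I. frac I \<longrightarrow> (\<exists>x J. x \<in> K \<and> x \<noteq> 0 \<and> normalized k J \<and> I = scaled x J)"
proof -
  obtain M :: nat where M: "M > 0"
    "\<And>\<alpha>. \<alpha> \<in> K \<Longrightarrow> \<exists>t. 0 < t \<and> t \<le> M \<and> (\<exists>\<omega>\<in>R. norm_abs (of_nat t * \<alpha> - \<omega>) < 1)"
    using hurwitz by blast
  have "\<exists>x J. x \<in> K \<and> x \<noteq> 0 \<and> normalized (fact M) J \<and> I = scaled x J"
    if I: "frac I" for I
  proof -
    obtain d where d: "d \<in> R" "d \<noteq> 0" "\<And>x. x \<in> I \<Longrightarrow> d * x \<in> R"
      using frac_denominator[OF I] by blast
    \<comment> \<open>Multiplied by the denominator \<open>d\<close>, the elements of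
      \<open>I\<close> are integral and their norms are natural numbers, so the floor loses nothing
      and a minimum exists.\<close>
    have "\<exists>\<beta>. (\<beta> \<in> I \<and> \<beta> \<noteq> 0) \<and>
        (\<forall>\<gamma>. \<gamma> \<in> I \<and> \<gamma> \<noteq> 0 \<longrightarrow> nat \<lfloor>norm_abs (d * \<beta>)\<rfloor> \<le> nat \<lfloor>norm_abs (d * \<gamma>)\<rfloor>)"
      using frac_nonzero[OF I] ex_has_least_nat[of "\<lambda>\<beta>. \<beta> \<in> I \<and> \<beta> \<noteq> 0" _ "\<lambda>\<beta>. nat \<lfloor>norm_abs (d * \<beta>)\<rfloor>"]
      by blast
    then obtain \<beta> where \<beta>: "\<beta> \<in> I" "\<beta> \<noteq> 0"
      and min: "\<And>\<gamma>. \<gamma> \<in> I \<Longrightarrow> \<gamma> \<noteq> 0 \<Longrightarrow> nat \<lfloor>norm_abs (d * \<beta>)\<rfloor> \<le> nat \<lfloor>norm_abs (d * \<gamma>)\<rfloor>"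
      by blast
    have \<beta>K: "\<beta> \<in> K" using frac_K[OF I \<beta>(1)] .
    have mult: "of_nat (fact M) / \<beta> * \<alpha> \<in> R" if \<alpha>: "\<alpha> \<in> I" for \<alpha>
    proof -
      have \<alpha>K: "\<alpha> \<in> K" using frac_K[OF I \<alpha>] .
      obtain t \<omega> where t: "0 < t" "t \<le> M" and \<omega>: "\<omega> \<in> R" "norm_abs (of_nat t * (\<alpha> / \<beta>) - \<omega>) < 1"
        using M(2)[OF K_divide[OF \<alpha>K \<beta>K]] by blast
      define \<gamma> where "\<gamma> = of_nat t * \<alpha> - \<omega> * \<beta>"
      have \<gamma>: "\<gamma> \<in> I"
        unfolding \<gamma>_def using \<alpha> \<beta> \<omega> by (intro frac_diff[OF I] frac_mult[OF I] R_of_nat)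
      have "\<gamma> = 0"
      proof (rule ccontr)
        assume "\<gamma> \<noteq> 0"
        have eq: "d * \<gamma> = (d * \<beta>) * (of_nat t * (\<alpha> / \<beta>) - \<omega>)"
          using \<beta>(2) by (simp add: \<gamma>_def field_simps)
        have d\<beta>: "d * \<beta> \<in> K" using R_K[OF d(1)] \<beta>K by (rule K_mult)
        have quot: "of_nat t * (\<alpha> / \<beta>) - \<omega> \<in> K"
          using K_diff[OF K_mult[OF K_of_nat K_divide[OF \<alpha>K \<beta>K]] R_K[OF \<omega>(1)]] .
        have "norm_abs (d * \<beta>) > 0"
          using d \<beta> by (intro norm_abs_pos[OF d\<beta>]) auto
        then have "norm_abs (d * \<gamma>) < norm_abs (d * \<beta>)"
          unfolding eq norm_abs_mult[OF d\<beta> quot] using \<omega>(2) by simp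
        moreover obtain a b :: nat where "norm_abs (d * \<gamma>) = real a" "norm_abs (d * \<beta>) = real b"
          using norm_nat[OF d(3)[OF \<gamma>]] norm_nat[OF d(3)[OF \<beta>(1)]] by (auto simp: norm_abs_def)
        ultimately show False using min[OF \<gamma> \<open>\<gamma> \<noteq> 0\<close>] by simp
      qed
      then have quot: "of_nat t * (\<alpha> / \<beta>) = \<omega>" using \<beta>(2) by (simp add: \<gamma>_def field_simps)
      obtain s where "fact M = t * s"
        using dvd_fact[of t M] t by (auto elim: dvdE)
      then have "of_nat (fact M) = (of_nat s * of_nat t :: complex)"
        by (metis mult.commute of_nat_mult)
      then have "of_nat (fact M) / \<beta> * \<alpha> = of_nat s * (of_nat t * (\<alpha> / \<beta>))" by simp
      also note quot
      finally have "of_nat (fact M) / \<beta> * \<alpha> = of_nat s * \<omega>" .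
      then show ?thesis using R_mult[OF R_of_nat \<omega>(1)] by simp
    qed
    let ?y = "of_nat (fact M) / \<beta>"
    have y: "?y \<in> K" "?y \<noteq> 0" using K_divide[OF K_of_nat \<beta>K] \<beta>(2) by (simp_all del: of_nat_fact)
    have "normalized (fact M) (scaled ?y I)"
      unfolding normalized_def
    proof (intro conjI)
      show "frac (scaled ?y I)" by (rule frac_scaled[OF I y])
      show "scaled ?y I \<subseteq> R" using mult by blast
      show "of_nat (fact M) \<in> scaled ?y I" by (rule image_eqI[OF _ \<beta>(1)]) (simp add: \<beta>(2))
    qed
    moreover have "I = scaled (inverse ?y) (scaled ?y I)"
      unfolding scaled_scaled using left_inverse[OF y(2)] by simp
    ultimately show ?thesis
      using K_inverse[OF y(1)] nonzero_imp_inverse_nonzero[OF y(2)]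
      by (intro exI[of _ "inverse ?y"] exI[of _ "scaled ?y I"] conjI)
  qed
  then show ?thesis by (intro exI[of _ "fact M"]) (simp add: fact_gt_zero)
qed

text \<open>\<open>S\<close> represents \<open>R\<close> modulo \<open>k\<close> times the span of
  \<open>E\<close>, a finer relation than congruence modulo \<open>k R\<close>. The finer form
  exhibits finitely many additive generators in \<open>frac_finitely_generated\<close>.\<close>

definition residues :: "complex set \<Rightarrow> nat \<Rightarrow> complex set \<Rightarrow> bool" where
  "residues E k S \<longleftrightarrow> finite S \<and> S \<subseteq> R \<and>
     (\<forall>x\<in>R. \<exists>s\<in>S. \<exists>y\<in>int_span E. x = s + of_nat k * y)"

text \<open>The known integer coordinates are those of \<open>m x\<close>, so they are reduced
  modulo \<open>m k\<close>: if two elements agree there, cancelling \<open>m\<close> leaves a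
  difference in \<open>k\<close> times the span of \<open>E\<close>. One \<open>E\<close> serves all
  \<open>k\<close>.\<close>

lemma finite_residues: "\<exists>E. finite E \<and> E \<subseteq> R \<and> (\<forall>k>0. \<exists>S. residues E k S)"
proof -
  obtain E m where E: "finite E" "E \<subseteq> R" and m: "m > 0" "\<forall>x\<in>R. of_nat m * x \<in> int_span E"
    using finitely_generated by blast
  have "\<forall>x\<in>R. \<exists>c. of_nat m * x = (\<Sum>e\<in>E. of_int (c e) * e)"
    using m(2) by (auto elim: int_spanE)
  then obtain c where "\<forall>x\<in>R. of_nat m * x = (\<Sum>e\<in>E. of_int (c x e) * e)"
    by (rule bchoice[THEN exE])
  then have c: "of_nat m * x = (\<Sum>e\<in>E. of_int (c x e) * e)" if "x \<in> R" for x
    using that by blast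
  have res: "\<exists>S. residues E k S"
    if k: "k > 0" for k :: nat
  proof -
    define f where "f x = (\<lambda>e\<in>E. c x e mod int (m * k))" for x
    have "f ` R \<subseteq> E \<rightarrow>\<^sub>E {0..<int (m * k)}"
      using m k by (auto simp: f_def)
    then have fin: "finite (f ` R)"
      by (rule finite_subset) (simp add: finite_PiE E(1))
    define S where "S = inv_into R f ` f ` R"
    have rep: "\<exists>y\<in>int_span E. x = inv_into R f (f x) + of_nat k * y" if x: "x \<in> R" for x
    proof -
      define s where "s = inv_into R f (f x)"
      have s: "s \<in> R" "f s = f x"
        using x by (auto simp: s_def inv_into_into f_inv_into_f)
      have dvd: "int (m * k) dvd c x e - c s e" if "e \<in> E" for e
        using fun_cong[OF s(2), of e] that mod_eq_dvd_iff[of "c x e" "int (m * k)" "c s e"]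
        by (simp add: f_def)
      define g where "g e = (c x e - c s e) div int (m * k)" for e
      have g: "c x e - c s e = int (m * k) * g e" if "e \<in> E" for e
        unfolding g_def by (rule dvd_mult_div_cancel[OF dvd[OF that], symmetric])
      have "of_nat m * (x - s) = (\<Sum>e\<in>E. of_int (c x e - c s e) * e)"
        by (simp add: right_diff_distrib c x s sum_subtractf left_diff_distrib)
      also have "\<dots> = of_nat m * (of_nat k * (\<Sum>e\<in>E. of_int (g e) * e))"
        by (simp add: g sum_distrib_left mult.assoc)
      finally have "x - s = of_nat k * (\<Sum>e\<in>E. of_int (g e) * e)" using m(1) by simp
      then have "x = s + of_nat k * (\<Sum>e\<in>E. of_int (g e) * e)" by (simp add: algebra_simps)
      then show ?thesis unfolding s_def by (blast intro: int_spanI)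
    qed
    have "\<exists>s\<in>S. \<exists>y\<in>int_span E. x = s + of_nat k * y" if "x \<in> R" for x
      using rep[OF that] that unfolding S_def by (metis image_eqI)
    moreover have "S \<subseteq> R" by (auto simp: S_def inv_into_into)
    moreover have "finite S" using fin by (simp add: S_def)
    ultimately show ?thesis unfolding residues_def by (intro exI[of _ S] conjI ballI)
  qed
  show ?thesis by (intro exI[of _ E] conjI allI impI E res)
qed

text \<open>Since \<open>J\<close> contains \<open>k R\<close>, it is a union of residue classes and
  is determined by the subset \<open>J \<inter> S\<close> of the finite set
  \<open>S\<close>.\<close>

lemma finite_normalized:
  assumes "k > 0"
  shows "finite {J. normalized k J}" (is "finite ?A")
  unfolding normalized_def
proof -
  let ?A = "{J. frac J \<and> J \<subseteq> R \<and> of_nat k \<in> J}"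
  obtain E S where E: "E \<subseteq> R" and "residues E k S"
    using finite_residues assms by blast
  then have S: "finite S" "S \<subseteq> R" "x \<in> R \<Longrightarrow> \<exists>s\<in>S. \<exists>y\<in>int_span E. x = s + of_nat k * y" for x
    by (simp_all add: residues_def)
  have sub: "J \<subseteq> J'" if J: "J \<in> ?A" and J': "J' \<in> ?A" and eq: "J \<inter> S = J' \<inter> S" for J J'
  proof
    fix x assume x: "x \<in> J"
    then obtain s y where s: "s \<in> S" and y: "y \<in> R" and xs: "x = s + of_nat k * y"
      using S(3)[of x] J int_span_R[OF E] by blast
    have "y * of_nat k \<in> J" "y * of_nat k \<in> J'" using J J' y by (auto intro: frac_mult)
    then have *: "of_nat k * y \<in> J" "of_nat k * y \<in> J'" by (simp_all add: mult.commute)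
    have "s = x - of_nat k * y" using xs by simp
    then have "s \<in> J" using frac_diff[of J x "of_nat k * y"] J x * by auto
    then have "s \<in> J'" using s eq by blast
    then show "x \<in> J'" using xs frac_add[of J' s] J' * by auto
  qed
  have "inj_on (\<lambda>J. J \<inter> S) ?A"
  proof (rule inj_onI)
    fix J J' assume "J \<in> ?A" "J' \<in> ?A" "J \<inter> S = J' \<inter> S"
    then show "J = J'" using sub[of J J'] sub[of J' J] by (intro equalityI) simp_all
  qed
  moreover have "finite ((\<lambda>J. J \<inter> S) ` ?A)"
    by (rule finite_subset[of _ "Pow S"]) (use S in auto)
  ultimately show "finite ?A" by (rule finite_imageD[rotated])
qed

text \<open>After normalization \<open>J\<close> contains \<open>k R\<close>, so
  \<open>J \<inter> S\<close> together with \<open>k E\<close> generates \<open>J\<close>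
  additively.\<close>

lemma frac_finitely_generated:
  assumes I: "frac I"
  shows "\<exists>F. finite F \<and> F \<subseteq> I \<and> I \<subseteq> int_span F"
proof -
  obtain k x J where k: "k > 0" and "normalized k J" and IJ: "I = scaled x J"
    using frac_normalize I by blast
  then have J: "frac J" "J \<subseteq> R" "of_nat k \<in> J" by (simp_all add: normalized_def)
  obtain E S where E: "finite E" "E \<subseteq> R" and "residues E k S"
    using finite_residues k by blast
  then have S: "finite S" "x \<in> R \<Longrightarrow> \<exists>s\<in>S. \<exists>y\<in>int_span E. x = s + of_nat k * y" for x
    by (simp_all add: residues_def)
  have kR: "of_nat k * y \<in> J" if "y \<in> R" for y
    using frac_mult[OF J(1) that J(3)] by (simp add: mult.commute)
  define F where "F = scaled x ((J \<inter> S) \<union> scaled (of_nat k) E)"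
  have fin: "finite F" using E S by (simp add: F_def)
  have "x * j \<in> int_span F" if j: "j \<in> J" for j
  proof -
    obtain s y where s: "s \<in> S" and y: "y \<in> int_span E" and js: "j = s + of_nat k * y"
      using S(2)[of j] j J by blast
    have "s = j - of_nat k * y" using js by simp
    then have "s \<in> J" using frac_diff[OF J(1) j kR[OF int_span_R[OF E(2) y]]] by simp
    then have "x * s \<in> int_span F" using s by (intro int_span_base[OF fin]) (auto simp: F_def)
    moreover have "x * (of_nat k * y) \<in> int_span F"
    proof -
      obtain c where "y = (\<Sum>e\<in>E. of_int (c e) * e)" using y by (rule int_spanE)
      then have "x * (of_nat k * y) = (\<Sum>e\<in>E. of_int (c e) * (x * (of_nat k * e)))"
        by (simp add: sum_distrib_left mult_ac)
      also have "\<dots> \<in> int_span F"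
        by (intro int_span_sum int_span_smult int_span_base[OF fin]) (auto simp: F_def)
      finally show ?thesis .
    qed
    ultimately show ?thesis using js by (simp add: distrib_left int_span_add)
  qed
  moreover have "F \<subseteq> I" using kR E(2) by (auto simp: F_def IJ)
  ultimately show ?thesis using fin IJ by blast
qed

text \<open>Multiplication by \<open>c\<close> preserves a finitely generated nonzero additive
  group, so the determinant trick applies.\<close>

lemma integral_if_stable:
  assumes D: "frac D" and c: "c \<in> K" "\<And>x. x \<in> D \<Longrightarrow> c * x \<in> D"
  shows "c \<in> R"
proof -
  obtain F where F: "finite F" "F \<subseteq> D" "D \<subseteq> int_span F"
    using frac_finitely_generated[OF D] by blast
  have "\<exists>b\<in>F. b \<noteq> 0"
  proof (rule ccontr)
    assume "\<not> (\<exists>b\<in>F. b \<noteq> 0)"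
    then have "int_span F \<subseteq> {0}" by (auto elim!: int_spanE intro!: sum.neutral)
    then show False using F(3) frac_nonzero[OF D] by blast
  qed
  then have "algebraic_int c"
    using algebraic_int_if_int_span_stable[OF F(1), of _ c] F(2,3) c(2) by blast
  then show ?thesis using c(1) by (simp add: integers_of_def)
qed

text \<open>Nakayama's lemma: the generators of \<open>D\<close> are eliminated one at a time, at the price of a
  factor congruent to 1 modulo \<open>C\<close>.\<close>

lemma nakayama:
  assumes D: "frac D" and C: "frac C" "C \<subseteq> R" and CD: "C \<star> D = D"
  shows "1 \<in> C"
proof -
  obtain F where F: "finite F" "F \<subseteq> D" "D \<subseteq> int_span F"
    using frac_finitely_generated[OF D] by blast
  define spn where "spn A G = {\<Sum>g\<in>G. a g * g | a. \<forall>g\<in>G. a g \<in> A}" for A G :: "complex set"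
  have spnI: "(\<Sum>g\<in>G. a g * g) \<in> spn A G" if "\<And>g. g \<in> G \<Longrightarrow> a g \<in> A" for a A G
    using that by (auto simp: spn_def)
  have spn_add: "x + y \<in> spn A G" if "frac A" "x \<in> spn A G" "y \<in> spn A G" for A G x y
  proof -
    from that obtain a b where "\<forall>g\<in>G. a g \<in> A" "\<forall>g\<in>G. b g \<in> A"
      "x = (\<Sum>g\<in>G. a g * g)" "y = (\<Sum>g\<in>G. b g * g)" by (auto simp: spn_def)
    then show ?thesis
      using spnI[of G "\<lambda>g. a g + b g" A] frac_add[OF that(1)] by (simp add: sum.distrib distrib_right)
  qed
  have spn_mult: "c * x \<in> spn A G" if "x \<in> spn R G" "c \<in> A" "frac A" for A G x c
  proof -
    from that obtain a where a: "\<forall>g\<in>G. a g \<in> R" and "x = (\<Sum>g\<in>G. a g * g)"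
      by (auto simp: spn_def)
    then have "c * x = (\<Sum>g\<in>G. (a g * c) * g)" by (simp add: sum_distrib_left mult_ac)
    also have "\<dots> \<in> spn A G"
      by (rule spnI) (use a frac_mult[OF that(3) _ that(2)] in blast)
    finally show ?thesis .
  qed
  \<comment> \<open>Invariant: up to a factor \<open>1 - b\<close> with \<open>b\<close> in
    \<open>C\<close>, the generators in \<open>G\<close> have become dispensable.\<close>
  have "\<exists>b\<in>C. \<forall>x\<in>D. (1 - b) * x \<in> spn R (F - G)" if "finite G" "G \<subseteq> F" for G
    using that
  proof (induction G rule: finite_induct)
    case empty
    have "x \<in> spn R F" if x: "x \<in> D" for x
    proof -
      obtain c where "x = (\<Sum>b\<in>F. of_int (c b) * b)" using F(3) x by (blast elim: int_spanE)
      then show ?thesis using spnI[of F "\<lambda>b. of_int (c b)" R] by (simp add: R_of_int)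
    qed
    then show ?case using frac_zero[OF C(1)] by (intro bexI[of _ 0]) auto
  next
    case (insert g G)
    then obtain b where b: "b \<in> C" "\<And>x. x \<in> D \<Longrightarrow> (1 - b) * x \<in> spn R (F - G)" by auto
    define H where "H = F - insert g G"
    have FG: "F - G = insert g H" and gH: "g \<notin> H" "finite H"
      using insert F(1) by (auto simp: H_def)
    have split: "\<exists>c\<in>A. \<exists>y\<in>spn A H. x = c * g + y" if "x \<in> spn A (F - G)" for x A
      using that gH unfolding FG by (auto simp: spn_def)
    \<comment> \<open>For elements of \<open>C \<star> D\<close>, which is \<open>D\<close> itself,
      the coefficients can even be taken in \<open>C\<close>; applied to the generator
      \<open>g\<close> this gives \<open>(1 - b) g = c g + y\<close> with \<open>c\<close> in
      \<open>C\<close>.\<close>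
    have CH: "(1 - b) * x \<in> spn C (F - G)" if "x \<in> C \<star> D" for x
      using that
    proof (induction rule: ideal_mult_induct)
      case (prod i j)
      then show ?case using spn_mult[OF b(2)[OF prod(2)] prod(1) C(1)] by (simp add: mult_ac)
    qed (simp add: distrib_left spn_add[OF C(1)])
    have "g \<in> D" using insert F(2) by blast
    then obtain c y where c: "c \<in> C" "y \<in> spn C H" "(1 - b) * g = c * g + y"
      using split[OF CH] CD by metis
    have yR: "y \<in> spn R H" using c(2) C(2) by (auto simp: spn_def)
    define u where "u = 1 - b - c"
    have bR: "b \<in> R" and cR: "c \<in> R" using b c C by auto
    then have uR: "u \<in> R" by (simp add: u_def R_diff R_one)
    have ug: "u * g = y" using c(3) by (simp add: u_def algebra_simps)
    \<comment> \<open>Chosen so that \<open>1 - b' = u (1 - b)\<close>: multiplication by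
      \<open>u = 1 - b - c\<close> turns \<open>g\<close> into \<open>y\<close>, which no longer
      involves \<open>g\<close>.\<close>
    define b' where "b' = b + (1 - b) * (b + c)"
    have "b' \<in> C"
      unfolding b'_def using b c bR by (intro frac_add[OF C(1)] frac_mult[OF C(1)] R_diff R_one)
    moreover have "(1 - b') * x \<in> spn R H" if x: "x \<in> D" for x
    proof -
      obtain a s where a: "a \<in> R" "s \<in> spn R H" "(1 - b) * x = a * g + s"
        using split[OF b(2)[OF x]] by blast
      have "(1 - b') * x = u * ((1 - b) * x)" by (simp add: u_def b'_def algebra_simps)
      also have "\<dots> = a * (u * g) + u * s" unfolding a(3) by (simp add: algebra_simps)
      also have "\<dots> = a * y + u * s" unfolding ug ..
      also have "\<dots> \<in> spn R H"
        using spn_add[OF frac_R] spn_mult[OF yR a(1) frac_R] spn_mult[OF a(2) uR frac_R] by blast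
      finally show ?thesis .
    qed
    ultimately show ?case unfolding H_def by blast
  qed
  \<comment> \<open>With all generators eliminated, \<open>1 - b\<close> annihilates the nonzero set
    \<open>D\<close>, so \<open>b = 1\<close>.\<close>
  from this[OF F(1) order_refl] obtain b where b: "b \<in> C" "\<And>x. x \<in> D \<Longrightarrow> (1 - b) * x = 0"
    by (auto simp: spn_def)
  then show ?thesis using frac_nonzero[OF D] by auto
qed

lemma frac_invertible:
  assumes I: "frac I"
  shows "\<exists>J. frac J \<and> I \<star> J = R"
proof -
  define pows where "pows = rec_nat R (\<lambda>_ Y. I \<star> Y)"
  have pows_0: "pows 0 = R" and pows_Suc: "pows (Suc n) = I \<star> pows n" for n by (simp_all add: pows_def)
  have fr: "frac (pows n)" for n
    by (induction n) (simp_all add: pows_def frac_ideal_mult[OF I] frac_R)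
  have pows_add: "pows (a + b) = pows a \<star> pows b" for a b :: nat
    by (induction a) (simp_all add: pows_0 pows_Suc ideal_mult_R fr ideal_mult_assoc)
  obtain k where k: "k > 0" and norm: "\<And>I. frac I \<Longrightarrow>
      \<exists>x J. x \<in> K \<and> x \<noteq> 0 \<and> normalized k J \<and> I = scaled x J"
    using frac_normalize by blast
  obtain x Q where xQ: "\<And>n. x n \<in> K" "\<And>n. x n \<noteq> 0" "\<And>n. normalized k (Q n)"
    "\<And>n. pows n = scaled (x n) (Q n)"
    using norm[OF fr] by metis
  have "\<not> inj_on Q UNIV"
  proof
    assume "inj_on Q UNIV"
    moreover have "finite (range Q)"
      by (rule finite_subset[OF _ finite_normalized[OF k]]) (use xQ(3) in auto)
    ultimately show False by (metis finite_imageD infinite_UNIV_nat)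
  qed
  then obtain i j where ij: "i < j" "Q i = Q j"
    by (auto simp: inj_on_def) (metis linorder_neqE_nat)
  \<comment> \<open>As \<open>Q i = Q j\<close>, scaling by \<open>\<omega>\<close> carries
    \<open>I^j\<close> to \<open>I^i\<close>. Hence \<open>C = \<omega> I^(j - i)\<close> satisfies
    \<open>C I^i = I^i\<close>; stability gives \<open>C \<subseteq> R\<close>, and Nakayama gives
    \<open>1 \<in> C\<close>.\<close>
  define \<omega> where "\<omega> = x i / x j"
  have \<omega>: "\<omega> \<in> K" "\<omega> \<noteq> 0" using xQ by (auto simp: \<omega>_def K_divide)
  define C where "C = scaled \<omega> (pows (j - i))"
  have C: "frac C" unfolding C_def by (rule frac_scaled[OF fr \<omega>])
  have "pows j = pows (j - i) \<star> pows i" using pows_add[of "j - i" i] ij by simp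
  then have "C \<star> pows i = scaled \<omega> (pows j)" by (simp add: C_def scaled_ideal_mult)
  also have "\<dots> = pows i"
    using xQ(2)[of j] unfolding xQ(4)[of i] xQ(4)[of j] scaled_scaled ij(2) \<omega>_def by simp
  finally have CD: "C \<star> pows i = pows i" .
  have "C \<subseteq> R"
  proof
    fix c assume c: "c \<in> C"
    show "c \<in> R"
      by (rule integral_if_stable[OF fr[of i] frac_K[OF C c]]) (metis CD c ideal_mult_prod)
  qed
  then have "1 \<in> C" using nakayama[OF fr C _ CD] by blast
  then have "R \<subseteq> C" using frac_mult[OF C, of _ 1] by auto
  with \<open>C \<subseteq> R\<close> have "C = R" by blast
  \<comment> \<open>Because \<open>i < j\<close>, one factor \<open>I\<close> splits off from
    \<open>C = R\<close>; the cofactor is the inverse.\<close>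
  moreover have "C = I \<star> scaled \<omega> (pows (j - i - 1))"
  proof -
    have "j - i = Suc (j - i - 1)" using ij by simp
    then have "pows (j - i) = I \<star> pows (j - i - 1)" by (metis pows_Suc)
    then show ?thesis by (simp add: C_def scaled_ideal_mult_right)
  qed
  ultimately show ?thesis
    by (intro exI[of _ "scaled \<omega> (pows (j - i - 1))"] conjI frac_scaled[OF fr \<omega>]) simp
qed

end

section \<open>The class group\<close>

text \<open>An odd prime \<open>q\<close> dividing the order would give, by Sylow's theorem with
  exponent 1, a subgroup of order \<open>q\<close>; there \<open>x^q = 1\<close> and
  \<open>x^2 = 1\<close> leave only the identity.\<close>

lemma (in group) order_power_of_two:
  assumes fin: "finite (carrier G)" and sq: "\<And>x. x \<in> carrier G \<Longrightarrow> x \<otimes> x = \<one>"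
  shows "\<exists>k. Coset.order G = 2 ^ k"
proof -
  have ord: "Coset.order G > 0" by (simp add: order_gt_0_iff_finite fin)
  obtain k m where km: "Coset.order G = 2 ^ k * m" "\<not> 2 dvd m"
    by (rule multiplicity_decompose'[of "Coset.order G" "2 :: nat"]) (use ord in simp_all)
  have "m = 1"
  proof (rule ccontr)
    assume "m \<noteq> 1"
    then obtain q where q: "Factorial_Ring.prime q" "q dvd m"
      using prime_factor_nat by blast
    then obtain m' where "Coset.order G = q ^ 1 * m'" using km by (auto elim!: dvdE)
    then obtain H where H: "subgroup H G" "card H = q ^ 1"
      using sylow_thm[OF q(1) group_axioms _ fin] by blast
    have "q > 1" using q(1) prime_gt_1_nat by blast
    then have "\<not> H \<subseteq> {\<one>}" using H(2) card_mono[of "{\<one>}" H] by auto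
    then obtain x where x: "x \<in> H" "x \<noteq> \<one>" by blast
    have xG: "x \<in> carrier G" using H(1) x(1) subgroup.subset by blast
    interpret HG: group "G\<lparr>carrier := H\<rparr>" using subgroup.subgroup_is_group[OF H(1)] group_axioms .
    have "x [^]\<^bsub>G\<lparr>carrier := H\<rparr>\<^esub> q = \<one>"
      using HG.pow_order_eq_1[of x] x(1) H(2) by (simp add: Coset.order_def)
    then have xq: "x [^] q = \<one>" by (simp add: nat_pow_consistent[symmetric])
    have "odd q" using q km(2) dvd_trans by blast
    then obtain r where "q = 2 * r + 1" by (rule oddE)
    then have "x [^] q = (x [^] (2 :: nat)) [^] r \<otimes> x"
      using xG by (simp add: nat_pow_pow)
    also have "x [^] (2 :: nat) = \<one>"
      using sq[OF xG] xG by (simp add: numeral_2_eq_2)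
    finally show False using xq x(2) xG by simp
  qed
  then show ?thesis using km by auto
qed

context number_ring
begin

abbreviation IG :: "complex set monoid" where "IG \<equiv> fractional_ideal_group K"

abbreviation PI :: "complex set set" where "PI \<equiv> principal_fractional_ideals K"

lemma IG_simps: "carrier IG = {I. frac I}" "I \<otimes>\<^bsub>IG\<^esub> J = I \<star> J" "\<one>\<^bsub>IG\<^esub> = R"
  by (simp_all add: fractional_ideal_group_def)

lemma IG_comm_group: "comm_group IG"
proof (rule comm_groupI)
  show "\<exists>J\<in>carrier IG. J \<otimes>\<^bsub>IG\<^esub> I = \<one>\<^bsub>IG\<^esub>" if "I \<in> carrier IG" for I
    using that frac_invertible[of I] by (auto simp: IG_simps ideal_mult_commute)
  show "I \<otimes>\<^bsub>IG\<^esub> J = J \<otimes>\<^bsub>IG\<^esub> I" for I J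
    unfolding IG_simps by (rule ideal_mult_commute)
qed (auto simp: IG_simps frac_ideal_mult frac_R ideal_mult_assoc ideal_mult_R)

lemma PI_iff: "I \<in> PI \<longleftrightarrow> (\<exists>x\<in>K. x \<noteq> 0 \<and> I = scaled x R)"
  by (auto simp: principal_fractional_ideals_def)

lemma PI_I: "x \<in> K \<Longrightarrow> x \<noteq> 0 \<Longrightarrow> scaled x R \<in> PI"
  unfolding PI_iff by blast

lemma PI_E:
  assumes "I \<in> PI"
  obtains x where "x \<in> K" "x \<noteq> 0" "I = scaled x R"
  using assms unfolding PI_iff by blast

lemma scaled_R_mult:
  assumes "frac I"
  shows "scaled x R \<star> I = scaled x I"
  by (simp add: scaled_ideal_mult ideal_mult_R assms)

lemma frac_principal: "x \<in> K \<Longrightarrow> x \<noteq> 0 \<Longrightarrow> frac (scaled x R)"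
  by (rule frac_scaled[OF frac_R])

lemma PI_subgroup: "subgroup PI IG"
proof -
  interpret comm_group IG by (rule IG_comm_group)
  show ?thesis
  proof (rule subgroupI)
    show "PI \<subseteq> carrier IG" unfolding IG_simps by (auto elim!: PI_E simp: frac_principal)
    show "PI \<noteq> {}" using PI_I[OF K_one] by auto
    fix I J assume "I \<in> PI" "J \<in> PI"
    then obtain x y where x: "x \<in> K" "x \<noteq> 0" "I = scaled x R" and y: "y \<in> K" "y \<noteq> 0" "J = scaled y R"
      by (elim PI_E)
    have "I \<star> J = scaled (x * y) R"
      by (simp only: x(3) y(3) scaled_R_mult[OF frac_principal[OF y(1,2)]] scaled_scaled)
    then show "I \<otimes>\<^bsub>IG\<^esub> J \<in> PI" using PI_I[OF K_mult[OF x(1) y(1)]] x(2) y(2) by (simp only: IG_simps mult_eq_0_iff) simp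
    have "scaled (inverse x) R \<star> I = R"
      by (simp only: x(3) scaled_R_mult[OF frac_principal[OF x(1,2)]] scaled_scaled
          left_inverse[OF x(2)] scaled_one)
    then have "inv\<^bsub>IG\<^esub> I = scaled (inverse x) R"
      using frac_principal[OF x(1,2)] frac_principal[OF K_inverse[OF x(1)] nonzero_imp_inverse_nonzero[OF x(2)]]
      by (intro inv_equality) (simp_all only: IG_simps mem_Collect_eq x(3))
    then show "inv\<^bsub>IG\<^esub> I \<in> PI" using PI_I[OF K_inverse[OF x(1)]] x(2) by (simp only: inverse_nonzero_iff_nonzero) simp
  qed
qed

lemma PI_normal: "PI \<lhd> IG"
  using comm_group.subgroup_imp_normal[OF IG_comm_group PI_subgroup] .

lemma class_group_comm_group: "comm_group (class_group K)"
  unfolding class_group_def by (rule comm_group.abelian_FactGroup[OF IG_comm_group PI_subgroup])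

lemma carrier_class_group: "carrier (class_group K) = ideal_class K ` {I. frac I}"
  by (simp add: class_group_def carrier_FactGroup IG_simps ideal_class_def)

lemma ideal_class_mult:
  assumes "frac I" "frac J"
  shows "ideal_class K I \<otimes>\<^bsub>class_group K\<^esub> ideal_class K J = ideal_class K (I \<star> J)"
  using normal.rcos_sum[OF PI_normal, of I J] assms
  by (simp add: class_group_def ideal_class_def IG_simps)

lemma ideal_class_eq_iff:
  assumes "frac I" "frac J"
  shows "ideal_class K I = ideal_class K J \<longleftrightarrow> (\<exists>x\<in>K. x \<noteq> 0 \<and> I = scaled x J)"
proof -
  interpret comm_group IG by (rule IG_comm_group)
  have "I \<in> PI #>\<^bsub>IG\<^esub> J \<longleftrightarrow> (\<exists>H\<in>PI. I = H \<star> J)"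
    by (simp add: r_coset_def IG_simps)
  also have "\<dots> \<longleftrightarrow> (\<exists>x\<in>K. x \<noteq> 0 \<and> I = scaled x J)"
  proof
    assume "\<exists>H\<in>PI. I = H \<star> J"
    then obtain x where "x \<in> K" "x \<noteq> 0" "I = scaled x R \<star> J" by (auto elim!: PI_E)
    then show "\<exists>x\<in>K. x \<noteq> 0 \<and> I = scaled x J"
      by (intro bexI[of _ x]) (simp_all only: scaled_R_mult[OF assms(2)] simp_thms not_False_eq_True)
  next
    assume "\<exists>x\<in>K. x \<noteq> 0 \<and> I = scaled x J"
    then obtain x where x: "x \<in> K" "x \<noteq> 0" "I = scaled x J" by blast
    show "\<exists>H\<in>PI. I = H \<star> J"
      by (rule bexI[OF _ PI_I[OF x(1,2)]]) (simp only: scaled_R_mult[OF assms(2)] x(3))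
  qed
  finally have mem: "I \<in> PI #>\<^bsub>IG\<^esub> J \<longleftrightarrow> (\<exists>x\<in>K. x \<noteq> 0 \<and> I = scaled x J)" .
  have "PI #>\<^bsub>IG\<^esub> I = PI #>\<^bsub>IG\<^esub> J \<longleftrightarrow> I \<in> PI #>\<^bsub>IG\<^esub> J"
    using rcos_self[of I PI] repr_independence[of I PI J] assms PI_subgroup
    unfolding IG_simps mem_Collect_eq by metis
  then show ?thesis unfolding ideal_class_def mem .
qed

text \<open>Every class contains a normalized ideal for one fixed \<open>k\<close>.\<close>

lemma finite_class_group: "finite (carrier (class_group K))"
proof -
  obtain k where k: "k > 0"
    "\<And>I. frac I \<Longrightarrow> \<exists>x J. x \<in> K \<and> x \<noteq> 0 \<and> normalized k J \<and> I = scaled x J"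
    using frac_normalize by blast
  have "ideal_class K ` {I. frac I} \<subseteq> ideal_class K ` {J. normalized k J}"
  proof (rule image_subsetI)
    fix I assume "I \<in> {I. frac I}"
    then have I: "frac I" by simp
    then obtain x J where x: "x \<in> K" "x \<noteq> 0" and J: "normalized k J" and eq: "I = scaled x J"
      using k(2) by blast
    have "ideal_class K I = ideal_class K J"
      using ideal_class_eq_iff[OF I, of J] J x eq unfolding normalized_def by blast
    then show "ideal_class K I \<in> ideal_class K ` {J. normalized k J}" using J by blast
  qed
  then show ?thesis
    unfolding carrier_class_group by (rule finite_subset[OF _ finite_imageI[OF finite_normalized[OF k(1)]]])
qed

lemma class_number_power_of_two:
  assumes sq: "\<And>I. frac I \<Longrightarrow> \<exists>x\<in>K. x \<noteq> 0 \<and> I \<star> I = scaled x R"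
  shows "\<exists>k. class_number K = 2 ^ k"
proof -
  interpret comm_group "class_group K" by (rule class_group_comm_group)
  have "c \<otimes>\<^bsub>class_group K\<^esub> c = \<one>\<^bsub>class_group K\<^esub>" if c: "c \<in> carrier (class_group K)" for c
  proof -
    obtain I where I: "frac I" "c = ideal_class K I" using c unfolding carrier_class_group by blast
    have R1: "ideal_class K R \<otimes>\<^bsub>class_group K\<^esub> ideal_class K R = ideal_class K R"
      by (simp add: ideal_class_mult frac_R ideal_mult_R)
    have "ideal_class K (I \<star> I) = ideal_class K R"
      using sq[OF I(1)] ideal_class_eq_iff[OF frac_ideal_mult[OF I(1) I(1)] frac_R] by simp
    also have "\<dots> = \<one>\<^bsub>class_group K\<^esub>"
    proof -
      have "ideal_class K R \<in> carrier (class_group K)"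
        unfolding carrier_class_group using frac_R by blast
      with R1 show ?thesis using l_cancel_one by blast
    qed
    finally show ?thesis by (simp add: I ideal_class_mult)
  qed
  from order_power_of_two[OF finite_class_group this] show ?thesis
    by (simp add: class_number_def)
qed

text \<open>A subgroup \<open>U\<close> containing all principal ideals is a union of ideal classes,
  so membership can be tested on classes; the image of \<open>U\<close> is a subgroup of the class
  group containing the generators.\<close>

lemma frac_in_subgroup_if_generating:
  assumes gen: "generate (class_group K) S = carrier (class_group K)"
    and S: "S \<subseteq> ideal_class K ` U" and U: "subgroup U IG" "PI \<subseteq> U" and I: "frac I"
  shows "I \<in> U"
proof -
  have hom: "group_hom IG (class_group K) (ideal_class K)"
    using normal.r_coset_hom_Mod[OF PI_normal] comm_group.axioms(2)[OF IG_comm_group]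
      comm_group.axioms(2)[OF class_group_comm_group]
    by (simp add: group_hom_def group_hom_axioms_def class_group_def ideal_class_def[abs_def])
  have "generate (class_group K) S \<subseteq> ideal_class K ` U"
    using group.generate_subgroup_incl[OF comm_group.axioms(2)[OF class_group_comm_group] S]
      group_hom.subgroup_img_is_subgroup[OF hom U(1)] by blast
  then obtain J where J: "J \<in> U" "ideal_class K I = ideal_class K J"
    using I gen by (auto simp: carrier_class_group)
  have "frac J" using J(1) subgroup.subset[OF U(1)] by (auto simp: IG_simps)
  then obtain x where x: "x \<in> K" "x \<noteq> 0" "I = scaled x J"
    using ideal_class_eq_iff[OF I] J(2) by blast
  then have "I = scaled x R \<star> J" by (simp add: scaled_R_mult \<open>frac J\<close>)
  moreover have "scaled x R \<in> U" using U(2) PI_I[OF x(1,2)] by blast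
  ultimately show ?thesis
    using subgroup.m_closed[OF U(1) _ J(1)] by (simp add: IG_simps)
qed

end

section \<open>Arithmetic of roots of unity of prime order\<close>

lemma map_poly_pCons_of_0: "f 0 = 0 \<Longrightarrow> map_poly f (pCons c p) = pCons (f c) (map_poly f p)"
  by (intro poly_eqI) (simp add: coeff_map_poly coeff_pCons split: nat.split)

definition eval_rat :: "complex \<Rightarrow> rat poly \<Rightarrow> complex" where
  "eval_rat z p = poly (map_poly of_rat p) z"

lemma eval_rat_pCons [simp]: "eval_rat z (pCons a p) = of_rat a + z * eval_rat z p"
  by (simp add: eval_rat_def map_poly_pCons_of_0)

lemma eval_rat_0 [simp]: "eval_rat z 0 = 0"
  by (simp add: eval_rat_def)

lemma eval_rat_add: "eval_rat z (p + q) = eval_rat z p + eval_rat z q"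
  by (induction p q rule: poly_induct2) (simp_all add: of_rat_add algebra_simps)

lemma eval_rat_smult: "eval_rat z (smult c p) = of_rat c * eval_rat z p"
  by (induction p) (simp_all add: of_rat_mult algebra_simps)

lemma eval_rat_mult: "eval_rat z (p * q) = eval_rat z p * eval_rat z q"
  by (induction p) (simp_all add: eval_rat_add eval_rat_smult algebra_simps)

lemma eval_rat_uminus: "eval_rat z (- p) = - eval_rat z p"
  using eval_rat_smult[of z "-1" p] by (simp add: of_rat_minus)

lemma eval_rat_diff: "eval_rat z (p - q) = eval_rat z p - eval_rat z q"
  using eval_rat_add[of z p "- q"] by (simp add: eval_rat_uminus)

lemma eval_rat_1 [simp]: "eval_rat z 1 = 1"
  by (simp add: one_pCons)

lemma eval_rat_sum: "eval_rat z (\<Sum>i\<in>A. f i) = (\<Sum>i\<in>A. eval_rat z (f i))"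
  by (induction A rule: infinite_finite_induct) (simp_all add: eval_rat_add)

lemma eval_rat_prod: "eval_rat z (\<Prod>i\<in>A. f i) = (\<Prod>i\<in>A. eval_rat z (f i))"
  by (induction A rule: infinite_finite_induct) (simp_all add: eval_rat_mult)

lemma eval_rat_monom [simp]: "eval_rat z (monom c n) = of_rat c * z ^ n"
  by (induction n) (simp_all add: monom_0 monom_Suc)

lemma eval_rat_pcompose: "eval_rat z (pcompose p q) = eval_rat (eval_rat z q) p"
  by (induction p) (simp_all add: pcompose_pCons eval_rat_add eval_rat_mult)

lemma eval_rat_of_int_poly: "eval_rat z (map_poly of_int p) = poly (map_poly of_int p) z"
  by (induction p) (simp_all add: map_poly_pCons_of_0)

lemma eval_rat_coeffs:
  assumes "degree p < n"
  shows "eval_rat z p = (\<Sum>i<n. of_rat (coeff p i) * z ^ i)"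
proof -
  have "p = (\<Sum>i<n. monom (coeff p i) i)"
    using assms poly_as_sum_of_monoms'[of p "n - 1"] by (cases n) (simp_all add: lessThan_Suc_atMost)
  then have "eval_rat z p = eval_rat z (\<Sum>i<n. monom (coeff p i) i)" by simp
  also have "\<dots> = (\<Sum>i<n. of_rat (coeff p i) * z ^ i)" by (simp add: eval_rat_sum)
  finally show ?thesis .
qed

lemma cnj_eval_rat: "cnj (eval_rat z p) = eval_rat (cnj z) p"
proof -
  have "cnj (of_rat q) = of_rat q" for q :: rat
    by (cases q) (simp add: of_rat_rat)
  then show ?thesis by (induction p) simp_all
qed

text \<open>A predicate on rational polynomials rather than a separate type of integer polynomials,
  so that division of the coefficients by \<open>l\<close> can be expressed directly.\<close>

definition int_coeffs :: "rat poly \<Rightarrow> bool" where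
  "int_coeffs p \<longleftrightarrow> (\<forall>i. coeff p i \<in> \<int>)"

lemma int_coeffs_pCons: "int_coeffs (pCons a p) \<longleftrightarrow> a \<in> \<int> \<and> int_coeffs p"
  by (auto simp: int_coeffs_def coeff_pCons split: nat.splits)

lemma int_coeffs_0: "int_coeffs 0"
  by (simp add: int_coeffs_def)

lemma int_coeffs_add: "int_coeffs p \<Longrightarrow> int_coeffs q \<Longrightarrow> int_coeffs (p + q)"
  by (simp add: int_coeffs_def)

lemma int_coeffs_mult: "int_coeffs p \<Longrightarrow> int_coeffs q \<Longrightarrow> int_coeffs (p * q)"
  by (auto simp: int_coeffs_def coeff_mult intro!: Ints_sum Ints_mult)

lemma int_coeffs_pcompose: "int_coeffs p \<Longrightarrow> int_coeffs q \<Longrightarrow> int_coeffs (pcompose p q)"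
  by (induction p)
    (simp_all add: int_coeffs_pCons pcompose_pCons int_coeffs_add int_coeffs_mult int_coeffs_0)

lemma common_denominator: "\<exists>m::nat. m > 0 \<and> int_coeffs (smult (of_nat m) p)"
proof (induction p)
  case (pCons a p)
  then obtain m :: nat where m: "m > 0" "int_coeffs (smult (of_nat m) p)" by blast
  obtain b c where bc: "quotient_of a = (b, c)" by (cases "quotient_of a")
  then have c: "c > 0" "a = of_int b / of_int c"
    using quotient_of_denom_pos quotient_of_div by blast+
  have "of_nat (m * nat c) * a = of_int (int m * b)"
    using c by simp
  moreover have "smult (of_nat (m * nat c)) p = smult (of_int c) (smult (of_nat m) p)"
    using c(1) by (simp add: mult.commute)
  then have "int_coeffs (smult (of_nat (m * nat c)) p)"
    using m(2) by (simp only: int_coeffs_def coeff_smult) (simp add: Ints_mult del: of_nat_mult)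
  ultimately show ?case
    using m(1) c(1) by (intro exI[of _ "m * nat c"]) (simp add: int_coeffs_pCons del: of_nat_mult)
qed (auto simp: int_coeffs_0 intro: exI[of _ 1])

lemma algebraic_int_eval_rat:
  assumes "int_coeffs p" "algebraic_int z"
  shows "algebraic_int (eval_rat z p)"
  using assms(1)
proof (induction p)
  case (pCons a p)
  then obtain k where "a = of_int k" by (auto simp: int_coeffs_pCons elim: Ints_cases)
  moreover have "algebraic_int (eval_rat z p)" using pCons by (simp add: int_coeffs_pCons)
  ultimately show ?case
    using algebraic_int_add[OF algebraic_int_of_int algebraic_int_mult[OF assms(2)]] by simp
qed simp

text \<open>Divisibility in the ring of all algebraic integers: no field containing the quotient has
  to be tracked. \<open>quotient_in_R\<close> returns to \<open>O_L\<close>.\<close>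

definition alg_dvd :: "complex \<Rightarrow> complex \<Rightarrow> bool" where
  "alg_dvd x y \<longleftrightarrow> (\<exists>u. algebraic_int u \<and> y = x * u)"

lemma alg_dvdI: "algebraic_int u \<Longrightarrow> y = x * u \<Longrightarrow> alg_dvd x y"
  by (auto simp: alg_dvd_def)

lemma alg_dvd_trans: "alg_dvd x y \<Longrightarrow> alg_dvd y z \<Longrightarrow> alg_dvd x z"
  by (auto simp: alg_dvd_def mult.assoc intro: algebraic_int_mult)

lemma alg_dvd_diff: "alg_dvd x y \<Longrightarrow> alg_dvd x z \<Longrightarrow> alg_dvd x (y - z)"
  by (auto simp: alg_dvd_def right_diff_distrib[symmetric] intro: algebraic_int_diff)

lemma alg_dvd_power: "alg_dvd x y \<Longrightarrow> alg_dvd (x ^ n) (y ^ n)"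
  by (auto simp: alg_dvd_def power_mult_distrib intro: algebraic_int_power)

text \<open>The quotient is a rational algebraic integer, hence an ordinary integer.\<close>

lemma alg_dvd_of_int:
  assumes "alg_dvd (of_int a :: complex) (of_int b)"
  shows "a dvd b"
proof (cases "a = 0")
  case False
  obtain u :: complex where u: "algebraic_int u" "of_int b = of_int a * u"
    using assms by (auto simp: alg_dvd_def)
  then have "u = of_int b / of_int a" using False by simp
  then have "u \<in> \<int>" using rational_algebraic_int_is_int[OF u(1)] by simp
  then obtain k where "u = of_int k" by (elim Ints_cases)
  with u(2) have "b = a * k" by (metis of_int_eq_iff of_int_mult)
  then show ?thesis by simp
qed (use assms in \<open>auto simp: alg_dvd_def\<close>)

locale cyclotomic =
  fixes l :: nat and \<zeta> :: complex
  assumes prime: "Factorial_Ring.prime l" and odd: "odd l"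
    and root: "primitive_root_of_unity l \<zeta>"
begin

text \<open>Since \<open>l\<close> is prime, these are exactly the primitive \<open>l\<close>-th
  roots of unity. They also index the embeddings \<open>conjg\<close> of \<open>L\<close>.\<close>

definition Z :: "complex set" where "Z = {z. z ^ l = 1 \<and> z \<noteq> 1}"

lemma l_gt_1: "l > 1"
  using prime prime_gt_1_nat by blast

lemma l_ge_3: "l \<ge> 3"
  using l_gt_1 odd by (cases "l = 2") auto

lemma power_eq_1_iff:
  assumes "z \<in> Z"
  shows "z ^ i = 1 \<longleftrightarrow> l dvd i"
proof
  assume "l dvd i"
  then show "z ^ i = 1" using assms by (auto simp: Z_def power_mult elim!: dvdE)
next
  assume i: "z ^ i = 1"
  show "l dvd i"
  proof (rule ccontr)
    assume ndvd: "\<not> l dvd i"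
    then have "i \<noteq> 0" by (intro notI) simp
    then obtain d x y where d: "d dvd i" "d dvd l" "i * x = l * y + d"
      using bezout_add_strong_nat by blast
    from d have "d = 1" using prime ndvd by (auto simp: prime_nat_iff)
    then have "z ^ (i * x) = z ^ (l * y) * z" using d by (simp add: power_add)
    then show False using i assms by (simp add: Z_def power_mult)
  qed
qed

lemma \<zeta>_Z: "\<zeta> \<in> Z"
  using root l_gt_1 unfolding primitive_root_of_unity_def Z_def
  by (auto dest!: spec[of _ 1])

lemma inj_power:
  assumes w: "w \<in> Z"
  shows "inj_on (\<lambda>k. w ^ k) {..<l}"
proof -
  have "i = j" if "i \<le> j" "i < l" "j < l" "w ^ i = w ^ j" for i j
  proof -
    have "w \<noteq> 0" using w l_gt_1 by (auto simp: Z_def power_0_left)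
    have "w ^ j = w ^ i * w ^ (j - i)" using that(1) by (simp flip: power_add)
    then have "w ^ (j - i) = 1" using that(4) \<open>w \<noteq> 0\<close> by simp
    then have "l dvd j - i" by (simp add: power_eq_1_iff[OF w])
    then show ?thesis using that by (auto dest: dvd_imp_le)
  qed
  then show ?thesis
    by (intro inj_onI) (metis lessThan_iff nat_le_linear)
qed

lemma roots_eq_powers:
  assumes w: "w \<in> Z"
  shows "{z. z ^ l = 1} = (\<lambda>k. w ^ k) ` {..<l}"
proof (rule card_subset_eq[symmetric])
  show "finite {z::complex. z ^ l = 1}" using l_gt_1 by (intro finite_roots_unity) simp
  have "(w ^ k) ^ l = 1" for k
    using w by (simp add: Z_def power_mult[symmetric] mult.commute[of k l]) (simp add: power_mult)
  then show "(\<lambda>k. w ^ k) ` {..<l} \<subseteq> {z. z ^ l = 1}" by auto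
  show "card ((\<lambda>k. w ^ k) ` {..<l}) = card {z::complex. z ^ l = 1}"
    using card_image[OF inj_power[OF w]] card_roots_unity_eq[of l] l_gt_1 by simp
qed

lemma bij_power: "w \<in> Z \<Longrightarrow> bij_betw (\<lambda>k. w ^ k) {1..<l} Z"
proof -
  assume w: "w \<in> Z"
  have 0: "{..<l} = insert 0 {1..<l}" using l_gt_1 by auto
  have "w ^ k \<noteq> 1" if "k \<in> {1..<l}" for k
    using that by (auto simp: power_eq_1_iff[OF w] dest: dvd_imp_le)
  then have "(\<lambda>k. w ^ k) ` {1..<l} = {z. z ^ l = 1} - {1}"
    unfolding roots_eq_powers[OF w] 0 by force
  then show ?thesis
    using inj_power[OF w] unfolding bij_betw_def 0 Z_def by (auto simp: inj_on_def)
qed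

lemma finite_Z: "finite Z" and card_Z: "card Z = l - 1"
  using bij_betw_finite[OF bij_power[OF \<zeta>_Z]] bij_betw_same_card[OF bij_power[OF \<zeta>_Z]] by auto

lemma power_in_Z: "w \<in> Z \<Longrightarrow> \<not> l dvd k \<Longrightarrow> w ^ k \<in> Z"
  using power_eq_1_iff[of w k] by (auto simp: Z_def power_mult[symmetric] mult.commute[of k l])
    (auto simp: power_mult)

text \<open>\<open>w\<close> lies on the unit circle, so its conjugate is its inverse. Writing it as
  a power makes conjugation a substitution in polynomials.\<close>

lemma cnj_eq_power:
  assumes "w \<in> Z"
  shows "cnj w = w ^ (l - 1)"
proof -
  have w: "w ^ l = 1" using assms by (simp add: Z_def)
  then have "norm w ^ l = 1" by (metis norm_one norm_power)
  then have "norm w = 1" using l_gt_1 by (metis norm_ge_zero power_eq_1_iff power_eq_imp_eq_base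
      power_one zero_le_one gr_implies_not0 zero_less_iff_neq_zero)
  then have "w * cnj w = 1" by (simp add: complex_norm_square[symmetric])
  moreover have "w * w ^ (l - 1) = 1" using w l_gt_1 by (cases l) auto
  ultimately have "w * cnj w = w * w ^ (l - 1)" "w \<noteq> 0" by auto
  then show ?thesis by simp
qed

lemma algebraic_int_Z: "z \<in> Z \<Longrightarrow> algebraic_int z"
  by (rule algebraic_int_root[of 1 "monom 1 l"])
    (use l_gt_1 in \<open>auto simp: Z_def poly_monom degree_monom_eq algebraic_int_one\<close>)

lemma sum_powers_Z:
  assumes "w \<in> Z"
  shows "(\<Sum>i<l. w ^ i) = 0"
  using assms geometric_sum[of w l] by (simp add: Z_def)

text \<open>The value at 1 of the cyclotomic polynomial, which is both the product of the
  \<open>X - z\<close> and the sum of the powers of \<open>X\<close> below \<open>l\<close>; the two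
  agree at the \<open>l - 1\<close> points of \<open>Z\<close> and in the coefficient of degree
  \<open>l - 1\<close>.\<close>

lemma prod_one_minus: "(\<Prod>z\<in>Z. 1 - z) = of_nat l"
proof -
  have "(\<Prod>z\<in>Z. [:-z, 1:]) = (\<Sum>i<l. monom 1 i)"
  proof (rule poly_eqI_degree_lead_coeff[of _ "l - 1" _ Z])
    have deg: "degree (\<Prod>z\<in>Z. [:-z, 1:]) = l - 1"
      by (subst degree_prod_eq_sum_degree) (auto simp: card_Z finite_Z)
    show "degree (\<Prod>z\<in>Z. [:-z, 1:]) \<le> l - 1" using deg by simp
    have "lead_coeff (\<Prod>z\<in>Z. [:-z, 1:]) = 1" by (simp add: lead_coeff_prod)
    moreover have "coeff (\<Sum>i<l. monom (1::complex) i) (l - 1) = 1"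
      using l_gt_1 by (simp add: coeff_sum)
    ultimately show "coeff (\<Prod>z\<in>Z. [:-z, 1:]) (l - 1) = coeff (\<Sum>i<l. monom 1 i) (l - 1)"
      by (simp add: deg)
    show "degree (\<Sum>i<l. monom (1::complex) i) \<le> l - 1"
      by (rule degree_sum_le) (auto intro: order_trans[OF degree_monom_le])
    show "poly (\<Prod>z\<in>Z. [:-z, 1:]) w = poly (\<Sum>i<l. monom 1 i) w" if "w \<in> Z" for w
      using that finite_Z sum_powers_Z[OF that]
      by (auto simp: poly_prod poly_sum poly_monom)
  qed (simp add: card_Z)
  from arg_cong[OF this, of "\<lambda>p. poly p 1"] show ?thesis
    by (simp add: poly_prod poly_sum poly_monom)
qed

text \<open>\<open>z\<close> is a power of \<open>w\<close>, so the quotient is a geometric sum.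
  Used in both directions, this makes all the \<open>1 - z\<close> associates of each other.\<close>

lemma one_minus_dvd:
  assumes "w \<in> Z" "z \<in> Z"
  shows "alg_dvd (1 - w) (1 - z)"
proof -
  obtain k where k: "z = w ^ k" using bij_power[OF assms(1)] assms(2) by (auto simp: bij_betw_def)
  have "1 - z = (1 - w) * (\<Sum>i<k. w ^ i)" by (simp add: k one_diff_power_eq)
  then show ?thesis
    by (rule alg_dvdI[rotated]) (intro algebraic_int_intros algebraic_int_Z assms)
qed

text \<open>\<open>l\<close> is the product of the \<open>l - 1\<close> mutually associated factors
  \<open>1 - z\<close>; this is the total ramification of \<open>l\<close>.\<close>

lemma l_associated:
  assumes w: "w \<in> Z"
  shows "alg_dvd ((1 - w) ^ (l - 1)) (of_nat l)" "alg_dvd (of_nat l) ((1 - w) ^ (l - 1))"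
proof -
  have "\<forall>z\<in>Z. \<exists>u. algebraic_int u \<and> 1 - z = (1 - w) * u"
    using one_minus_dvd[OF w] by (simp add: alg_dvd_def)
  from bchoice[OF this] obtain u where u: "\<forall>z\<in>Z. algebraic_int (u z) \<and> 1 - z = (1 - w) * u z" ..
  have "of_nat l = (\<Prod>z\<in>Z. (1 - w) * u z)"
    unfolding prod_one_minus[symmetric] using u by (intro prod.cong) auto
  also have "\<dots> = (1 - w) ^ (l - 1) * (\<Prod>z\<in>Z. u z)" by (simp add: prod.distrib card_Z)
  finally show "alg_dvd ((1 - w) ^ (l - 1)) (of_nat l)"
    by (rule alg_dvdI[rotated]) (use u in \<open>auto intro!: algebraic_int_prod\<close>)
  have "\<forall>z\<in>Z. \<exists>u. algebraic_int u \<and> 1 - w = (1 - z) * u"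
    using one_minus_dvd[OF _ w] by (simp add: alg_dvd_def)
  from bchoice[OF this] obtain v where v: "\<forall>z\<in>Z. algebraic_int (v z) \<and> 1 - w = (1 - z) * v z" ..
  have "(1 - w) ^ (l - 1) = (\<Prod>z\<in>Z. 1 - w)" by (simp add: card_Z)
  also have "\<dots> = (\<Prod>z\<in>Z. (1 - z) * v z)" using v by (intro prod.cong) auto
  also have "\<dots> = of_nat l * (\<Prod>z\<in>Z. v z)" by (simp add: prod.distrib prod_one_minus)
  finally show "alg_dvd (of_nat l) ((1 - w) ^ (l - 1))"
    by (rule alg_dvdI[rotated]) (use v in \<open>auto intro!: algebraic_int_prod\<close>)
qed

text \<open>Raising to the power \<open>l - 1\<close> replaces \<open>1 - w\<close> by
  \<open>l\<close>, which then divides a power of \<open>c\<close> among the integers.\<close>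

lemma one_minus_dvd_int:
  assumes w: "w \<in> Z" and dvd: "alg_dvd (1 - w) (of_int c)"
  shows "int l dvd c"
proof -
  have "alg_dvd (of_nat l) (of_int c ^ (l - 1))"
    using alg_dvd_trans[OF l_associated(2)[OF w] alg_dvd_power[OF dvd]] .
  then have "alg_dvd (of_int (int l)) (of_int (c ^ (l - 1)))" by simp
  then have "int l dvd c ^ (l - 1)" by (rule alg_dvd_of_int)
  then show ?thesis using prime by (simp add: prime_dvd_power)
qed

text \<open>The coefficients of an expansion in powers of \<open>1 - w\<close> are read off modulo \<open>l\<close> one at a time,
  since \<open>l\<close> is associated to \<open>(1 - w)^(l - 1)\<close>.\<close>

lemma one_minus_adic:
  assumes w: "w \<in> Z" and "d \<le> l - 1" "int_coeffs p" "\<forall>i\<ge>d. coeff p i = 0"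
    "alg_dvd ((1 - w) ^ d) (eval_rat (1 - w) p)"
  shows "int_coeffs (smult (1 / of_nat l) p)"
  using assms(2-)
proof (induction d arbitrary: p)
  case 0
  then have "p = 0" by (intro poly_eqI) simp
  then show ?case by (simp add: int_coeffs_0)
next
  case (Suc d)
  obtain a q where p: "p = pCons a q" by (cases p)
  from Suc.prems(2) obtain c where c: "a = of_int c" and q: "int_coeffs q"
    by (auto simp: p int_coeffs_pCons elim: Ints_cases)
  have ev: "eval_rat (1 - w) p = of_int c + (1 - w) * eval_rat (1 - w) q" by (simp add: p c)
  have w1: "1 - w \<noteq> 0" using w by (simp add: Z_def)
  have alg: "algebraic_int (1 - w)" by (intro algebraic_int_intros algebraic_int_Z w)
  have "alg_dvd (1 - w) ((1 - w) ^ Suc d)"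
    by (rule alg_dvdI[of "(1 - w) ^ d"]) (auto intro: algebraic_int_power alg)
  then have "alg_dvd (1 - w) (eval_rat (1 - w) p)" using Suc.prems(4) by (rule alg_dvd_trans)
  moreover have "alg_dvd (1 - w) ((1 - w) * eval_rat (1 - w) q)"
    by (rule alg_dvdI[OF algebraic_int_eval_rat[OF q alg]]) simp
  ultimately have "alg_dvd (1 - w) (of_int c)" using alg_dvd_diff unfolding ev by fastforce
  then have lc: "int l dvd c" by (rule one_minus_dvd_int[OF w])
  then obtain c' where c': "c = int l * c'" by (elim dvdE)
  \<comment> \<open>The bound \<open>Suc d \<le> l - 1\<close> makes \<open>(1 - w)^(d + 1)\<close>
    divide \<open>l\<close>, hence \<open>c\<close>. The constant term can be subtracted and one
    factor \<open>1 - w\<close> cancelled.\<close>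
  have "alg_dvd ((1 - w) ^ Suc d) ((1 - w) ^ (l - 1))"
  proof (rule alg_dvdI[OF algebraic_int_power[OF alg]])
    show "(1 - w) ^ (l - 1) = (1 - w) ^ Suc d * (1 - w) ^ (l - 1 - Suc d)"
      unfolding power_add[symmetric] le_add_diff_inverse[OF Suc.prems(1)] ..
  qed
  moreover have "alg_dvd (of_nat l) (of_int c :: complex)"
    by (rule alg_dvdI[OF algebraic_int_of_int[of c']]) (simp add: c')
  ultimately have "alg_dvd ((1 - w) ^ Suc d) (of_int c)"
    using alg_dvd_trans l_associated(1)[OF w] by blast
  then have "alg_dvd ((1 - w) ^ Suc d) ((1 - w) * eval_rat (1 - w) q)"
    using alg_dvd_diff[OF Suc.prems(4)] unfolding ev by fastforce
  then have "alg_dvd ((1 - w) ^ d) (eval_rat (1 - w) q)"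
    using w1 by (auto simp: alg_dvd_def)
  moreover have "\<forall>i\<ge>d. coeff q i = 0"
    using Suc.prems(3) by (auto simp: p dest: spec[of _ "Suc _"])
  ultimately have "int_coeffs (smult (1 / of_nat l) q)"
    using Suc.IH[of q] Suc.prems(1) q by simp
  moreover have "1 / of_nat l * a \<in> \<int>" using l_gt_1 by (simp add: c c')
  ultimately show ?case by (simp add: p int_coeffs_pCons)
qed

text \<open>The substitution of \<open>1 - X\<close> for \<open>X\<close> exchanges expansions in
  powers of \<open>w\<close> and of \<open>1 - w\<close>; it is an involution that keeps integrality
  and the degree bound.\<close>

lemma eval_rat_flip: "eval_rat (1 - w) (pcompose p [:1, -1:]) = eval_rat w p"
  by (simp add: eval_rat_pcompose of_rat_minus)

lemma flip_flip: "pcompose (pcompose p [:1, -1:]) [:1, -1:] = (p :: rat poly)"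
  by (simp add: pcompose_assoc[symmetric] pcompose_pCons)

lemma int_coeffs_flip: "int_coeffs p \<Longrightarrow> int_coeffs (pcompose p [:1, -1:])"
  by (rule int_coeffs_pcompose) (simp_all add: int_coeffs_pCons int_coeffs_0)

lemma flip_degree: "degree (p :: rat poly) < n \<Longrightarrow> i \<ge> n \<Longrightarrow> coeff (pcompose p [:1, -1:]) i = 0"
  by (rule coeff_eq_0) (rule le_less_trans[OF degree_pcompose_le], simp)

lemma coeffs_divisible_by_l:
  assumes w: "w \<in> Z" and p: "int_coeffs p" "degree p < l - 1"
    and dvd: "alg_dvd (of_nat l) (eval_rat w p)"
  shows "int_coeffs (smult (1 / of_nat l) p)"
proof -
  let ?p = "pcompose p [:1, -1:]"
  have "int_coeffs (smult (1 / of_nat l) ?p)"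
  proof (rule one_minus_adic[OF w order_refl])
    show "alg_dvd ((1 - w) ^ (l - 1)) (eval_rat (1 - w) ?p)"
      unfolding eval_rat_flip using l_associated(1)[OF w] dvd by (rule alg_dvd_trans)
  qed (use p int_coeffs_flip flip_degree in auto)
  from int_coeffs_flip[OF this] show ?thesis by (simp add: pcompose_smult flip_flip)
qed

text \<open>Irreducibility of the cyclotomic polynomial, by descent: the value 0 is divisible by
  \<open>l\<close>, so the coefficients of an integral relation can be divided by \<open>l\<close>
  again and again, which only zero coefficients survive.\<close>

lemma eval_rat_eq_0:
  assumes w: "w \<in> Z" and p: "degree p < l - 1" and zero: "eval_rat w p = 0"
  shows "p = 0"
proof -
  have int: "int_coeffs (smult (1 / of_nat l ^ k) q)"
    if "int_coeffs q" "degree q < l - 1" "eval_rat w q = 0" for k q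
  proof (induction k)
    case (Suc k)
    let ?q = "smult (1 / of_nat l ^ k) q"
    have "alg_dvd (of_nat l) (eval_rat w ?q)"
      using that(3) by (intro alg_dvdI[of 0]) (simp_all add: eval_rat_smult)
    then have "int_coeffs (smult (1 / of_nat l) ?q)"
      using that(2) Suc by (intro coeffs_divisible_by_l[OF w]) auto
    then show ?case by (simp add: mult.commute)
  qed (use that in simp)
  obtain m :: nat where m: "m > 0" "int_coeffs (smult (of_nat m) p)"
    using common_denominator by blast
  define q where "q = smult (of_nat m) p"
  have q: "int_coeffs q" "degree q < l - 1" "eval_rat w q = 0"
    using m p zero by (auto simp: q_def eval_rat_smult)
  have "coeff q i = 0" for i
  proof (rule ccontr)
    assume nz: "coeff q i \<noteq> 0"
    obtain c where c: "coeff q i = of_int c" using q(1) by (auto simp: int_coeffs_def elim: Ints_cases)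
    have "int l ^ k dvd c" for k
    proof -
      have "coeff q i / of_nat l ^ k \<in> \<int>"
        using int[OF q, of k] by (simp add: int_coeffs_def)
      then obtain e where "coeff q i / of_nat l ^ k = of_int e" by (elim Ints_cases)
      then have "of_int c = (of_int (int l ^ k * e) :: rat)"
        using l_gt_1 by (simp add: c field_simps)
      then have "c = int l ^ k * e" by (simp only: of_int_eq_iff)
      then show ?thesis by simp
    qed
    \<comment> \<open>The exponent \<open>|c|\<close> suffices, because \<open>l^|c|\<close> exceeds
      \<open>|c|\<close>.\<close>
    from dvd_imp_le_int[OF _ this[of "nat \<bar>c\<bar>"]] nz c
    have "int l ^ nat \<bar>c\<bar> \<le> \<bar>c\<bar>" by simp
    moreover have "nat \<bar>c\<bar> < l ^ nat \<bar>c\<bar>" by (rule power_gt_expt) (use l_gt_1 in simp)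
    ultimately show False by (simp flip: of_nat_power)
  qed
  then have "q = 0" by (intro poly_eqI) simp
  then show ?thesis using m(1) by (simp add: q_def)
qed

end

section \<open>The cyclotomic field and its real subfield\<close>

context cyclotomic
begin

abbreviation L :: "complex set" where "L \<equiv> rat_adjoin \<zeta>"

definition \<Phi> :: "rat poly" where "\<Phi> = (\<Sum>i<l. monom 1 i)"

lemma degree_\<Phi>: "degree \<Phi> = l - 1"
proof (rule antisym)
  show "degree \<Phi> \<le> l - 1"
    unfolding \<Phi>_def by (rule degree_sum_le) (auto intro: order_trans[OF degree_monom_le])
  have "coeff \<Phi> (l - 1) = 1"
    using l_gt_1 by (simp add: \<Phi>_def coeff_sum)
  then show "l - 1 \<le> degree \<Phi>" by (intro le_degree) simp
qed

lemma \<Phi>_nonzero: "\<Phi> \<noteq> 0"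
  using degree_\<Phi> l_gt_1 by (metis degree_0 less_irrefl zero_less_diff)

lemma eval_rat_\<Phi>: "z \<in> Z \<Longrightarrow> eval_rat z \<Phi> = 0"
  using sum_powers_Z by (simp add: \<Phi>_def eval_rat_sum)

lemma degree_mod_\<Phi>: "degree (p mod \<Phi>) < l - 1"
  using degree_mod_less'[OF \<Phi>_nonzero, of p] l_gt_1 by (cases "p mod \<Phi> = 0") (simp_all add: degree_\<Phi>)

lemma eval_rat_mod_\<Phi>:
  assumes "z \<in> Z"
  shows "eval_rat z (p mod \<Phi>) = eval_rat z p"
proof -
  have "eval_rat z p = eval_rat z (p div \<Phi> * \<Phi> + p mod \<Phi>)" by simp
  also have "\<dots> = eval_rat z (p mod \<Phi>)"
    by (simp only: eval_rat_add eval_rat_mult eval_rat_\<Phi>[OF assms]) simp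
  finally show ?thesis by simp
qed

text \<open>The difference reduced modulo \<open>\<Phi>\<close> vanishes at \<open>w\<close>, so it
  is the zero polynomial. This is what makes \<open>conjg\<close> well defined.\<close>

lemma eval_rat_conjugate:
  assumes "w \<in> Z" "z \<in> Z" "eval_rat w p = eval_rat w q"
  shows "eval_rat z p = eval_rat z q"
proof -
  have "eval_rat w ((p - q) mod \<Phi>) = 0"
    using assms by (simp add: eval_rat_mod_\<Phi> eval_rat_diff)
  then have "(p - q) mod \<Phi> = 0" by (rule eval_rat_eq_0[OF assms(1) degree_mod_\<Phi>])
  then have "eval_rat z (p - q) = 0" using eval_rat_mod_\<Phi>[OF assms(2), of "p - q"] by simp
  then show ?thesis by (simp add: eval_rat_diff)
qed

text \<open>Write \<open>\<Phi> = g h\<close> with \<open>g\<close> the gcd of \<open>p\<close> and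
  \<open>\<Phi>\<close>. As \<open>g\<close> does not vanish at \<open>w\<close>, \<open>h\<close>
  does, so \<open>h\<close> has degree at least \<open>l - 1\<close> and \<open>g\<close> is
  constant; Bezout coefficients then give the inverse.\<close>

lemma eval_rat_inverse:
  assumes "w \<in> Z"
  shows "\<exists>q. inverse (eval_rat w p) = eval_rat w q"
proof (cases "eval_rat w p = 0")
  case False
  define g where "g = gcd p \<Phi>"
  obtain h where h: "\<Phi> = g * h" by (metis dvdE g_def gcd_dvd2)
  obtain p' where p': "p = g * p'" by (metis dvdE g_def gcd_dvd1)
  have "eval_rat w g \<noteq> 0" using False p' by (auto simp: eval_rat_mult)
  then have h0: "eval_rat w h = 0"
    using eval_rat_\<Phi>[OF assms] by (simp add: h eval_rat_mult)
  have gh: "g \<noteq> 0" "h \<noteq> 0" using \<Phi>_nonzero h by auto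
  then have "degree h \<ge> l - 1" using eval_rat_eq_0[OF assms _ h0] by fastforce
  then have "degree g = 0" using degree_\<Phi> gh by (simp add: h degree_mult_eq)
  then obtain c where c: "g = [:c:]" by (elim degree_eq_zeroE)
  obtain a b where "a * p + b * \<Phi> = g" using bezout_coefficients_fst_snd[of p \<Phi>] g_def by metis
  from arg_cong[OF this, of "eval_rat w"] have "eval_rat w a * eval_rat w p = of_rat c"
    using eval_rat_\<Phi>[OF assms] by (simp add: eval_rat_add eval_rat_mult c)
  moreover have "c \<noteq> 0" using gh c by auto
  moreover have "eval_rat w p * eval_rat w (smult (inverse c) a)
      = inverse (of_rat c) * (eval_rat w a * eval_rat w p)"
    by (simp add: eval_rat_smult of_rat_inverse mult_ac)
  ultimately have "eval_rat w p * eval_rat w (smult (inverse c) a) = 1" by simp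
  then have "inverse (eval_rat w p) = eval_rat w (smult (inverse c) a)"
    by (rule inverse_unique)
  then show ?thesis by blast
qed (auto intro: exI[of _ 0])

text \<open>The polynomial expressions in \<open>\<zeta>\<close> are closed under inverses by
  \<open>eval_rat_inverse\<close>, so the generated field is no larger.\<close>

lemma L_eq: "L = range (eval_rat \<zeta>)"
proof
  have inv: "\<ominus>\<^bsub>complex_ring\<^esub> x = - x" for x :: complex
  proof -
    interpret F: Ring.field complex_ring by (rule complex_ring_field)
    show ?thesis
      by (rule F.minus_equality) (auto simp: complex_ring_simps)
  qed
  have minv: "inv\<^bsub>complex_ring\<^esub> x = inverse x" if "x \<noteq> 0" for x :: complex
  proof -
    interpret F: Ring.field complex_ring by (rule complex_ring_field)
    show ?thesis
      by (rule F.comm_inv_char) (auto simp: complex_ring_simps that)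
  qed
  show "L \<subseteq> range (eval_rat \<zeta>)"
  proof
    fix x assume "x \<in> L"
    then show "x \<in> range (eval_rat \<zeta>)"
      unfolding rat_adjoin_def
    proof (induction rule: generate_field.induct)
      case one
      show ?case using eval_rat_1[of \<zeta>] unfolding complex_ring_simps by (metis rangeI)
    next
      case (incl h)
      have "of_rat q \<in> range (eval_rat \<zeta>)" for q
        by (rule range_eqI[of _ _ "[:q:]"]) simp
      moreover have "\<zeta> \<in> range (eval_rat \<zeta>)"
        by (rule range_eqI[of _ _ "[:0, 1:]"]) simp
      ultimately show ?case using incl unfolding Rats_def by blast
    next
      case (a_inv h)
      then show ?case unfolding inv using eval_rat_uminus[of \<zeta>, symmetric] by auto
    next
      case (m_inv h)
      then show ?case
        using eval_rat_inverse[OF \<zeta>_Z] minv[of h] unfolding complex_ring_simps by auto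
    next
      case (eng_add h1 h2)
      then show ?case unfolding complex_ring_simps using eval_rat_add[of \<zeta>, symmetric] by auto
    next
      case (eng_mult h1 h2)
      then show ?case unfolding complex_ring_simps using eval_rat_mult[of \<zeta>, symmetric] by auto
    qed
  qed
  have "eval_rat \<zeta> p \<in> L" for p
  proof (induction p)
    case 0
    show ?case
      unfolding rat_adjoin_def using generate_field.incl[of 0 "\<rat> \<union> {\<zeta>}" complex_ring] by simp
  next
    case (pCons a p)
    have "of_rat a \<in> L" "\<zeta> \<in> L"
      unfolding rat_adjoin_def by (auto intro: generate_field.incl)
    then show ?case
      using pCons(2) generate_field.eng_add generate_field.eng_mult
      unfolding rat_adjoin_def eval_rat_pCons complex_ring_simps(2,5)[symmetric] by metis
  qed
  then show "range (eval_rat \<zeta>) \<subseteq> L" by blast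
qed

lemma L_cases:
  assumes "x \<in> L"
  obtains p where "degree p < l - 1" "x = eval_rat \<zeta> p"
proof -
  obtain p where "x = eval_rat \<zeta> p" using assms unfolding L_eq by blast
  then show ?thesis
    using that[of "p mod \<Phi>"] degree_mod_\<Phi> eval_rat_mod_\<Phi>[OF \<zeta>_Z] by simp
qed

text \<open>The embedding of \<open>L\<close> sending \<open>\<zeta>\<close> to \<open>z\<close>. By
  \<open>eval_rat_conjugate\<close> the value does not depend on the chosen polynomial.\<close>

definition conjg :: "complex \<Rightarrow> complex \<Rightarrow> complex" where
  "conjg z x = eval_rat z (SOME p. eval_rat \<zeta> p = x)"

lemma conjg_eval_rat: "z \<in> Z \<Longrightarrow> conjg z (eval_rat \<zeta> p) = eval_rat z p"
  unfolding conjg_def by (rule eval_rat_conjugate[OF \<zeta>_Z]) (auto intro: someI[where x = p])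

text \<open>If the monic polynomial \<open>q\<close> annihilates the value of \<open>p\<close> at
  \<open>w\<close>, then \<open>q\<close> composed with \<open>p\<close> vanishes at
  \<open>w\<close>, hence at \<open>z\<close>.\<close>

lemma algebraic_int_conjugate:
  assumes "algebraic_int (eval_rat w p)" "w \<in> Z" "z \<in> Z"
  shows "algebraic_int (eval_rat z p)"
proof -
  obtain q where q: "poly (map_poly of_int q) (eval_rat w p) = 0" "lead_coeff q = 1"
    using assms(1) by (auto simp: algebraic_int_altdef_ipoly)
  let ?q = "map_poly of_int q :: rat poly"
  have "eval_rat w (pcompose ?q p) = eval_rat w 0"
    using q(1) by (simp add: eval_rat_pcompose eval_rat_of_int_poly)
  then have "eval_rat z (pcompose ?q p) = 0"
    using eval_rat_conjugate[OF assms(2,3), of _ 0] by simp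
  then have "poly (map_poly of_int q) (eval_rat z p) = 0"
    by (simp add: eval_rat_pcompose eval_rat_of_int_poly)
  then show ?thesis using q(2) by (auto simp: algebraic_int_altdef_ipoly)
qed

section \<open>Traces, norms and the ring of integers of \<open>L\<close>\<close>

lemma power_sum_Z: "(\<Sum>z\<in>Z. z ^ i) = of_int ((if l dvd i then int l else 0) - 1)"
proof -
  have "(\<Sum>k\<in>{..<l}. (\<zeta> ^ k) ^ i) = (\<Sum>k<l. (\<zeta> ^ i) ^ k)"
    by (simp add: power_mult[symmetric] mult.commute)
  also have "\<dots> = of_int (if l dvd i then int l else 0)"
  proof (cases "l dvd i")
    case True
    then show ?thesis using power_eq_1_iff[OF \<zeta>_Z, of i] by simp
  next
    case False
    then show ?thesis using sum_powers_Z[OF power_in_Z[OF \<zeta>_Z False]] by simp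
  qed
  finally have 1: "(\<Sum>k\<in>{..<l}. (\<zeta> ^ k) ^ i) = of_int (if l dvd i then int l else 0)" .
  have "{..<l} = insert 0 {1..<l}" using l_gt_1 by auto
  then have "(\<Sum>k\<in>{..<l}. (\<zeta> ^ k) ^ i) = 1 + (\<Sum>k\<in>{1..<l}. (\<zeta> ^ k) ^ i)" by simp
  also have "(\<Sum>k\<in>{1..<l}. (\<zeta> ^ k) ^ i) = (\<Sum>z\<in>Z. z ^ i)"
    by (rule sum.reindex_bij_betw[OF bij_power[OF \<zeta>_Z]])
  finally show ?thesis using 1 by (simp add: algebra_simps)
qed

text \<open>The trace from \<open>L\<close> to the rationals of the element
  \<open>eval_rat \<zeta> p\<close>, defined on representing polynomials.\<close>

definition trace :: "rat poly \<Rightarrow> complex" where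
  "trace p = (\<Sum>z\<in>Z. eval_rat z p)"

lemma trace_coeffs:
  assumes "degree p < n"
  shows "trace (monom 1 k * p) =
    (\<Sum>i<n. of_rat (coeff p i) * of_int ((if l dvd k + i then int l else 0) - 1))"
proof -
  have "trace (monom 1 k * p) = (\<Sum>z\<in>Z. \<Sum>i<n. of_rat (coeff p i) * z ^ (k + i))"
    by (simp add: trace_def eval_rat_mult eval_rat_coeffs[OF assms] sum_distrib_left power_add mult_ac)
  also have "\<dots> = (\<Sum>i<n. of_rat (coeff p i) * (\<Sum>z\<in>Z. z ^ (k + i)))"
    by (subst sum.swap) (simp add: sum_distrib_left)
  finally show ?thesis by (simp only: power_sum_Z)
qed

lemma trace_rational: "trace p \<in> \<rat>"
proof -
  have "trace p = trace (monom 1 0 * p)" by (simp add: monom_0)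
  also have "\<dots> \<in> \<rat>"
    unfolding trace_coeffs[of p "Suc (degree p)", OF lessI]
    by (intro Rats_sum Rats_mult Rats_of_rat Rats_of_int)
  finally show ?thesis .
qed

lemma trace_integer:
  assumes "algebraic_int (eval_rat \<zeta> p)"
  shows "trace p \<in> \<int>"
proof (rule rational_algebraic_int_is_int[OF _ trace_rational])
  show "algebraic_int (trace p)"
    unfolding trace_def using algebraic_int_conjugate[OF assms \<zeta>_Z] by (rule algebraic_int_sum)
qed

text \<open>The traces of \<open>x \<zeta>^(-j)\<close> and of \<open>x \<zeta>\<close> differ by \<open>l\<close> times the \<open>j\<close>-th coordinate of \<open>x\<close>.\<close>

lemma int_coeffs_l_times:
  assumes p: "degree p < l - 1" and int: "algebraic_int (eval_rat \<zeta> p)"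
  shows "int_coeffs (smult (of_nat l) p)"
proof -
  have tr: "trace (monom 1 k * p) \<in> \<int>" for k
    using int algebraic_int_Z[OF \<zeta>_Z]
    by (intro trace_integer) (auto simp: eval_rat_mult intro: algebraic_int_mult algebraic_int_power)
  have "of_nat l * coeff p j \<in> \<int>" for j
  proof (cases "j < l - 1")
    case True
    \<comment> \<open>\<open>\<zeta>^(l - j)\<close> stands for \<open>\<zeta>^(-j)\<close>. The
      summand -1 of \<open>power_sum_Z\<close> occurs in both traces and cancels; \<open>l\<close>
      does not divide \<open>1 + i\<close> for \<open>i < l - 1\<close>, so only the term
      \<open>i = j\<close> is left.\<close>
    have "trace (monom 1 (l - j) * p) - trace (monom 1 1 * p) =
      (\<Sum>i<l - 1. of_rat (coeff p i) * of_int ((if l dvd l - j + i then int l else 0)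
         - (if l dvd 1 + i then int l else 0)))"
      unfolding trace_coeffs[OF p] sum_subtractf[symmetric]
      by (rule sum.cong) (simp_all add: algebra_simps)
    also have "\<dots> = (\<Sum>i<l - 1. if i = j then of_rat (of_nat l * coeff p j) else 0)"
    proof (rule sum.cong[OF refl])
      fix i assume i: "i \<in> {..<l - 1}"
      have "\<not> l dvd 1 + i" using i by (auto dest: dvd_imp_le)
      moreover have "l dvd l - j + i \<longleftrightarrow> i = j"
      proof
        assume "l dvd l - j + i"
        then obtain c where c: "l - j + i = l * c" by (elim dvdE)
        have "l - j + i < l * 2" using i by (simp add: less_diff_conv)
        moreover have "0 < l - j + i" using True by arith
        ultimately have "c < 2" "0 < c" unfolding c by simp_all
        then have "c = 1" by simp
        then show "i = j" using c True by simp
      qed (use True in simp)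
      ultimately show "of_rat (coeff p i) * of_int ((if l dvd l - j + i then int l else 0)
         - (if l dvd 1 + i then int l else 0)) = (if i = j then of_rat (of_nat l * coeff p j) else (0 :: complex))"
        by (simp add: of_rat_mult)
    qed
    also have "\<dots> = of_rat (of_nat l * coeff p j)" using True by simp
    finally have "(of_rat (of_nat l * coeff p j) :: complex) \<in> \<int>"
      using Ints_diff[OF tr[of "l - j"] tr[of 1]] by (simp only:)
    then obtain k where "(of_rat (of_nat l * coeff p j) :: complex) = of_int k" by (elim Ints_cases)
    then have "(of_rat (of_nat l * coeff p j) :: complex) = of_rat (of_int k)" by simp
    then have "of_nat l * coeff p j = of_int k" by (simp only: of_rat_eq_iff)
    then show ?thesis by simp
  next
    case False
    then show ?thesis using p by (simp add: coeff_eq_0)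
  qed
  then show ?thesis by (simp add: int_coeffs_def)
qed

text \<open>Traces bound the denominators of the coordinates of an integer \<open>x\<close> by
  \<open>l\<close>. Since \<open>l\<close> divides \<open>l x\<close>, the integral coordinates of
  \<open>l x\<close> are divisible by \<open>l\<close>, so those of \<open>x\<close> are
  integral.\<close>

lemma integers_of_L: "integers_of L = {eval_rat \<zeta> p | p. int_coeffs p \<and> degree p < l - 1}"
proof (intro equalityI subsetI)
  fix x assume x: "x \<in> integers_of L"
  then obtain p where p: "degree p < l - 1" "x = eval_rat \<zeta> p"
    by (auto simp: integers_of_def elim: L_cases)
  then have int: "algebraic_int (eval_rat \<zeta> p)" using x by (simp add: integers_of_def)
  have "alg_dvd (of_nat l) (eval_rat \<zeta> (smult (of_nat l) p))"
    using int by (intro alg_dvdI[of "eval_rat \<zeta> p"]) (simp_all add: eval_rat_smult)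
  then have "int_coeffs (smult (1 / of_nat l) (smult (of_nat l) p))"
    using p by (intro coeffs_divisible_by_l[OF \<zeta>_Z] int_coeffs_l_times int) auto
  then have "int_coeffs p" using l_gt_1 by simp
  then show "x \<in> {eval_rat \<zeta> p | p. int_coeffs p \<and> degree p < l - 1}" using p by blast
next
  fix x assume "x \<in> {eval_rat \<zeta> p | p. int_coeffs p \<and> degree p < l - 1}"
  then show "x \<in> integers_of L"
    by (auto simp: integers_of_def L_eq algebraic_int_eval_rat algebraic_int_Z[OF \<zeta>_Z])
qed

text \<open>The product \<open>q\<close> of the \<open>p(X^k)\<close> takes the norm as its value at
  every root, so its rational trace is \<open>l - 1\<close> times the norm.\<close>

lemma norm_rational: "(\<Prod>z\<in>Z. eval_rat z p) \<in> \<rat>"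
proof -
  define q where "q = (\<Prod>k\<in>{1..<l}. pcompose p (monom 1 k))"
  have "eval_rat w q = (\<Prod>z\<in>Z. eval_rat z p)" if "w \<in> Z" for w
    using prod.reindex_bij_betw[OF bij_power[OF that], of "\<lambda>z. eval_rat z p"]
    by (simp add: q_def eval_rat_prod eval_rat_pcompose)
  then have "trace q = of_nat (l - 1) * (\<Prod>z\<in>Z. eval_rat z p)"
    by (simp add: trace_def card_Z)
  then have "(\<Prod>z\<in>Z. eval_rat z p) = trace q / of_nat (l - 1)" using l_gt_1 by simp
  then show ?thesis using trace_rational[of q] by (simp only:) (intro Rats_divide, auto)
qed

lemma norm_nat_L:
  assumes "x \<in> integers_of L"
  shows "\<exists>n::nat. (\<Prod>z\<in>Z. cmod (conjg z x)) = real n"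
proof -
  obtain p where p: "x = eval_rat \<zeta> p" "int_coeffs p"
    using assms by (auto simp: integers_of_L)
  have "(\<Prod>z\<in>Z. eval_rat z p) \<in> \<int>"
    by (rule rational_algebraic_int_is_int[OF _ norm_rational])
      (intro algebraic_int_prod algebraic_int_eval_rat p algebraic_int_Z)
  then obtain k where k: "(\<Prod>z\<in>Z. eval_rat z p) = of_int k" by (elim Ints_cases)
  have "(\<Prod>z\<in>Z. cmod (conjg z x)) = cmod (\<Prod>z\<in>Z. eval_rat z p)"
    by (simp add: p conjg_eval_rat prod_norm)
  then show ?thesis by (intro exI[of _ "nat \<bar>k\<bar>"]) (simp add: k)
qed

definition E :: "complex set" where "E = (\<lambda>i. \<zeta> ^ i) ` {..<l - 1}"

lemma integers_of_L_span: "x \<in> integers_of L \<Longrightarrow> \<exists>c. x = (\<Sum>i<l - 1. of_int (c i) * \<zeta> ^ i)"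
proof -
  assume "x \<in> integers_of L"
  then obtain p where p: "x = eval_rat \<zeta> p" "int_coeffs p" "degree p < l - 1"
    by (auto simp: integers_of_L)
  have "\<forall>i. \<exists>c. coeff p i = of_int c" using p(2) by (auto simp: int_coeffs_def elim: Ints_cases)
  then obtain c where "\<forall>i. coeff p i = of_int (c i)" by (rule choice[THEN exE])
  then show ?thesis by (auto simp: p(1) eval_rat_coeffs[OF p(3)])
qed

lemma \<zeta>_power_integer: "\<zeta> ^ i \<in> integers_of L"
proof -
  have "\<zeta> ^ i = eval_rat \<zeta> (monom 1 i)" by simp
  then have "\<zeta> ^ i \<in> L" unfolding L_eq by (metis rangeI)
  then show ?thesis
    by (simp add: integers_of_def algebraic_int_power algebraic_int_Z[OF \<zeta>_Z])
qed

section \<open>\<open>L\<close> and its real subfield as instances of the common theory\<close>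

lemma number_ring_L: "number_ring L Z conjg"
proof
  show "q \<in> L" if "q \<in> \<rat>" for q
    using that unfolding rat_adjoin_def by (intro generate_field.incl) simp
  show "x + y \<in> L" if "x \<in> L" "y \<in> L" for x y
    using that by (auto simp: L_eq simp flip: eval_rat_add)
  show "x * y \<in> L" if "x \<in> L" "y \<in> L" for x y
    using that by (auto simp: L_eq simp flip: eval_rat_mult)
  show "inverse x \<in> L" if "x \<in> L" for x
    using that eval_rat_inverse[OF \<zeta>_Z] by (auto simp: L_eq)
  show "\<exists>d::nat. d > 0 \<and> algebraic_int (of_nat d * x)" if x: "x \<in> L" for x
  proof -
    obtain p where p: "x = eval_rat \<zeta> p" using x by (auto simp: L_eq)
    obtain m :: nat where m: "m > 0" "int_coeffs (smult (of_nat m) p)"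
      using common_denominator by blast
    then show ?thesis
      using algebraic_int_eval_rat[OF m(2) algebraic_int_Z[OF \<zeta>_Z]]
      by (intro exI[of _ m]) (simp add: p eval_rat_smult)
  qed
  show "finite Z" by (rule finite_Z)
  show "Z \<noteq> {}" using \<zeta>_Z by blast
  show "conjg z (x + y) = conjg z x + conjg z y" if z: "z \<in> Z" and xy: "x \<in> L" "y \<in> L" for x y z
  proof -
    obtain p q where "x = eval_rat \<zeta> p" "y = eval_rat \<zeta> q" using xy by (auto simp: L_eq)
    then show ?thesis
      using conjg_eval_rat[OF z] by (simp flip: eval_rat_add)
  qed
  show "conjg z (x * y) = conjg z x * conjg z y" if z: "z \<in> Z" and xy: "x \<in> L" "y \<in> L" for x y z
  proof -
    obtain p q where "x = eval_rat \<zeta> p" "y = eval_rat \<zeta> q" using xy by (auto simp: L_eq)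
    then show ?thesis
      using conjg_eval_rat[OF z] by (simp flip: eval_rat_mult)
  qed
  show "conjg z q = q" if "z \<in> Z" "q \<in> \<rat>" for z q
    using that(2) conjg_eval_rat[OF that(1), of "[:_:]"] by (auto elim!: Rats_cases)
  show "\<exists>n::nat. (\<Prod>z\<in>Z. cmod (conjg z x)) = real n" if "x \<in> integers_of L" for x
    by (rule norm_nat_L[OF that])
  show "\<exists>E m. finite E \<and> E \<subseteq> integers_of L \<and> m > 0 \<and> (\<forall>x\<in>integers_of L. of_nat m * x \<in> int_span E)"
  proof (intro exI[of _ E] exI[of _ "1 :: nat"] conjI ballI)
    show "finite E" by (simp add: E_def)
    show "E \<subseteq> integers_of L" using \<zeta>_power_integer by (auto simp: E_def)
    fix x assume "x \<in> integers_of L"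
    then obtain c where "x = (\<Sum>i<l - 1. of_int (c i) * \<zeta> ^ i)"
      using integers_of_L_span by blast
    then show "of_nat 1 * x \<in> int_span E"
      by (auto intro!: int_span_sum int_span_smult int_span_base simp: E_def)
  qed simp
qed

lemma cnj_L: "x \<in> L \<Longrightarrow> cnj x \<in> L"
proof -
  assume "x \<in> L"
  then obtain p where "x = eval_rat \<zeta> p" by (auto simp: L_eq)
  then have "cnj x = eval_rat \<zeta> (pcompose p (monom 1 (l - 1)))"
    by (simp add: cnj_eval_rat cnj_eq_power[OF \<zeta>_Z] eval_rat_pcompose)
  then show ?thesis unfolding L_eq by blast
qed

abbreviation Lreal :: "complex set" where "Lreal \<equiv> maximal_real_subfield L"

lemma number_ring_Lreal: "number_ring Lreal Z conjg"
proof -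
  interpret L: number_ring L Z conjg by (rule number_ring_L)
  have sub: "x \<in> L" "x \<in> \<real>" if "x \<in> Lreal" for x
    using that by (auto simp: maximal_real_subfield_def)
  have int_sub: "x \<in> integers_of L" if "x \<in> integers_of Lreal" for x
    using that by (simp add: integers_of_def sub)
  show ?thesis
  proof
    show "q \<in> Lreal" if q: "q \<in> \<rat>" for q
    proof -
      obtain r where "q = of_rat r" using q by (elim Rats_cases)
      then have "q = of_real (of_rat r)" by (cases r) (simp add: of_rat_rat)
      then show ?thesis using L.K_Rats[OF q] by (simp add: maximal_real_subfield_def)
    qed
    show "x + y \<in> Lreal" "x * y \<in> Lreal" if "x \<in> Lreal" "y \<in> Lreal" for x y
      using that by (auto simp: maximal_real_subfield_def L.K_add L.K_mult)
    show "inverse x \<in> Lreal" if "x \<in> Lreal" for x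
      using that by (auto simp: maximal_real_subfield_def L.K_inverse)
    show "\<exists>E m. finite E \<and> E \<subseteq> integers_of Lreal \<and> m > 0 \<and>
        (\<forall>x\<in>integers_of Lreal. of_nat m * x \<in> int_span E)"
    \<comment> \<open>A real integer satisfies \<open>2 x = x + cnj x\<close>; adding to an
      expansion of \<open>x\<close> in \<open>L\<close> its conjugate gives generators
      \<open>e + cnj e\<close> with \<open>m = 2\<close>.\<close>
    proof (intro exI[of _ "(\<lambda>e. e + cnj e) ` E"] exI[of _ "2 :: nat"] conjI ballI)
      show "finite ((\<lambda>e. e + cnj e) ` E)" by (simp add: E_def)
      show "(\<lambda>e. e + cnj e) ` E \<subseteq> integers_of Lreal"
      proof (rule image_subsetI)
        fix e assume "e \<in> E"
        then have e: "e \<in> integers_of L" using \<zeta>_power_integer by (auto simp: E_def)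
        have "e + cnj e \<in> \<real>" by (simp add: complex_add_cnj)
        then show "e + cnj e \<in> integers_of Lreal"
          using e cnj_L[of e]
          by (auto simp: integers_of_def maximal_real_subfield_def intro: L.K_add algebraic_int_add)
      qed
      fix x assume x: "x \<in> integers_of Lreal"
      then obtain c where c: "x = (\<Sum>i<l - 1. of_int (c i) * \<zeta> ^ i)"
        using integers_of_L_span int_sub by blast
      have "cnj x = x" using x sub by (simp add: integers_of_def Reals_cnj_iff)
      then have "of_nat 2 * x = x + cnj x" by simp
      also have "\<dots> = (\<Sum>i<l - 1. of_int (c i) * (\<zeta> ^ i + cnj (\<zeta> ^ i)))"
        by (simp add: c sum.distrib distrib_left)
      also have "\<dots> \<in> int_span ((\<lambda>e. e + cnj e) ` E)"
      proof (intro int_span_sum int_span_smult int_span_base)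
        show "\<zeta> ^ i + cnj (\<zeta> ^ i) \<in> (\<lambda>e. e + cnj e) ` E" if "i \<in> {..<l - 1}" for i
          using that unfolding E_def by blast
      qed (simp add: E_def)
      finally show "of_nat 2 * x \<in> int_span ((\<lambda>e. e + cnj e) ` E)" .
    qed simp
    show "\<exists>d::nat. d > 0 \<and> algebraic_int (of_nat d * x)" if "x \<in> Lreal" for x
      by (rule L.denominator[OF sub(1)[OF that]])
    show "conjg z (x + y) = conjg z x + conjg z y" "conjg z (x * y) = conjg z x * conjg z y"
      if "z \<in> Z" "x \<in> Lreal" "y \<in> Lreal" for x y z
      by (simp_all add: that L.\<sigma>_add L.\<sigma>_mult sub)
    show "\<exists>n::nat. (\<Prod>z\<in>Z. cmod (conjg z x)) = real n" if "x \<in> integers_of Lreal" for x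
      by (rule L.norm_nat[OF int_sub[OF that]])
  qed (fact L.Z L.\<sigma>_Rats)+
qed

end

section \<open>Ideals whose norm to the real subfield is principal\<close>

text \<open>Elements correspond to their coordinate lists in a basis. The whole finite carrier
  serves as the first spanning list.\<close>

lemma (in ring) card_dimension:
  assumes K: "subfield K R" and fin: "finite (carrier R)"
  shows "card (carrier R) = card K ^ dim K (carrier R)"
proof -
  obtain Us where Us: "set Us = carrier R" using finite_list[OF fin] by blast
  then have "Span K Us = carrier R"
    using Span_subgroup_props(1)[OF K, of Us] Span_base_incl[OF K, of Us] by blast
  then have "finite_dimension K (carrier R)"
    using Span_finite_dimension[OF K, of Us] Us by simp
  then have "dimension (dim K (carrier R)) K (carrier R)"
    using finite_dimensionE[OF K] by (simp add: over_def)
  then obtain Vs where Vs: "set Vs \<subseteq> carrier R" "independent K Vs" "length Vs = dim K (carrier R)"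
    "Span K Vs = carrier R"
    using exists_base[OF K] by blast
  define A where "A = {Ks. set Ks \<subseteq> K \<and> length Ks = length Vs}"
  have "bij_betw (\<lambda>Ks. combine Ks Vs) A (carrier R)"
  proof (rule bij_betwI')
    fix Ks Ks' assume Ks: "Ks \<in> A" "Ks' \<in> A"
    then have "combine Ks Vs \<in> Span K Vs"
      using Span_eq_combine_set_length_version[OF K Vs(1)] by (auto simp: A_def)
    from unique_decomposition[OF K Vs(2) this] Ks
    show "combine Ks Vs = combine Ks' Vs \<longleftrightarrow> Ks = Ks'" by (auto simp: A_def)
    show "combine Ks Vs \<in> carrier R" using \<open>combine Ks Vs \<in> Span K Vs\<close> Vs(4) by simp
  next
    fix x assume "x \<in> carrier R"
    then have "x \<in> Span K Vs" using Vs(4) by simp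
    then show "\<exists>Ks\<in>A. x = combine Ks Vs"
      using Span_eq_combine_set_length_version[OF K Vs(1)] by (auto simp: A_def)
  qed
  then have "card (carrier R) = card A" by (simp add: bij_betw_same_card)
  also have "\<dots> = card K ^ length Vs"
    using card_lists_length_eq[OF finite_subset[OF subfieldE(3)[OF K] fin], of "length Vs"]
    by (simp add: A_def)
  finally show ?thesis by (simp add: Vs(3))
qed

context cyclotomic
begin

sublocale L: number_ring L Z conjg by (rule number_ring_L)
sublocale Lr: number_ring Lreal Z conjg by (rule number_ring_Lreal)

section \<open>Complex conjugation on the ideals of \<open>L\<close>\<close>

lemma cnj_R: "x \<in> L.R \<Longrightarrow> cnj x \<in> L.R"
  by (simp add: integers_of_def cnj_L)

lemma cnj_image_cnj_image: "cnj ` cnj ` I = I"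
  by (simp add: image_image)

lemma cnj_image_R: "cnj ` L.R = L.R"
proof
  show "cnj ` L.R \<subseteq> L.R" using cnj_R by blast
  then show "L.R \<subseteq> cnj ` L.R" using cnj_image_cnj_image[of L.R] by blast
qed

lemma cnj_image_scaled: "cnj ` scaled x I = scaled (cnj x) (cnj ` I)"
  by (simp add: image_image)

lemma cnj_image_ideal_mult: "cnj ` (I \<star> J) = cnj ` I \<star> cnj ` J"
proof
  have sub: "cnj ` (I \<star> J) \<subseteq> cnj ` I \<star> cnj ` J" for I J
  proof (rule image_subsetI)
    fix x assume "x \<in> I \<star> J"
    then show "cnj x \<in> cnj ` I \<star> cnj ` J"
      by (induction rule: ideal_mult_induct) (simp_all add: ideal_mult_prod ideal_mult_sum)
  qed
  then show "cnj ` (I \<star> J) \<subseteq> cnj ` I \<star> cnj ` J" .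
  have "cnj ` (cnj ` I \<star> cnj ` J) \<subseteq> I \<star> J"
    using sub[of "cnj ` I" "cnj ` J"] by (simp only: cnj_image_cnj_image)
  then show "cnj ` I \<star> cnj ` J \<subseteq> cnj ` (I \<star> J)"
    using image_mono[of "cnj ` (cnj ` I \<star> cnj ` J)" "I \<star> J" cnj] by (simp only: cnj_image_cnj_image)
qed

lemma frac_cnj_image:
  assumes I: "L.frac I"
  shows "L.frac (cnj ` I)"
proof -
  obtain x0 where x0: "x0 \<in> I" "x0 \<noteq> 0" using L.frac_nonzero[OF I] by blast
  obtain d where d: "d \<in> L.R" "d \<noteq> 0" "\<forall>x\<in>I. d * x \<in> L.R" using L.frac_denominator[OF I] by blast
  show ?thesis
  proof (rule L.fracI)
    show "cnj ` I \<subseteq> L" using L.frac_K[OF I] cnj_L by blast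
    show "0 \<in> cnj ` I" using imageI[OF L.frac_zero[OF I], of cnj] by simp
    show "cnj x0 \<in> cnj ` I" "cnj x0 \<noteq> 0" using x0 by auto
    show "x + y \<in> cnj ` I" if "x \<in> cnj ` I" "y \<in> cnj ` I" for x y
      using that L.frac_add[OF I] by (auto simp flip: complex_cnj_add)
    show "a * x \<in> cnj ` I" if a: "a \<in> L.R" and "x \<in> cnj ` I" for a x
    proof -
      from that obtain y where y: "y \<in> I" "x = cnj y" by blast
      show ?thesis
        using L.frac_mult[OF I cnj_R[OF a] y(1)] by (rule rev_image_eqI) (simp add: y(2))
    qed
    show "cnj d \<in> L.R" "cnj d \<noteq> 0" using d cnj_R by auto
    show "cnj d * x \<in> L.R" if "x \<in> cnj ` I" for x
      using that d(3) cnj_R by (auto simp flip: complex_cnj_mult)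
  qed
qed

text \<open>The relative norm of \<open>I\<close> to the real subfield, extended back to
  \<open>L\<close>.\<close>

definition norm_ideal :: "complex set \<Rightarrow> complex set" where
  "norm_ideal I = I \<star> cnj ` I"

lemma norm_ideal_mult: "norm_ideal (I \<star> J) = norm_ideal I \<star> norm_ideal J"
  unfolding norm_ideal_def cnj_image_ideal_mult
  by (metis ideal_mult_assoc ideal_mult_commute)

lemma frac_norm_ideal: "L.frac I \<Longrightarrow> L.frac (norm_ideal I)"
  unfolding norm_ideal_def by (intro L.frac_ideal_mult frac_cnj_image)

text \<open>The generator is required in \<open>Lreal\<close> because
  \<open>class_number_Lreal\<close> divides an ideal of the real subfield by it.\<close>

definition real_norm_ideals :: "complex set set" where
  "real_norm_ideals = {I. L.frac I \<and> (\<exists>x\<in>Lreal. x \<noteq> 0 \<and> norm_ideal I = scaled x L.R)}"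

lemma Lreal_L: "x \<in> Lreal \<Longrightarrow> x \<in> L"
  by (simp add: maximal_real_subfield_def)

lemma real_norm_idealsI:
  "L.frac I \<Longrightarrow> x \<in> Lreal \<Longrightarrow> x \<noteq> 0 \<Longrightarrow> norm_ideal I = scaled x L.R \<Longrightarrow> I \<in> real_norm_ideals"
  unfolding real_norm_ideals_def by blast

lemma PI_real_norm_ideals: "L.PI \<subseteq> real_norm_ideals"
proof
  fix I assume "I \<in> L.PI"
  then obtain x where x: "x \<in> L" "x \<noteq> 0" "I = scaled x L.R" by (rule L.PI_E)
  show "I \<in> real_norm_ideals"
  proof (rule real_norm_idealsI)
    show "L.frac I" unfolding x(3) by (rule L.frac_principal[OF x(1,2)])
    have "x * cnj x \<in> \<real>" by (simp add: complex_mult_cnj)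
    then show "x * cnj x \<in> Lreal"
      using x L.K_mult[OF x(1) cnj_L[OF x(1)]] by (simp add: maximal_real_subfield_def)
    show "x * cnj x \<noteq> 0" using x(2) by simp
    show "norm_ideal I = scaled (x * cnj x) L.R"
      by (simp only: norm_ideal_def x(3) cnj_image_scaled cnj_image_R scaled_ideal_mult
          scaled_ideal_mult_right scaled_scaled L.ideal_mult_R[OF L.frac_R] mult.commute[of "cnj x" x])
  qed
qed

text \<open>\<open>norm_ideal\<close> is multiplicative, so real generators multiply and invert
  along with the ideals.\<close>

lemma subgroup_real_norm_ideals: "subgroup real_norm_ideals L.IG"
proof -
  interpret comm_group L.IG by (rule L.IG_comm_group)
  show ?thesis
  proof (rule subgroupI)
    show "real_norm_ideals \<subseteq> carrier L.IG" by (auto simp: real_norm_ideals_def L.IG_simps)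
    show "real_norm_ideals \<noteq> {}"
      using subsetD[OF PI_real_norm_ideals L.PI_I[OF L.K_one one_neq_zero]] by blast
    fix I J assume I: "I \<in> real_norm_ideals" and J: "J \<in> real_norm_ideals"
    obtain x where x: "L.frac I" "x \<in> Lreal" "x \<noteq> 0" "norm_ideal I = scaled x L.R"
      using I unfolding real_norm_ideals_def by blast
    obtain y where y: "L.frac J" "y \<in> Lreal" "y \<noteq> 0" "norm_ideal J = scaled y L.R"
      using J unfolding real_norm_ideals_def by blast
    have "norm_ideal (I \<star> J) = scaled (x * y) L.R"
      by (simp only: norm_ideal_mult x(4) y(4) scaled_ideal_mult
          scaled_ideal_mult_right scaled_scaled L.ideal_mult_R[OF L.frac_R] mult.commute[of y x])
    then show "I \<otimes>\<^bsub>L.IG\<^esub> J \<in> real_norm_ideals"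
      unfolding L.IG_simps
      by (rule real_norm_idealsI[OF L.frac_ideal_mult[OF x(1) y(1)] Lr.K_mult[OF x(2) y(2)], rotated])
        (simp add: x(3) y(3))
    define I' where "I' = inv\<^bsub>L.IG\<^esub> I"
    have I': "L.frac I'" "I \<star> I' = L.R"
      using inv_closed[of I] r_inv[of I] x(1) by (simp_all add: I'_def L.IG_simps)
    have "norm_ideal I \<star> norm_ideal I' = L.R"
      unfolding norm_ideal_mult[symmetric] I'(2)
      by (simp add: norm_ideal_def cnj_image_R L.ideal_mult_R[OF L.frac_R])
    then have "scaled x (norm_ideal I') = L.R"
      by (simp only: x(4) scaled_ideal_mult L.ideal_mult_R[OF frac_norm_ideal[OF I'(1)]])
    then have "scaled (inverse x) L.R = scaled (inverse x * x) (norm_ideal I')"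
      by (simp only: scaled_scaled[symmetric])
    also have "\<dots> = norm_ideal I'" by (simp only: left_inverse[OF x(3)] scaled_one)
    finally have "norm_ideal I' = scaled (inverse x) L.R" ..
    then show "inv\<^bsub>L.IG\<^esub> I \<in> real_norm_ideals"
      unfolding I'_def[symmetric]
      using real_norm_idealsI[OF I'(1) Lr.K_inverse[OF x(2)] nonzero_imp_inverse_nonzero[OF x(3)]] by blast
  qed
qed

section \<open>Extension of ideals from the real subfield\<close>

lemma Lr_R_eq: "Lr.R = L.R \<inter> Lreal"
  by (auto simp: integers_of_def maximal_real_subfield_def)

lemma frac_extend:
  assumes A: "Lr.frac A"
  shows "L.frac (A \<star> L.R)"
proof -
  obtain x0 where x0: "x0 \<in> A" "x0 \<noteq> 0" using Lr.frac_nonzero[OF A] by blast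
  obtain d where d: "d \<in> Lr.R" "d \<noteq> 0" "\<forall>x\<in>A. d * x \<in> Lr.R" using Lr.frac_denominator[OF A] by blast
  show ?thesis
  proof (rule L.fracI)
    show "A \<star> L.R \<subseteq> L"
      by (rule ideal_mult_subsetI) (auto intro: L.K_mult L.K_add L.R_K Lreal_L Lr.frac_K[OF A])
    show "0 \<in> A \<star> L.R" using ideal_mult_prod[OF Lr.frac_zero[OF A] L.R_zero] by simp
    show "x + y \<in> A \<star> L.R" if "x \<in> A \<star> L.R" "y \<in> A \<star> L.R" for x y
      using that by (rule ideal_mult_sum)
    show "a * x \<in> A \<star> L.R" if a: "a \<in> L.R" and x: "x \<in> A \<star> L.R" for a x
      using x
    proof (induction rule: ideal_mult_induct)
      case (prod i j)
      then show ?case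
        using ideal_mult_prod[of i A "a * j" L.R] L.R_mult[OF a] by (simp add: mult.left_commute)
    qed (simp add: distrib_left ideal_mult_sum)
    show "x0 * 1 \<in> A \<star> L.R" "x0 * 1 \<noteq> 0" using x0 by (auto simp del: mult_1_right intro: ideal_mult_prod L.R_one)
    show "d \<in> L.R" "d \<noteq> 0" using d Lr_R_eq by auto
    show "d * x \<in> L.R" if "x \<in> A \<star> L.R" for x
      using that
    proof (induction rule: ideal_mult_induct)
      case (prod i j)
      then have "d * i \<in> L.R" using d(3) Lr_R_eq by blast
      then show ?case using L.R_mult[of "d * i" j] prod(2) by (simp add: mult.assoc)
    qed (simp add: distrib_left L.R_add)
  qed
qed

text \<open>An ideal whose extension is integral consists of real integers. This applies to
  \<open>C\<close> and also to its inverse \<open>C'\<close>, whose extension is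
  \<open>C' C O_L = O_L\<close>; integrality of \<open>C'\<close> gives the reverse
  inclusion.\<close>

lemma extend_contract:
  assumes C: "Lr.frac C" and ext: "C \<star> L.R = L.R"
  shows "C = Lr.R"
proof
  have sub: "D \<subseteq> Lr.R" if "Lr.frac D" "D \<star> L.R \<subseteq> L.R" for D
  proof
    fix c assume c: "c \<in> D"
    have "c * 1 \<in> D \<star> L.R" using c L.R_one by (rule ideal_mult_prod)
    then show "c \<in> Lr.R" using that Lr.frac_K[OF that(1) c] by (auto simp: Lr_R_eq)
  qed
  show "C \<subseteq> Lr.R" using sub[OF C] ext by simp
  obtain C' where C': "Lr.frac C'" "C \<star> C' = Lr.R" using Lr.frac_invertible[OF C] by blast
  have "Lr.R \<star> L.R \<subseteq> L.R"
    by (rule ideal_mult_subsetI) (auto simp: Lr_R_eq intro: L.R_mult L.R_add)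
  moreover have "C' \<star> L.R = Lr.R \<star> L.R"
  proof -
    have "C' \<star> L.R = C' \<star> (C \<star> L.R)" by (simp only: ext)
    also have "\<dots> = (C \<star> C') \<star> L.R" by (simp only: ideal_mult_assoc[symmetric] ideal_mult_commute[of C' C])
    finally show ?thesis by (simp only: C'(2))
  qed
  ultimately have "C' \<subseteq> Lr.R" using sub[OF C'(1)] by simp
  then have "C \<star> C' \<subseteq> C \<star> Lr.R" by (intro ideal_mult_mono order_refl)
  then show "Lr.R \<subseteq> C" by (simp only: C'(2) Lr.ideal_mult_R(1)[OF C])
qed

text \<open>\<open>A\<close> is fixed elementwise by conjugation, so the norm of its extension is
  \<open>A^2 O_L\<close>. Dividing \<open>A^2\<close> by the real generator \<open>x\<close> gives
  an ideal with trivial extension, to which \<open>extend_contract\<close> applies.\<close>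

lemma class_number_Lreal:
  assumes all: "\<And>I. L.frac I \<Longrightarrow> I \<in> real_norm_ideals"
  shows "\<exists>k. class_number Lreal = 2 ^ k"
proof (rule Lr.class_number_power_of_two)
  fix A assume A: "Lr.frac A"
  have R2: "L.R \<star> L.R = L.R" by (rule L.ideal_mult_R[OF L.frac_R])
  have "cnj a = a" if "a \<in> A" for a
    using Lr.frac_K[OF A that] by (simp add: maximal_real_subfield_def Reals_cnj_iff)
  then have "cnj ` A = A" by (simp add: image_def)
  then have "norm_ideal (A \<star> L.R) = (A \<star> L.R) \<star> (A \<star> L.R)"
    by (simp only: norm_ideal_def cnj_image_ideal_mult cnj_image_R)
  also have "\<dots> = (A \<star> A) \<star> (L.R \<star> L.R)"
    by (metis ideal_mult_assoc ideal_mult_commute)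
  finally have norm: "norm_ideal (A \<star> L.R) = (A \<star> A) \<star> L.R" by (simp only: R2)
  obtain x where x: "x \<in> Lreal" "x \<noteq> 0" "norm_ideal (A \<star> L.R) = scaled x L.R"
    using all[OF frac_extend[OF A]] unfolding real_norm_ideals_def by blast
  define C where "C = scaled (inverse x) (A \<star> A)"
  have C: "Lr.frac C"
    unfolding C_def
    by (rule Lr.frac_scaled[OF Lr.frac_ideal_mult[OF A A] Lr.K_inverse[OF x(1)] nonzero_imp_inverse_nonzero[OF x(2)]])
  have "C \<star> L.R = scaled (inverse x) (scaled x L.R)"
    by (simp only: C_def scaled_ideal_mult norm[symmetric] x(3))
  also have "\<dots> = L.R" by (simp only: scaled_scaled left_inverse[OF x(2)] scaled_one)
  finally have "C = Lr.R" by (rule extend_contract[OF C])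
  then have "scaled x Lr.R = scaled (x * inverse x) (A \<star> A)"
    by (simp only: C_def scaled_scaled[symmetric])
  also have "\<dots> = A \<star> A" by (simp only: right_inverse[OF x(2)] scaled_one)
  finally have "A \<star> A = scaled x Lr.R" ..
  then show "\<exists>x\<in>Lreal. x \<noteq> 0 \<and> A \<star> A = scaled x Lr.R" using x(1,2) by blast
qed

end

section \<open>Primes of the cyclotomic field\<close>

locale cyclotomic_prime = cyclotomic +
  fixes P :: "complex set"
  assumes P: "prime_of (rat_adjoin \<zeta>) P"
begin

abbreviation OL :: "complex ring" where "OL \<equiv> ring_of_integers L"

lemma OL_simps:
  "carrier OL = L.R" "x \<otimes>\<^bsub>OL\<^esub> y = x * y" "\<one>\<^bsub>OL\<^esub> = 1" "\<zero>\<^bsub>OL\<^esub> = 0" "x \<oplus>\<^bsub>OL\<^esub> y = x + y"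
  by (simp_all add: ring_of_integers_def ring_of_type_algebra_def)

lemma primeideal: "primeideal P OL"
  using P by (simp add: prime_of_def)

lemma
  shows P_R: "x \<in> P \<Longrightarrow> x \<in> L.R"
    and P_add: "x \<in> P \<Longrightarrow> y \<in> P \<Longrightarrow> x + y \<in> P"
    and P_mult: "a \<in> L.R \<Longrightarrow> x \<in> P \<Longrightarrow> a * x \<in> P"
    and P_zero: "0 \<in> P"
    and P_nonzero: "\<exists>x\<in>P. x \<noteq> 0"
    and P_one: "1 \<notin> P"
    and P_prime: "a \<in> L.R \<Longrightarrow> b \<in> L.R \<Longrightarrow> a * b \<in> P \<Longrightarrow> a \<in> P \<or> b \<in> P"
proof -
  interpret primeideal P OL by (rule primeideal)
  show "x \<in> P \<Longrightarrow> x \<in> L.R" using a_subset by (auto simp: OL_simps)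
  show "x \<in> P \<Longrightarrow> y \<in> P \<Longrightarrow> x + y \<in> P" 
    using additive_subgroup.a_closed[OF is_additive_subgroup, of x y] by (simp add: OL_simps)
  show "a \<in> L.R \<Longrightarrow> x \<in> P \<Longrightarrow> a * x \<in> P" using I_l_closed[of x a] by (simp add: OL_simps)
  show 0: "0 \<in> P" 
    using additive_subgroup.zero_closed[OF is_additive_subgroup] by (simp add: OL_simps)
  show "\<exists>x\<in>P. x \<noteq> 0" using P 0 by (auto simp: prime_of_def)
  show "1 \<notin> P" using one_imp_carrier I_notcarr by (auto simp: OL_simps)
  show "a \<in> L.R \<Longrightarrow> b \<in> L.R \<Longrightarrow> a * b \<in> P \<Longrightarrow> a \<in> P \<or> b \<in> P"
    using I_prime[of a b] by (simp add: OL_simps)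
qed

lemma P_mult_right: "x \<in> P \<Longrightarrow> a \<in> L.R \<Longrightarrow> x * a \<in> P"
  using P_mult[of a x] by (simp add: mult.commute)

lemma P_uminus: "x \<in> P \<Longrightarrow> - x \<in> P"
  using P_mult[OF L.R_of_int[of "-1"], of x] by simp

lemma P_diff: "x \<in> P \<Longrightarrow> y \<in> P \<Longrightarrow> x - y \<in> P"
  using P_add[OF _ P_uminus, of x y] by simp

lemma P_power: "a \<in> L.R \<Longrightarrow> a ^ n \<in> P \<Longrightarrow> a \<in> P"
proof (induction n)
  case (Suc n)
  then show ?case using P_prime[of a "a ^ n"] L.R_power[of a n] by auto
qed (use P_one in simp)

lemma frac_P: "L.frac P"
proof -
  obtain x0 where x0: "x0 \<in> P" "x0 \<noteq> 0" using P_nonzero by blast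
  show ?thesis
  proof (rule L.fracI)
    show "P \<subseteq> L" using P_R L.R_K by blast
    show "x0 \<in> P" "x0 \<noteq> 0" by (fact x0)+
    show "1 \<in> L.R" by (rule L.R_one)
    show "1 * x \<in> L.R" if "x \<in> P" for x using P_R[OF that] by simp
  qed (auto intro: P_zero P_add P_mult)
qed

text \<open>For nonzero \<open>x\<close> in \<open>P\<close> some positive \<open>d\<close> makes
  \<open>d / x\<close> integral, so \<open>d\<close> lies in \<open>P\<close>; primality then
  descends to a prime factor of \<open>d\<close>.\<close>

lemma prime_number_in_P: "\<exists>p::nat. Factorial_Ring.prime p \<and> of_nat p \<in> P"
proof -
  obtain x where x: "x \<in> P" "x \<noteq> 0" using P_nonzero by blast
  have inv: "inverse x \<in> L" using L.K_inverse L.R_K P_R x(1) by blast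
  then obtain d :: nat where d: "d > 0" "algebraic_int (of_nat d * inverse x)"
    using L.denominator by blast
  have "of_nat d * inverse x \<in> L.R"
    using d(2) L.K_mult[OF L.K_of_nat inv] by (simp add: integers_of_def)
  from P_mult[OF this x(1)] have "of_nat d \<in> P" using x(2) by (simp add: mult.assoc)
  have "n > 0 \<Longrightarrow> of_nat n \<in> P \<Longrightarrow> ?thesis" for n :: nat
  proof (induction n rule: less_induct)
    case (less n)
    have "n \<noteq> 1" using less.prems P_one by auto
    then obtain q where q: "Factorial_Ring.prime q" "q dvd n" using prime_factor_nat by blast
    then obtain m where m: "n = q * m" by (elim dvdE)
    have "of_nat q \<in> P \<or> of_nat m \<in> P"
      using P_prime[OF L.R_of_nat L.R_of_nat, of q m] less.prems(2) m by simp
    then show ?case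
    proof
      assume "of_nat q \<in> P"
      then show ?case using q by blast
    next
      assume "of_nat m \<in> P"
      moreover have "m < n" "m > 0" using m less.prems(1) prime_gt_1_nat[OF q(1)] by auto
      ultimately show ?case using less.IH by blast
    qed
  qed
  then show ?thesis using d(1) \<open>of_nat d \<in> P\<close> by blast
qed

lemma int_in_P_iff:
  assumes p: "Factorial_Ring.prime (p::nat)" "of_nat p \<in> P"
  shows "of_int a \<in> P \<longleftrightarrow> int p dvd a"
proof
  assume "int p dvd a"
  then obtain c where "a = int p * c" by (elim dvdE)
  then show "of_int a \<in> P" using P_mult_right[OF p(2) L.R_of_int[of c]] by simp
next
  assume a: "of_int a \<in> P"
  show "int p dvd a"
  proof (rule ccontr)
    assume "\<not> int p dvd a"
    then have "Rings.coprime (int p) a" using p(1) by (simp add: prime_imp_coprime)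
    then have "gcd (int p) a = 1" by (simp add: coprime_iff_gcd_eq_1)
    then obtain u v where uv: "u * int p + v * a = 1" using bezout_int[of "int p" a] by auto
    have "of_int u * of_nat p + of_int v * of_int a = (of_int (u * int p + v * a) :: complex)" by simp
    then have "of_int u * of_nat p + of_int v * of_int a = (1 :: complex)" unfolding uv by simp
    then have "1 \<in> P"
      using P_add[OF P_mult[OF L.R_of_int[of u] p(2)] P_mult[OF L.R_of_int[of v] a]] by simp
    then show False using P_one by simp
  qed
qed

lemma quotient_in_R: "alg_dvd x y \<Longrightarrow> x \<in> L \<Longrightarrow> y \<in> L \<Longrightarrow> x \<noteq> 0 \<Longrightarrow> \<exists>u\<in>L.R. y = x * u"
proof -
  assume xy: "alg_dvd x y" "x \<in> L" "y \<in> L" "x \<noteq> 0"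
  then obtain u where u: "algebraic_int u" "y = x * u" by (auto simp: alg_dvd_def)
  then have "u = y / x" using xy(4) by simp
  then have "u \<in> L.R" using u(1) L.K_divide[OF xy(3,2)] by (simp add: integers_of_def)
  then show ?thesis using u(2) by blast
qed

lemma Z_R: "w \<in> Z \<Longrightarrow> w \<in> L.R"
proof -
  assume "w \<in> Z"
  then have "w \<in> (\<lambda>k. \<zeta> ^ k) ` {1..<l}" using bij_power[OF \<zeta>_Z] by (simp add: bij_betw_def)
  then show ?thesis using \<zeta>_power_integer by blast
qed

text \<open>\<open>l\<close> and \<open>(1 - w)^(l - 1)\<close> are associates, and a prime ideal
  contains a power only with its base.\<close>

lemma one_minus_in_P_iff:
  assumes w: "w \<in> Z"
  shows "1 - w \<in> P \<longleftrightarrow> of_nat l \<in> P"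
proof -
  have w1: "1 - w \<noteq> 0" using w by (simp add: Z_def)
  have wR: "1 - w \<in> L.R" by (intro L.R_diff L.R_one Z_R w)
  have wL: "(1 - w) ^ (l - 1) \<in> L" by (intro L.R_K L.R_power wR)
  show ?thesis
  proof
    assume "1 - w \<in> P"
    obtain u where u: "u \<in> L.R" "of_nat l = (1 - w) ^ (l - 1) * u"
      using quotient_in_R[OF l_associated(1)[OF w] wL L.K_of_nat power_not_zero[OF w1]] by blast
    have "(1 - w) ^ (l - 1) = (1 - w) ^ (l - 2) * (1 - w)"
    proof -
      have "l - 1 = Suc (l - 2)" using l_ge_3 by simp
      then show ?thesis by (simp only: power_Suc2)
    qed
    then have "(1 - w) ^ (l - 1) \<in> P" using P_mult[OF L.R_power[OF wR] \<open>1 - w \<in> P\<close>] by simp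
    then show "of_nat l \<in> P" using P_mult_right u by simp
  next
    assume l: "of_nat l \<in> P"
    obtain u where u: "u \<in> L.R" "(1 - w) ^ (l - 1) = of_nat l * u"
      using quotient_in_R[OF l_associated(2)[OF w] L.K_of_nat wL] l_gt_1 by fastforce
    then have "(1 - w) ^ (l - 1) \<in> P" using P_mult_right[OF l u(1)] by simp
    then show "1 - w \<in> P" by (rule P_power[OF wR])
  qed
qed

text \<open>Modulo \<open>1 - \<zeta>\<close> every integer of \<open>L\<close> is congruent to the
  sum \<open>a\<close> of its coordinates. For an element of \<open>P\<close> this \<open>a\<close>
  lies in \<open>P\<close>, so it is divisible by \<open>l\<close> and hence by
  \<open>1 - \<zeta>\<close>.\<close>

lemma prime_above_l:
  assumes l: "of_nat l \<in> P"
  shows "P = scaled (1 - \<zeta>) L.R"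
proof
  have lam: "1 - \<zeta> \<in> P" using one_minus_in_P_iff[OF \<zeta>_Z] l by simp
  have lamR: "1 - \<zeta> \<in> L.R" by (rule P_R[OF lam])
  show "scaled (1 - \<zeta>) L.R \<subseteq> P" using P_mult_right[OF lam] by blast
  show "P \<subseteq> scaled (1 - \<zeta>) L.R"
  proof
    fix x assume x: "x \<in> P"
    obtain c where c: "x = (\<Sum>i<l - 1. of_int (c i) * \<zeta> ^ i)"
      using integers_of_L_span[OF P_R[OF x]] by blast
    define a where "a = (\<Sum>i<l - 1. c i)"
    define y where "y = (\<Sum>i<l - 1. of_int (c i) * (\<Sum>j<i. \<zeta> ^ j))"
    have y: "y \<in> L.R" unfolding y_def by (intro L.R_sum L.R_mult L.R_of_int \<zeta>_power_integer)
    have "of_int a - x = (\<Sum>i<l - 1. of_int (c i) * (1 - \<zeta> ^ i))"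
      by (simp add: a_def c sum_subtractf right_diff_distrib)
    also have "\<dots> = (1 - \<zeta>) * y"
      by (simp add: y_def one_diff_power_eq sum_distrib_left mult_ac)
    finally have ax: "of_int a = x + (1 - \<zeta>) * y" by (simp add: algebra_simps)
    then have "of_int a \<in> P" using P_add[OF x P_mult_right[OF lam y]] by simp
    then have "int l dvd a" using int_in_P_iff[OF prime l] by simp
    then obtain b where b: "a = int l * b" by (elim dvdE)
    have "alg_dvd (1 - \<zeta>) (of_nat l)"
    proof (rule alg_dvd_trans[OF _ l_associated(1)[OF \<zeta>_Z]])
      have "(1 - \<zeta>) ^ (l - 1) = (1 - \<zeta>) * (1 - \<zeta>) ^ (l - 2)"
      proof -
        have "l - 1 = Suc (l - 2)" using l_ge_3 by simp
        then show ?thesis by (simp only: power_Suc)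
      qed
      then show "alg_dvd (1 - \<zeta>) ((1 - \<zeta>) ^ (l - 1))"
        by (rule alg_dvdI[rotated]) (intro algebraic_int_intros algebraic_int_Z \<zeta>_Z)
    qed
    then obtain v where v: "v \<in> L.R" "of_nat l = (1 - \<zeta>) * v"
      using quotient_in_R[OF _ L.R_K[OF lamR] L.K_of_nat] \<zeta>_Z unfolding Z_def by fastforce
    have "x = (1 - \<zeta>) * (v * of_int b - y)"
      using ax b v(2) by (simp add: algebra_simps)
    moreover have "v * of_int b - y \<in> L.R" by (intro L.R_diff L.R_mult L.R_of_int v y)
    ultimately show "x \<in> scaled (1 - \<zeta>) L.R" by blast
  qed
qed

lemma real_norm_if_l_in_P: "of_nat l \<in> P \<Longrightarrow> P \<in> real_norm_ideals"
proof -
  assume l: "of_nat l \<in> P"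
  have "1 - \<zeta> \<in> L" by (intro L.R_K L.R_diff L.R_one Z_R \<zeta>_Z)
  moreover have "1 - \<zeta> \<noteq> 0" using \<zeta>_Z by (simp add: Z_def)
  ultimately have "scaled (1 - \<zeta>) L.R \<in> L.PI" by (rule L.PI_I)
  then have "P \<in> L.PI" using prime_above_l[OF l] by simp
  then show ?thesis using PI_real_norm_ideals by blast
qed

section \<open>The residue field at \<open>P\<close>\<close>

definition coset :: "complex \<Rightarrow> complex set" where
  "coset x = P +>\<^bsub>OL\<^esub> x"

lemma coset_eq_iff:
  assumes "x \<in> L.R" "y \<in> L.R"
  shows "coset x = coset y \<longleftrightarrow> x - y \<in> P"
proof -
  have *: "coset x = {h + x | h. h \<in> P}" for x
    by (auto simp: coset_def a_r_coset_def' OL_simps)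
  show ?thesis
  proof
    assume eq: "coset x = coset y"
    have "0 + x \<in> coset x" unfolding * using P_zero by blast
    then obtain h where "h \<in> P" "0 + x = h + y" unfolding eq unfolding * by blast
    then show "x - y \<in> P" by simp
  next
    assume xy: "x - y \<in> P"
    show "coset x = coset y"
    proof (intro equalityI subsetI)
      fix t assume "t \<in> coset x"
      then obtain h where "h \<in> P" "t = h + x" unfolding * by blast
      then show "t \<in> coset y"
        unfolding * using P_add[OF _ xy, of h] by (intro CollectI exI[of _ "h + (x - y)"]) simp
    next
      fix t assume "t \<in> coset y"
      then obtain h where "h \<in> P" "t = h + y" unfolding * by blast
      then show "t \<in> coset x"
        unfolding * using P_diff[OF _ xy, of h] by (intro CollectI exI[of _ "h - (x - y)"]) simp
    qed
  qed
qed

abbreviation FP :: "complex set ring" where "FP \<equiv> OL Quot P"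

lemma carrier_FP: "carrier FP = coset ` L.R"
  by (auto simp: FactRing_def A_RCOSETS_def' coset_def OL_simps)

lemma FP_mult: "x \<in> L.R \<Longrightarrow> y \<in> L.R \<Longrightarrow> coset x \<otimes>\<^bsub>FP\<^esub> coset y = coset (x * y)"
proof -
  interpret primeideal P OL by (rule primeideal)
  show "x \<in> L.R \<Longrightarrow> y \<in> L.R \<Longrightarrow> ?thesis"
    using rcoset_mult_add[of x y] by (simp add: FactRing_def coset_def OL_simps)
qed

lemma FP_one: "\<one>\<^bsub>FP\<^esub> = coset 1"
  by (simp add: FactRing_def coset_def OL_simps)

lemma FP_zero: "\<zero>\<^bsub>FP\<^esub> = coset 0"
proof -
  have "coset 0 = P" by (auto simp: coset_def a_r_coset_def' OL_simps)
  then show ?thesis by (simp add: FactRing_def)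
qed

text \<open>Representatives of \<open>O_L\<close> modulo \<open>p\<close>, by reduction of the
  integral coordinates. Their number is at most \<open>p^(l - 1)\<close>, the bound that
  \<open>norm_ideal_P\<close> compares with two residue fields.\<close>

definition reps :: "nat \<Rightarrow> complex set" where
  "reps p = (\<lambda>c. \<Sum>i<l - 1. of_nat (c i) * \<zeta> ^ i) ` ({..<l - 1} \<rightarrow>\<^sub>E {..<p})"

lemma reps_R: "r \<in> reps p \<Longrightarrow> r \<in> L.R"
  by (auto simp: reps_def intro!: L.R_sum L.R_mult L.R_of_nat \<zeta>_power_integer)

lemma finite_reps: "finite (reps p)"
  by (simp add: reps_def finite_PiE)

lemma card_reps: "card (reps p) \<le> p ^ (l - 1)"
  using card_image_le[of "{..<l - 1} \<rightarrow>\<^sub>E {..<p}"] by (simp add: reps_def finite_PiE card_PiE)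

lemma zero_reps: "p > 0 \<Longrightarrow> 0 \<in> reps p"
  unfolding reps_def
  by (rule image_eqI[of _ _ "\<lambda>i\<in>{..<l - 1}. 0"]) auto

lemma reps_cover:
  assumes x: "x \<in> L.R" and p: "p > 0"
  shows "\<exists>r\<in>reps p. \<exists>y\<in>L.R. x = r + of_nat p * y"
proof -
  obtain c where c: "x = (\<Sum>i<l - 1. of_int (c i) * \<zeta> ^ i)"
    using integers_of_L_span[OF x] by blast
  define a where "a = (\<lambda>i\<in>{..<l - 1}. nat (c i mod int p))"
  define r where "r = (\<Sum>i<l - 1. of_nat (a i) * \<zeta> ^ i)"
  define y where "y = (\<Sum>i<l - 1. of_int (c i div int p) * \<zeta> ^ i)"
  have "nat (k mod int p) < p" for k
    using p by (simp add: nat_less_iff)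
  then have "a \<in> {..<l - 1} \<rightarrow>\<^sub>E {..<p}" by (simp add: a_def)
  then have "r \<in> reps p" unfolding r_def reps_def by (rule imageI)
  moreover have "y \<in> L.R" unfolding y_def by (intro L.R_sum L.R_mult L.R_of_int \<zeta>_power_integer)
  moreover have "x = r + of_nat p * y"
  proof -
    have "of_int (c i) = of_nat (a i) + of_nat p * (of_int (c i div int p) :: complex)" if "i < l - 1" for i
    proof -
      have "c i = int (a i) + int p * (c i div int p)"
        using that p by (simp add: a_def)
      then have "of_int (c i) = (of_int (int (a i) + int p * (c i div int p)) :: complex)" by (rule arg_cong)
      then show ?thesis by simp
    qed
    then have "x = (\<Sum>i<l - 1. (of_nat (a i) + of_nat p * of_int (c i div int p)) * \<zeta> ^ i)"
      unfolding c by (intro sum.cong) auto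
    also have "\<dots> = r + of_nat p * y"
      by (simp add: r_def y_def sum.distrib distrib_right sum_distrib_left mult.assoc)
    finally show ?thesis .
  qed
  ultimately show ?thesis by blast
qed

end

context cyclotomic_prime
begin

lemma coset_mem_FP: "x \<in> L.R \<Longrightarrow> coset x \<in> coset ` L.R"
  by (rule imageI)

lemma finite_FP: "finite (coset ` L.R)"
proof -
  obtain p :: nat where p: "Factorial_Ring.prime p" "of_nat p \<in> P" using prime_number_in_P by blast
  have "coset ` L.R \<subseteq> coset ` reps p"
  proof (rule image_subsetI)
    fix x assume x: "x \<in> L.R"
    obtain r y where r: "r \<in> reps p" "y \<in> L.R" "x = r + of_nat p * y"
      using reps_cover[OF x prime_gt_0_nat[OF p(1)]] by blast
    then have "x - r \<in> P" using P_mult_right[OF p(2) r(2)] by simp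
    then have "coset x = coset r" using coset_eq_iff[OF x reps_R[OF r(1)]] by simp
    then show "coset x \<in> coset ` reps p" using r(1) by simp
  qed
  then show ?thesis by (rule finite_subset) (simp add: finite_reps)
qed

text \<open>There are finitely many residue classes, so two powers of \<open>y\<close> agree modulo
  \<open>P\<close>; cancelling the smaller one leaves \<open>y\<close> times a power congruent to
  1.\<close>

lemma inverse_mod_P:
  assumes y: "y \<in> L.R" "y \<notin> P"
  shows "\<exists>w\<in>L.R. y * w - 1 \<in> P"
proof -
  have yR: "y ^ n \<in> L.R" for n by (rule L.R_power[OF y(1)])
  have "\<not> inj_on (\<lambda>n::nat. coset (y ^ n)) UNIV"
  proof
    assume inj: "inj_on (\<lambda>n::nat. coset (y ^ n)) UNIV"
    have "range (\<lambda>n. coset (y ^ n)) \<subseteq> coset ` L.R" using yR by blast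
    from finite_imageD[OF finite_subset[OF this finite_FP] inj] show False by simp
  qed
  then obtain i j :: nat where "i \<noteq> j" "coset (y ^ i) = coset (y ^ j)"
    unfolding inj_on_def by blast
  then obtain i j :: nat where ij: "i < j" "coset (y ^ j) = coset (y ^ i)"
    by (metis linorder_neqE_nat)
  then have "y ^ j - y ^ i \<in> P" using coset_eq_iff[OF yR[of j] yR[of i]] by simp
  moreover have "y ^ j - y ^ i = y ^ i * (y * y ^ (j - i - 1) - 1)"
  proof -
    have "j = i + Suc (j - i - 1)" using ij(1) by simp
    from arg_cong[OF this, of "\<lambda>n. y ^ n"] have "y ^ j = y ^ i * (y * y ^ (j - i - 1))"
      by (simp only: power_add power_Suc)
    then show ?thesis by (simp add: right_diff_distrib)
  qed
  ultimately have "y ^ i * (y * y ^ (j - i - 1) - 1) \<in> P" by simp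
  moreover have "y ^ i \<notin> P" using P_power[OF y(1), of i] y(2) by blast
  moreover have "y * y ^ (j - i - 1) - 1 \<in> L.R" by (intro L.R_diff L.R_mult y yR L.R_one)
  ultimately have "y * y ^ (j - i - 1) - 1 \<in> P" using P_prime[OF yR[of i]] by blast
  then show ?thesis using yR[of "j - i - 1"] by blast
qed

lemma field_FP: "Ring.field FP"
proof -
  have "cring FP"
    using ideal.quotient_is_cring[OF primeideal.axioms(1)[OF primeideal] primeideal.axioms(2)[OF primeideal]] .
  then show ?thesis
  proof (rule cring.cring_fieldI2)
    show "\<zero>\<^bsub>FP\<^esub> \<noteq> \<one>\<^bsub>FP\<^esub>"
      unfolding FP_one FP_zero coset_eq_iff[OF L.R_zero L.R_one] using P_uminus[of "- 1"] P_one by auto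
    fix a assume a: "a \<in> carrier FP" "a \<noteq> \<zero>\<^bsub>FP\<^esub>"
    then obtain y where y: "y \<in> L.R" "a = coset y" unfolding carrier_FP by blast
    then have "y \<notin> P" using a(2) coset_eq_iff[OF y(1) L.R_zero] by (simp add: FP_zero)
    then obtain w where w: "w \<in> L.R" "y * w - 1 \<in> P" using inverse_mod_P[OF y(1)] by blast
    then have "coset y \<otimes>\<^bsub>FP\<^esub> coset w = \<one>\<^bsub>FP\<^esub>"
      using FP_mult[OF y(1) w(1)] coset_eq_iff[OF L.R_mult[OF y(1) w(1)] L.R_one] by (simp add: FP_one)
    then show "\<exists>b\<in>carrier FP. a \<otimes>\<^bsub>FP\<^esub> b = \<one>\<^bsub>FP\<^esub>" using w(1) unfolding carrier_FP y(2) by blast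
  qed
qed

lemma integers_of_Rats: "integers_of \<rat> = \<int>"
  using rational_algebraic_int_is_int int_imp_algebraic_int by (auto simp: integers_of_def elim: Ints_cases)

lemma card_prime_field:
  assumes p: "Factorial_Ring.prime (p::nat)" "of_nat p \<in> P"
  shows "card (coset ` \<int>) = p"
proof -
  have "coset ` \<int> = (\<lambda>k. coset (of_int k)) ` {0..<int p}"
  proof
    show "coset ` \<int> \<subseteq> (\<lambda>k. coset (of_int k)) ` {0..<int p}"
    proof (rule image_subsetI)
      fix x :: complex assume "x \<in> \<int>"
      then obtain k where k: "x = of_int k" by (elim Ints_cases)
      have "int p dvd k - k mod int p" by (simp add: minus_mod_eq_mult_div)
      then have "(of_int (k - k mod int p) :: complex) \<in> P" using int_in_P_iff[OF p] by blast
      then have "coset x = coset (of_int (k mod int p))"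
        unfolding k by (subst coset_eq_iff[OF L.R_of_int L.R_of_int]) simp
      moreover have "k mod int p \<in> {0..<int p}" using prime_gt_0_nat[OF p(1)] by simp
      ultimately show "coset x \<in> (\<lambda>k. coset (of_int k)) ` {0..<int p}" by blast
    qed
    show "(\<lambda>k. coset (of_int k)) ` {0..<int p} \<subseteq> coset ` \<int>" by auto
  qed
  moreover have "inj_on (\<lambda>k. coset (of_int k)) {0..<int p}"
  proof (rule inj_onI)
    fix a b assume ab: "a \<in> {0..<int p}" "b \<in> {0..<int p}" "coset (of_int a) = coset (of_int b)"
    then have "(of_int (a - b) :: complex) \<in> P" using coset_eq_iff[OF L.R_of_int L.R_of_int] by simp
    then have "int p dvd a - b" using int_in_P_iff[OF p] by blast
    then show "a = b" using ab(1,2) by (auto dest: zdvd_not_zless[rotated 1] simp: mod_eq_dvd_iff[symmetric])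
  qed
  ultimately show ?thesis by (simp add: card_image)
qed

lemma card_residue_field:
  assumes p: "Factorial_Ring.prime (p::nat)" "of_nat p \<in> P"
  shows "card (coset ` L.R) = p ^ residue_degree L \<rat> P"
proof -
  interpret F: Ring.field FP by (rule field_FP)
  have hom: "ring_hom_ring OL FP coset"
    using ideal.rcos_ring_hom_ring[OF primeideal.axioms(1)[OF primeideal]]
    by (simp add: coset_def[abs_def])
  have "cring OL" by (rule primeideal.axioms(2)[OF primeideal])
  then interpret O: cring OL .
  have minus: "\<ominus>\<^bsub>OL\<^esub> x = - x" if "x \<in> \<int>" for x
  proof (rule O.minus_equality)
    show "x \<in> carrier OL" "- x \<in> carrier OL" using that L.R_of_int unfolding OL_simps
      by (auto elim!: Ints_cases) (metis L.R_of_int of_int_minus)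
  qed (simp add: OL_simps)
  have "subring \<int> OL"
  proof (rule O.subringI)
    show "\<int> \<subseteq> carrier OL" using L.R_of_int unfolding OL_simps by (auto elim!: Ints_cases)
  qed (auto simp: OL_simps minus)
  then have sub: "subring (coset ` \<int>) FP" by (rule ring_hom_ring.img_is_subring[OF hom])
  have "subfield (coset ` \<int>) FP"
  proof (rule F.subfieldI'[OF sub])
    fix k assume k: "k \<in> coset ` \<int> - {\<zero>\<^bsub>FP\<^esub>}"
    then obtain a where a: "k = coset (of_int a)" by (auto elim!: Ints_cases)
    have "\<not> int p dvd a"
      using k int_in_P_iff[OF p] coset_eq_iff[OF L.R_of_int[of a] L.R_zero] by (auto simp: a FP_zero)
    then have "gcd a (int p) = 1"
      using p(1) by (metis coprime_iff_gcd_eq_1 coprime_commute prime_imp_coprime prime_nat_int_transfer)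
    then obtain u v where uv: "u * a + v * int p = 1" using bezout_int[of a "int p"] by auto
    have "of_int a * of_int u - (1 :: complex) = of_int (a * u - 1)" by simp
    also have "a * u - 1 = int p * (- v)" using uv by (simp add: algebra_simps)
    finally have "of_int a * of_int u - (1 :: complex) \<in> P" using int_in_P_iff[OF p] by (metis dvd_triv_left)
    then have "coset (of_int a) \<otimes>\<^bsub>FP\<^esub> coset (of_int u) = \<one>\<^bsub>FP\<^esub>"
      unfolding FP_one FP_mult[OF L.R_of_int L.R_of_int]
      using coset_eq_iff[OF L.R_mult[OF L.R_of_int L.R_of_int] L.R_one] by blast
    then have "inv\<^bsub>FP\<^esub> k = coset (of_int u)"
      unfolding a
      by (intro F.comm_inv_char) (simp_all only: carrier_FP coset_mem_FP L.R_of_int)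
    then show "inv\<^bsub>FP\<^esub> k \<in> coset ` \<int>" by simp
  qed
  then have "card (carrier FP) = card (coset ` \<int>) ^ F.dim (coset ` \<int>) (carrier FP)"
    by (rule F.card_dimension) (simp only: carrier_FP finite_FP)
  moreover have "residue_degree L \<rat> P = F.dim (coset ` \<int>) (carrier FP)"
    by (simp add: residue_degree_def Let_def integers_of_Rats coset_def[abs_def])
  ultimately show ?thesis by (simp add: carrier_FP card_prime_field[OF p])
qed

text \<open>If complex conjugation preserved \<open>P\<close>, it would be an involution of the residue field. It
  cannot be trivial, and the residue field would be a quadratic extension of the fixed field.\<close>

lemma cnj_P_neq:
  assumes odd_deg: "odd (residue_degree L \<rat> P)" and l: "of_nat l \<notin> P"
  shows "cnj ` P \<noteq> P"
proof
  assume stable: "cnj ` P = P"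
  have cnj_P: "cnj x \<in> P" if "x \<in> P" for x using that stable by blast
  define r where "r Y = inv_into L.R coset Y" for Y
  have r: "r Y \<in> L.R" "coset (r Y) = Y" if "Y \<in> coset ` L.R" for Y
    using that by (simp_all add: r_def inv_into_into f_inv_into_f)
  define F0 where "F0 = coset ` {x \<in> L.R. x - cnj x \<in> P}"
  have F0_sub: "Y \<in> coset ` L.R" if "Y \<in> F0" for Y using that by (auto simp: F0_def)
  have F0_r: "r Y - cnj (r Y) \<in> P" if Y: "Y \<in> F0" for Y
  proof -
    obtain x where x: "x \<in> L.R" "x - cnj x \<in> P" "Y = coset x" using Y by (auto simp: F0_def)
    have rx: "r Y - x \<in> P" using r[OF F0_sub[OF Y]] coset_eq_iff[OF _ x(1)] x(3) by blast
    show ?thesis using P_diff[OF P_add[OF rx x(2)] cnj_P[OF rx]] by simp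
  qed
  have "\<exists>x0\<in>L.R. x0 - cnj x0 \<notin> P"
  proof (rule ccontr)
    assume "\<not> (\<exists>x0\<in>L.R. x0 - cnj x0 \<notin> P)"
    \<comment> \<open>A trivial action would give \<open>\<zeta>\<close> congruent to its inverse,
      so \<open>1 - \<zeta>^2\<close> would lie in \<open>P\<close>; as \<open>\<zeta>^2\<close> is
      again in \<open>Z\<close>, this puts \<open>P\<close> above \<open>l\<close>.\<close>
    then have "\<zeta> - cnj \<zeta> \<in> P" using Z_R[OF \<zeta>_Z] by blast
    from P_mult[OF Z_R[OF \<zeta>_Z] this] have "\<zeta> ^ 2 - \<zeta> * \<zeta> ^ (l - 1) \<in> P"
      by (simp add: cnj_eq_power[OF \<zeta>_Z] right_diff_distrib power2_eq_square)
    moreover have "\<zeta> * \<zeta> ^ (l - 1) = 1"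
    proof -
      have "\<zeta> * \<zeta> ^ (l - 1) = \<zeta> ^ l" using l_gt_1 by (simp flip: power_Suc)
      then show ?thesis using \<zeta>_Z by (simp add: Z_def)
    qed
    ultimately have "- (\<zeta> ^ 2 - 1) \<in> P" by (intro P_uminus) simp
    then have "1 - \<zeta> ^ 2 \<in> P" by simp
    moreover have "\<not> l dvd 2" using l_ge_3 by (auto dest: dvd_imp_le)
    ultimately show False using one_minus_in_P_iff[OF power_in_Z[OF \<zeta>_Z]] l by blast
  qed
  then obtain x0 where x0: "x0 \<in> L.R" "x0 - cnj x0 \<notin> P" by blast
  have x0': "cnj x0 \<in> L.R" "x0 - cnj x0 \<in> L.R" using x0(1) by (auto intro: cnj_R L.R_diff)
  obtain w where w: "w \<in> L.R" "(x0 - cnj x0) * w - 1 \<in> P" using inverse_mod_P[OF x0'(2) x0(2)] by blast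
  \<comment> \<open>Coordinates with respect to 1 and \<open>x0\<close> over the fixed field
    \<open>F0\<close>. Bijectivity of \<open>h\<close> says that the residue field has
    \<open>card F0 ^ 2\<close> elements.\<close>
  define h where "h = (\<lambda>(A, B). coset (r A + x0 * r B))"
  have hR: "r A + x0 * r B \<in> L.R" if "A \<in> F0" "B \<in> F0" for A B
    using that x0(1) by (intro L.R_add L.R_mult r F0_sub)
  have inj: "A = A' \<and> B = B'"
    if F: "A \<in> F0" "B \<in> F0" "A' \<in> F0" "B' \<in> F0" and eq: "h (A, B) = h (A', B')" for A B A' B'
  proof -
    note rR = r(1)[OF F0_sub]
    define s t where "s = r A - r A'" and "t = r B - r B'"
    have st: "s \<in> L.R" "t \<in> L.R" using F rR by (auto simp: s_def t_def intro: L.R_diff)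
    have "(r A + x0 * r B) - (r A' + x0 * r B') \<in> P"
      using eq coset_eq_iff[OF hR[OF F(1,2)] hR[OF F(3,4)]] by (simp add: h_def)
    moreover have "(r A + x0 * r B) - (r A' + x0 * r B') = s + x0 * t"
      by (simp add: s_def t_def algebra_simps)
    ultimately have 1: "s + x0 * t \<in> P" by simp
    have "(r A - cnj (r A)) - (r A' - cnj (r A')) \<in> P" by (rule P_diff[OF F0_r[OF F(1)] F0_r[OF F(3)]])
    moreover have "(r A - cnj (r A)) - (r A' - cnj (r A')) = s - cnj s" by (simp add: s_def)
    ultimately have s: "s - cnj s \<in> P" by simp
    have "(r B - cnj (r B)) - (r B' - cnj (r B')) \<in> P" by (rule P_diff[OF F0_r[OF F(2)] F0_r[OF F(4)]])
    moreover have "(r B - cnj (r B)) - (r B' - cnj (r B')) = t - cnj t" by (simp add: t_def)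
    ultimately have t: "t - cnj t \<in> P" by simp
    \<comment> \<open>Subtracting the conjugate relation eliminates \<open>s\<close> and leaves
      \<open>(x0 - cnj x0) t\<close>, where the first factor is invertible modulo
      \<open>P\<close>.\<close>
    have "(s + x0 * t) - cnj (s + x0 * t) - (s - cnj s) - cnj x0 * (t - cnj t) \<in> P"
      by (rule P_diff[OF P_diff[OF P_diff[OF 1 cnj_P[OF 1]] s] P_mult[OF x0'(1) t]])
    moreover have "(s + x0 * t) - cnj (s + x0 * t) - (s - cnj s) - cnj x0 * (t - cnj t) = (x0 - cnj x0) * t"
      by (simp add: algebra_simps)
    ultimately have "(x0 - cnj x0) * t \<in> P" by simp
    then have tP: "t \<in> P" using P_prime[OF x0'(2) st(2)] x0(2) by simp
    have "(s + x0 * t) - x0 * t \<in> P" by (rule P_diff[OF 1 P_mult[OF x0(1) tP]])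
    then have sP: "s \<in> P" by simp
    have "coset (r A) = coset (r A')" "coset (r B) = coset (r B')"
      using coset_eq_iff[OF rR[OF F(1)] rR[OF F(3)]] coset_eq_iff[OF rR[OF F(2)] rR[OF F(4)]] sP tP
      by (simp_all add: s_def t_def)
    then show ?thesis using r(2)[OF F0_sub[OF F(1)]] r(2)[OF F0_sub[OF F(2)]]
        r(2)[OF F0_sub[OF F(3)]] r(2)[OF F0_sub[OF F(4)]] by simp
  qed
  have "bij_betw h (F0 \<times> F0) (coset ` L.R)"
    unfolding bij_betw_def
  proof
    show "inj_on h (F0 \<times> F0)"
    proof (rule inj_onI)
      fix u v assume uv: "u \<in> F0 \<times> F0" "v \<in> F0 \<times> F0" "h u = h v"
      then show "u = v"
        using inj[of "fst u" "snd u" "fst v" "snd v"] by (simp add: mem_Times_iff prod_eq_iff)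
    qed
    show "h ` (F0 \<times> F0) = coset ` L.R"
    proof (intro equalityI image_subsetI)
      fix Y assume "Y \<in> F0 \<times> F0"
      then show "h Y \<in> coset ` L.R" using hR by (auto simp: h_def)
    next
      fix y assume y: "y \<in> L.R"
      \<comment> \<open>Solves \<open>y = s + x0 t\<close> with \<open>s\<close>, \<open>t\<close>
        fixed modulo \<open>P\<close>: subtracting the conjugate equation gives
        \<open>t = (y - cnj y) / (x0 - cnj x0)\<close>, and \<open>w\<close> is that inverse modulo
        \<open>P\<close>.\<close>
      define t where "t = (y - cnj y) * w"
      define s where "s = y - x0 * t"
      note R = y x0(1) x0' w(1) cnj_R[OF y] cnj_R[OF w(1)]
      have tR: "t \<in> L.R" unfolding t_def by (intro L.R_mult L.R_diff R)
      have sR: "s \<in> L.R" unfolding s_def by (intro L.R_mult L.R_diff R tR)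
      define e where "e = (x0 - cnj x0) * w - 1"
      have e: "e \<in> P" using w(2) by (simp add: e_def)
      \<comment> \<open>Conjugation negates \<open>x0 - cnj x0\<close>, so it must negate its
        inverse \<open>w\<close> modulo \<open>P\<close>; this makes \<open>t\<close> fixed.\<close>
      have "(x0 - cnj x0) * (w + cnj w) \<in> P"
      proof -
        have "e - cnj e = (x0 - cnj x0) * (w + cnj w)" by (simp add: e_def algebra_simps)
        moreover have "e - cnj e \<in> P" by (rule P_diff[OF e cnj_P[OF e]])
        ultimately show ?thesis by simp
      qed
      then have ww: "w + cnj w \<in> P"
        using P_prime[OF x0'(2) L.R_add[OF w(1) cnj_R[OF w(1)]]] x0(2) by blast
      have "t - cnj t = (y - cnj y) * (w + cnj w)" by (simp add: t_def algebra_simps)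
      moreover have "(y - cnj y) * (w + cnj w) \<in> P" by (rule P_mult[OF L.R_diff[OF y cnj_R[OF y]] ww])
      ultimately have t: "t - cnj t \<in> P" by simp
      have "s - cnj s = - (y - cnj y) * e - cnj x0 * (t - cnj t)"
        by (simp add: s_def t_def e_def algebra_simps)
      moreover have "- (y - cnj y) * e - cnj x0 * (t - cnj t) \<in> P"
        by (rule P_diff[OF P_mult[OF L.R_uminus[OF L.R_diff[OF y cnj_R[OF y]]] e] P_mult[OF x0'(1) t]])
      ultimately have s: "s - cnj s \<in> P" by simp
      have F: "coset s \<in> F0" "coset t \<in> F0" using s t sR tR by (auto simp: F0_def)
      note rst = r[OF F0_sub[OF F(1)]] r[OF F0_sub[OF F(2)]]
      have rst': "r (coset s) - s \<in> P" "r (coset t) - t \<in> P"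
        using coset_eq_iff[OF rst(1) sR] coset_eq_iff[OF rst(3) tR] rst(2,4) by blast+
      have "(r (coset s) - s) + x0 * (r (coset t) - t) \<in> P"
        by (rule P_add[OF rst'(1) P_mult[OF x0(1) rst'(2)]])
      moreover have "(r (coset s) - s) + x0 * (r (coset t) - t) = (r (coset s) + x0 * r (coset t)) - y"
        by (simp add: s_def algebra_simps)
      ultimately have "(r (coset s) + x0 * r (coset t)) - y \<in> P" by simp
      then have "h (coset s, coset t) = coset y"
        using coset_eq_iff[OF hR[OF F] y] by (simp add: h_def)
      then show "coset y \<in> h ` (F0 \<times> F0)" using F by (intro image_eqI[of _ _ "(coset s, coset t)"]) simp_all
    qed
  qed
  then have card: "card (coset ` L.R) = card F0 ^ 2"
    using bij_betw_same_card by (force simp: card_cartesian_product power2_eq_square)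
  obtain p :: nat where p: "Factorial_Ring.prime p" "of_nat p \<in> P" using prime_number_in_P by blast
  have eq: "p ^ residue_degree L \<rat> P = card F0 ^ 2" using card card_residue_field[OF p] by simp
  have "card F0 \<noteq> 0" using eq prime_gt_0_nat[OF p(1)] by (intro notI) simp
  \<comment> \<open>Comparing the exponents of \<open>p\<close> in \<open>p^f = (card F0)^2\<close>
    shows that \<open>f\<close> is even.\<close>
  then have "residue_degree L \<rat> P = 2 * multiplicity p (card F0)"
    using arg_cong[OF eq, of "multiplicity p"] p(1) prime_gt_1_nat[OF p(1)]
    by (simp add: prime_elem_multiplicity_power_distrib multiplicity_same_power')
  then show False using odd_deg by simp
qed

lemma norm_ideal_P:
  assumes deg: "residue_degree L \<rat> P = (l - 1) div 2" and odd_deg: "odd ((l - 1) div 2)"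
    and l: "of_nat l \<notin> P" and p: "Factorial_Ring.prime (p::nat)" "of_nat p \<in> P"
  shows "norm_ideal P = scaled (of_nat p) L.R"
proof -
  have p0: "p > 0" by (rule prime_gt_0_nat[OF p(1)])
  have neq: "cnj ` P \<noteq> P" by (rule cnj_P_neq[OF _ l]) (unfold deg, rule odd_deg)
  have "\<not> cnj ` P \<subseteq> P"
  proof
    assume sub: "cnj ` P \<subseteq> P"
    then have "cnj ` cnj ` P \<subseteq> cnj ` P" by (rule image_mono)
    then have "P \<subseteq> cnj ` P" by (simp only: cnj_image_cnj_image)
    then show False using sub neq by blast
  qed
  then obtain y where y: "y \<in> P" "cnj y \<notin> P" by blast
  obtain w where w: "w \<in> L.R" "cnj y * w - 1 \<in> P"
    using inverse_mod_P[OF cnj_R[OF P_R[OF y(1)]] y(2)] by blast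
  \<comment> \<open>An idempotent of the Chinese remainder theorem: \<open>e\<close> is congruent to
    1 modulo \<open>P\<close> and lies in the conjugate of \<open>P\<close>.\<close>
  define e where "e = cnj y * w"
  have eR: "e \<in> L.R" unfolding e_def by (intro L.R_mult cnj_R P_R y w)
  have "e - 1 \<in> P" using w by (simp add: e_def)
  then have e1: "1 - e \<in> P" using P_uminus[of "e - 1"] by simp
  have ce: "cnj e \<in> P" using P_mult_right[OF y(1) cnj_R[OF w(1)]] by (simp add: e_def)
  define \<phi> where "\<phi> x = (coset x, coset (cnj x))" for x
  have surj: "\<phi> ` reps p = coset ` L.R \<times> coset ` L.R"
  proof
    show "\<phi> ` reps p \<subseteq> coset ` L.R \<times> coset ` L.R"
      using reps_R cnj_R by (auto simp: \<phi>_def)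
    show "coset ` L.R \<times> coset ` L.R \<subseteq> \<phi> ` reps p"
    proof
      fix Y assume "Y \<in> coset ` L.R \<times> coset ` L.R"
      then obtain a b where a: "a \<in> L.R" and b: "b \<in> L.R" and Y: "Y = (coset a, coset b)" by blast
      \<comment> \<open>Congruent to \<open>a\<close> modulo \<open>P\<close>, while its conjugate
        is congruent to \<open>b\<close> modulo \<open>P\<close>.\<close>
      define x where "x = a * e + cnj b * (1 - e)"
      have x: "x \<in> L.R" unfolding x_def by (intro L.R_add L.R_mult L.R_diff L.R_one cnj_R a b eR)
      obtain r z where r: "r \<in> reps p" "z \<in> L.R" "x = r + of_nat p * z"
        using reps_cover[OF x p0] by blast
      have "r - a = (cnj b - a) * (1 - e) - of_nat p * z" using r(3) by (simp add: x_def algebra_simps)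
      moreover have "(cnj b - a) * (1 - e) - of_nat p * z \<in> P"
        by (rule P_diff[OF P_mult[OF L.R_diff[OF cnj_R[OF b] a] e1] P_mult_right[OF p(2) r(2)]])
      ultimately have 1: "r - a \<in> P" by simp
      have r': "cnj r = cnj x - of_nat p * cnj z" using arg_cong[OF r(3), of cnj] by simp
      have "cnj r - b = (cnj a - b) * cnj e - of_nat p * cnj z"
        unfolding r' by (simp add: x_def algebra_simps)
      moreover have "(cnj a - b) * cnj e - of_nat p * cnj z \<in> P"
        by (rule P_diff[OF P_mult[OF L.R_diff[OF cnj_R[OF a] b] ce] P_mult_right[OF p(2) cnj_R[OF r(2)]]])
      ultimately have 2: "cnj r - b \<in> P" by simp
      have "\<phi> r = Y"
        using 1 2 coset_eq_iff[OF reps_R[OF r(1)] a] coset_eq_iff[OF cnj_R[OF reps_R[OF r(1)]] b]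
        by (simp add: \<phi>_def Y)
      then show "Y \<in> \<phi> ` reps p" using r(1) by blast
    qed
  qed
  \<comment> \<open>The target of the surjection has \<open>p^(2 f) = p^(l - 1)\<close> elements, at
    least as many as there are representatives, so \<open>\<phi>\<close> is injective. The common
    part of \<open>P\<close> and its conjugate then reduces to the representative 0.\<close>
  have "(l - 1) div 2 + (l - 1) div 2 = l - 1" using odd l_gt_1 by (auto elim!: oddE)
  then have "card (coset ` L.R \<times> coset ` L.R) = p ^ (l - 1)"
    by (simp add: card_cartesian_product card_residue_field[OF p] deg flip: power_add)
  then have "card (\<phi> ` reps p) = card (reps p)"
    using card_reps[of p] card_image_le[OF finite_reps, of \<phi> p] unfolding surj by simp
  then have inj: "inj_on \<phi> (reps p)" by (rule eq_card_imp_inj_on[OF finite_reps])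
  have inter: "x \<in> scaled (of_nat p) L.R" if x: "x \<in> P" "cnj x \<in> P" for x
  proof -
    obtain r z where r: "r \<in> reps p" "z \<in> L.R" "x = r + of_nat p * z"
      using reps_cover[OF P_R[OF x(1)] p0] by blast
    have "r = x - of_nat p * z" using r(3) by simp
    then have "r - 0 \<in> P" "cnj r - 0 \<in> P"
      using P_diff[OF x(1) P_mult_right[OF p(2) r(2)]] P_diff[OF x(2) P_mult_right[OF p(2) cnj_R[OF r(2)]]]
      by simp_all
    then have "\<phi> r = \<phi> 0"
      using coset_eq_iff[OF reps_R[OF r(1)] L.R_zero] coset_eq_iff[OF cnj_R[OF reps_R[OF r(1)]] L.R_zero]
      by (simp add: \<phi>_def)
    then have "r = 0" using inj r(1) zero_reps[OF p0] by (auto dest: inj_onD)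
    then show ?thesis using r(2,3) by (intro image_eqI[OF _ r(2)]) simp
  qed
  show ?thesis
  proof
    show "norm_ideal P \<subseteq> scaled (of_nat p) L.R"
      unfolding norm_ideal_def
    proof (rule ideal_mult_subsetI)
      fix i j assume i: "i \<in> P" and "j \<in> cnj ` P"
      then obtain k where k: "k \<in> P" "j = cnj k" by blast
      show "i * j \<in> scaled (of_nat p) L.R"
        using P_mult_right[OF i cnj_R[OF P_R[OF k(1)]]] P_mult_right[OF k(1) cnj_R[OF P_R[OF i]]]
        by (intro inter) (simp_all add: k(2) mult.commute)
    next
      fix a b assume "a \<in> scaled (of_nat p) L.R" "b \<in> scaled (of_nat p) L.R"
      then show "a + b \<in> scaled (of_nat p) L.R"
        by (auto simp: distrib_left[symmetric] intro!: imageI L.R_add)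
    qed
    have pe: "of_nat p \<in> norm_ideal P"
    proof -
      \<comment> \<open>\<open>p = p e + (1 - e) p\<close>: the first factors lie in
        \<open>P\<close>, the second ones in its conjugate.\<close>
      have "of_nat p * e \<in> norm_ideal P"
        unfolding norm_ideal_def using p(2) imageI[OF ce, of cnj] by (intro ideal_mult_prod) simp_all
      moreover have "(1 - e) * of_nat p \<in> norm_ideal P"
        unfolding norm_ideal_def using e1 imageI[OF p(2), of cnj] by (intro ideal_mult_prod) simp_all
      ultimately have "of_nat p * e + (1 - e) * of_nat p \<in> norm_ideal P"
        unfolding norm_ideal_def by (rule ideal_mult_sum)
      then show ?thesis by (simp add: algebra_simps)
    qed
    show "scaled (of_nat p) L.R \<subseteq> norm_ideal P"
      using L.frac_mult[OF frac_norm_ideal[OF frac_P] _ pe] by (auto simp: mult.commute)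
  qed
qed

lemma P_real_norm_ideal:
  assumes "residue_degree L \<rat> P = (l - 1) div 2" "odd ((l - 1) div 2)"
  shows "P \<in> real_norm_ideals"
proof (cases "of_nat l \<in> P")
  case False
  obtain p :: nat where p: "Factorial_Ring.prime p" "of_nat p \<in> P" using prime_number_in_P by blast
  show ?thesis
    by (rule real_norm_idealsI[OF frac_P Lr.K_of_nat _ norm_ideal_P[OF assms False p]])
      (use prime_gt_0_nat[OF p(1)] in simp)
qed (rule real_norm_if_l_in_P)

end

theorem corollary1p8:
  fixes l :: nat and \<zeta> :: complex
  assumes "Factorial_Ring.prime l"
    and "l mod 4 = 3"
    and "primitive_root_of_unity l \<zeta>"
    and "(l - 1) div 2 \<in> R_set (rat_adjoin \<zeta>) \<rat>"
  shows "\<exists>k::nat. class_number (maximal_real_subfield (rat_adjoin \<zeta>)) = 2 ^ k"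
proof -
  have "odd l" "odd ((l - 1) div 2)" using assms(2) by presburger+
  interpret cyclotomic l \<zeta> by unfold_locales (fact assms \<open>odd l\<close>)+
  have sub: "S \<subseteq> ideal_class L ` real_norm_ideals"
    if S: "S = {ideal_class L P | P. prime_of L P \<and> unramified L \<rat> P \<and> residue_degree L \<rat> P = (l - 1) div 2}" for S
  proof
    fix c assume "c \<in> S"
    then obtain P where prm: "prime_of L P" "residue_degree L \<rat> P = (l - 1) div 2" "c = ideal_class L P"
      unfolding S by blast
    interpret cyclotomic_prime l \<zeta> P by unfold_locales (fact prm(1))
    show "c \<in> ideal_class L ` real_norm_ideals"
      unfolding prm(3) by (rule imageI[OF P_real_norm_ideal[OF prm(2) \<open>odd ((l - 1) div 2)\<close>]])
  qed
  have gen: "generate (class_group L)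
      {ideal_class L P | P. prime_of L P \<and> unramified L \<rat> P \<and> residue_degree L \<rat> P = (l - 1) div 2}
      = carrier (class_group L)"
    using assms(4) by (simp add: R_set_def)
  show ?thesis
    by (rule class_number_Lreal)
      (rule L.frac_in_subgroup_if_generating[OF gen sub[OF refl] subgroup_real_norm_ideals PI_real_norm_ideals])
qed

end
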